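(* Let $X$ be a smooth projective toric surface and $\mathcal{L}$ an ample line bundle on $X$. Then there exists a constant $C(\mathcal{L})$ such that for all line bundles $\mathcal{M}$ on $X$ with $H^0(X,\mathcal{M}) \neq 0$, $$\dim\left(\operatorname{coker}\left[H^0(X,\mathcal{L}) \otimes H^0(X,\mathcal{M}) \to H^0(X,\mathcal{L}\otimes\mathcal{M})\right]\right) \leq C(\mathcal{L}),$$ where the map is the multiplication map of sections.
   Context: A smooth projective toric surface is the toric variety $X = X(\Delta)$, over a fixed base field $k$, associated to a smooth complete fan $\Delta$ in $N_{\mathbf{R}} = N\otimes \mathbf{R}$, where $N \cong \mathbf{Z}^2$ is the lattice of co-characters of a $2$-dimensional algebraic torus. The tensor product of the spaces of sections is over $k$, dimensions are over $k$, and the multiplication map sends $s\otimes t$ to the product section $st$. *)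

theory Defs
  imports
    "HOL-Analysis.Analysis"
    "HOL-Computational_Algebra.Polynomial_Factorial"
    "HOL-Algebra.Ideal"
    "HOL-Library.Extended_Nat"
    "HOL-Library.Function_Algebras"
begin

section \<open>Smooth complete fans in the plane\<close>

text \<open>
  The lattice of co-characters is \<open>N = \<int>\<^sup>2\<close>, and \<open>N\<^sub>R = \<real>\<^sup>2\<close>. The dual lattice of characters is
  identified with \<open>\<int>\<^sup>2\<close> as well, the pairing being the standard inner product.
\<close>

definition lat :: "int \<times> int \<Rightarrow> real \<times> real" where
  "lat m = (real_of_int (fst m), real_of_int (snd m))"

text \<open>A cone that is rational, polyhedral and contains no line.\<close>

definition rational_cone :: "(real \<times> real) set \<Rightarrow> bool" where
  "rational_cone \<sigma> \<longleftrightarrow>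
     (\<exists>B. finite B \<and> \<sigma> = convex_cone hull (lat ` B)) \<and> \<sigma> \<inter> uminus ` \<sigma> = {0}"

definition cone_face :: "(real \<times> real) set \<Rightarrow> (real \<times> real) set \<Rightarrow> bool" where
  "cone_face \<tau> \<sigma> \<longleftrightarrow> (\<exists>u. (\<forall>v\<in>\<sigma>. 0 \<le> inner u v) \<and> \<tau> = {v \<in> \<sigma>. inner u v = 0})"

definition fan :: "(real \<times> real) set set \<Rightarrow> bool" where
  "fan \<Delta> \<longleftrightarrow> finite \<Delta> \<and> \<Delta> \<noteq> {} \<and> (\<forall>\<sigma>\<in>\<Delta>. rational_cone \<sigma>) \<and>
     (\<forall>\<sigma>\<in>\<Delta>. \<forall>\<tau>. cone_face \<tau> \<sigma> \<longrightarrow> \<tau> \<in> \<Delta>) \<and>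
     (\<forall>\<sigma>\<in>\<Delta>. \<forall>\<tau>\<in>\<Delta>. cone_face (\<sigma> \<inter> \<tau>) \<sigma> \<and> cone_face (\<sigma> \<inter> \<tau>) \<tau>)"

definition complete_fan :: "(real \<times> real) set set \<Rightarrow> bool" where
  "complete_fan \<Delta> \<longleftrightarrow> fan \<Delta> \<and> \<Union>\<Delta> = UNIV"

definition lattice_basis :: "int \<times> int \<Rightarrow> int \<times> int \<Rightarrow> bool" where
  "lattice_basis v w \<longleftrightarrow>
     bij (\<lambda>(a, b). (a * fst v + b * fst w, a * snd v + b * snd w))"

definition smooth_cone :: "(real \<times> real) set \<Rightarrow> bool" where
  "smooth_cone \<sigma> \<longleftrightarrow>
     (\<exists>v w B. lattice_basis v w \<and> B \<subseteq> {v, w} \<and> \<sigma> = convex_cone hull (lat ` B))"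

definition smooth_complete_fan :: "(real \<times> real) set set \<Rightarrow> bool" where
  "smooth_complete_fan \<Delta> \<longleftrightarrow> complete_fan \<Delta> \<and> (\<forall>\<sigma>\<in>\<Delta>. smooth_cone \<sigma>)"


section \<open>The function field and the affine charts\<close>

text \<open>
  \<open>k(x, y)\<close>, the common function field of the torus and of all its toric embeddings.
\<close>

type_synonym 'k function_field = "'k poly poly fract"

definition const :: "'k::field \<Rightarrow> 'k function_field" where
  "const c = to_fract [:[:c:]:]"

definition scale :: "'k::field \<Rightarrow> 'k function_field \<Rightarrow> 'k function_field" where
  "scale c f = const c * f"

lemma const_simps [simp]:
  "const 0 = 0" "const 1 = 1" "const (a + b) = const a + const b" "const (a * b) = const a * const b"
  by (simp_all add: const_def flip: one_pCons to_fract_add to_fract_mult)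

lemma vector_space_scale: "vector_space (scale :: 'k::field \<Rightarrow> _)"
  by unfold_locales (simp_all add: scale_def algebra_simps)

definition monomial :: "int \<times> int \<Rightarrow> ('k::field) function_field" where
  "monomial m = to_fract [:[:0, 1:]:] powi fst m * to_fract [:0, 1:] powi snd m"

text \<open>
  The semigroup algebra \<open>k[\<sigma>\<^sup>\<or> \<inter> M]\<close>, realised inside the function field.
\<close>

definition chart_ring :: "(real \<times> real) set \<Rightarrow> ('k::field) function_field set" where
  "chart_ring \<sigma> = module.span scale {monomial m | m. \<forall>v\<in>\<sigma>. 0 \<le> inner (lat m) v}"


section \<open>Toric surfaces as integral schemes\<close>

text \<open>
  A separated integral scheme with function field \<open>K\<close> is determined by the family of its local
  rings, viewed as subrings of \<open>K\<close>: distinct points have distinct local rings, and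
  \<open>O(U)\<close> is the intersection of the local rings at the points of \<open>U\<close>. A point is therefore
  represented by its local ring. In this model the gluing of two charts along the chart of their
  common face is simply the union of two sets of local rings.
\<close>

type_synonym 'k point = "'k function_field set"

definition ring_on :: "'a::comm_ring_1 set \<Rightarrow> 'a ring" where
  "ring_on A = \<lparr>carrier = A, monoid.mult = (*), one = 1, zero = 0, add = (+)\<rparr>"

definition prime_spectrum :: "'a::comm_ring_1 set \<Rightarrow> 'a set set" where
  "prime_spectrum A = {P. primeideal P (ring_on A)}"

definition localize :: "'a::field set \<Rightarrow> 'a set \<Rightarrow> 'a set" where
  "localize A P = {a / b | a b. a \<in> A \<and> b \<in> A \<and> b \<notin> P}"

definition local_rings :: "'a::field set \<Rightarrow> 'a set set" where
  "local_rings A = localize A ` prime_spectrum A"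

definition zariski_open :: "'a::field set \<Rightarrow> 'a set set \<Rightarrow> bool" where
  "zariski_open A U \<longleftrightarrow> (\<exists>I\<subseteq>A. U = localize A ` {P \<in> prime_spectrum A. \<not> I \<subseteq> P})"

definition toric_surface :: "(real \<times> real) set set \<Rightarrow> ('k::field) point set" where
  "toric_surface \<Delta> = (\<Union>\<sigma>\<in>\<Delta>. local_rings (chart_ring \<sigma>))"

lemma chart_ring_closed:
  fixes f g :: "('k::field) function_field" and c :: 'k
  shows "const c \<in> chart_ring \<sigma>"
    and "f \<in> chart_ring \<sigma> \<Longrightarrow> g \<in> chart_ring \<sigma> \<Longrightarrow> f + g \<in> chart_ring \<sigma>"
    and "f \<in> chart_ring \<sigma> \<Longrightarrow> g \<in> chart_ring \<sigma> \<Longrightarrow> f * g \<in> chart_ring \<sigma>"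
proof -
  interpret V: vector_space "scale :: 'k \<Rightarrow> _" by (rule vector_space_scale)
  let ?S = "{monomial m | m. \<forall>v\<in>\<sigma>. 0 \<le> inner (lat m) v} :: 'k function_field set"
  have [simp]: "to_fract [:[:0, 1::'k:]:] \<noteq> 0" "to_fract [:0, 1::'k poly:] \<noteq> 0"
    by (simp_all add: to_fract_eq_0_iff)
  have one: "1 \<in> ?S"
    by (rule CollectI, rule exI[of _ "(0,0)"]) (simp add: monomial_def lat_def flip: zero_prod_def)
  have mult: "a * b \<in> ?S" if ab: "a \<in> ?S" "b \<in> ?S" for a b
  proof -
    from ab obtain m n where m: "a = monomial m" "\<forall>v\<in>\<sigma>. 0 \<le> inner (lat m) v"
      and n: "b = monomial n" "\<forall>v\<in>\<sigma>. 0 \<le> inner (lat n) v" by blast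
    have "a * b = monomial (m + n)"
      by (simp add: m n monomial_def power_int_add)
    moreover have "lat (m + n) = lat m + lat n" by (simp add: lat_def)
    ultimately have "a * b = monomial (m + n) \<and> (\<forall>v\<in>\<sigma>. 0 \<le> inner (lat (m + n)) v)"
      using m(2) n(2) by (simp add: inner_add_left)
    then show ?thesis by blast
  qed
  show "const c \<in> chart_ring \<sigma>"
    using V.span_scale[OF V.span_base[OF one], of c] by (simp add: chart_ring_def scale_def)
  show "f + g \<in> chart_ring \<sigma>" if "f \<in> chart_ring \<sigma>" "g \<in> chart_ring \<sigma>"
    using that unfolding chart_ring_def by (rule V.span_add)
  show "f * g \<in> chart_ring \<sigma>" if fg: "f \<in> chart_ring \<sigma>" "g \<in> chart_ring \<sigma>"
  proof -
    have 1: "a * h \<in> V.span ?S" if a: "a \<in> ?S" and h: "h \<in> V.span ?S" for a h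
      using h
    proof (induction h rule: V.span_induct_alt)
      case base
      then show ?case by (simp add: V.span_zero)
    next
      case (step c x y)
      have "a * (scale c x + y) = scale c (a * x) + a * y"
        by (simp add: scale_def algebra_simps)
      then show ?case using mult[OF a step(1)] step(2)
        by (simp add: V.span_add V.span_scale V.span_base)
    qed
    show ?thesis
      using fg(1) unfolding chart_ring_def
    proof (induction f rule: V.span_induct_alt)
      case base
      then show ?case by (simp add: V.span_zero)
    next
      case (step c x y)
      have "(scale c x + y) * g = scale c (x * g) + y * g"
        by (simp add: scale_def algebra_simps)
      then show ?case using 1[OF step(1) fg(2)[unfolded chart_ring_def]] step(2)
        by (simp add: V.span_add V.span_scale)
    qed
  qed
qed

lemma localize_closed:
  assumes "P \<in> prime_spectrum A"
    and add: "\<And>f g. f \<in> A \<Longrightarrow> g \<in> A \<Longrightarrow> f + g \<in> A"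
    and mult: "\<And>f g. f \<in> A \<Longrightarrow> g \<in> A \<Longrightarrow> f * g \<in> A"
  shows "1 \<in> A" "A \<subseteq> localize A P"
    and "f \<in> localize A P \<Longrightarrow> g \<in> localize A P \<Longrightarrow> f + g \<in> localize A P"
    and "f \<in> localize A P \<Longrightarrow> g \<in> localize A P \<Longrightarrow> f * g \<in> localize A P"
proof -
  interpret primeideal P "ring_on A" using assms(1) by (simp add: prime_spectrum_def)
  show one: "1 \<in> A" using one_closed by (simp add: ring_on_def)
  have one': "1 \<notin> P"
    using one_imp_carrier I_notcarr by (auto simp: ring_on_def)
  have zero: "0 \<in> P" using zero_closed additive_subgroup.zero_closed[OF is_additive_subgroup]
    by (simp add: ring_on_def)
  have prime: "a * b \<notin> P" if "a \<in> A" "b \<in> A" "a \<notin> P" "b \<notin> P" for a b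
    using I_prime[of a b] that by (auto simp: ring_on_def)
  show "A \<subseteq> localize A P" using one one' unfolding localize_def by force
  show "f + g \<in> localize A P" if fg: "f \<in> localize A P" "g \<in> localize A P"
  proof -
    obtain a b c d where *: "f = a / b" "g = c / d" "a \<in> A" "b \<in> A" "b \<notin> P" "c \<in> A" "d \<in> A" "d \<notin> P"
      using fg unfolding localize_def by blast
    with zero have "b \<noteq> 0" "d \<noteq> 0" by auto
    with * have "f + g = (a * d + c * b) / (b * d)" by (simp add: add_frac_eq)
    then show ?thesis unfolding localize_def using * add mult prime by blast
  qed
  show "f * g \<in> localize A P" if fg: "f \<in> localize A P" "g \<in> localize A P"
  proof -
    obtain a b c d where *: "f = a / b" "g = c / d" "a \<in> A" "b \<in> A" "b \<notin> P" "c \<in> A" "d \<in> A" "d \<notin> P"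
      using fg unfolding localize_def by blast
    then have "f * g = (a * c) / (b * d)" by simp
    then show ?thesis unfolding localize_def using * mult prime by blast
  qed
qed

lemma local_ring_closed:
  fixes f g :: "('k::field) function_field" and c :: 'k
  assumes "x \<in> toric_surface \<Delta>"
  shows "const c \<in> x" "f \<in> x \<Longrightarrow> g \<in> x \<Longrightarrow> f + g \<in> x" "f \<in> x \<Longrightarrow> g \<in> x \<Longrightarrow> f * g \<in> x"
proof -
  obtain \<sigma> and P :: "'k function_field set"
    where P: "P \<in> prime_spectrum (chart_ring \<sigma>)" and x: "x = localize (chart_ring \<sigma>) P"
    using assms unfolding toric_surface_def local_rings_def by blast
  note * = localize_closed[OF P chart_ring_closed(2,3)]
  show "const c \<in> x" using *(2) chart_ring_closed(1) x by blast
  show "f + g \<in> x" if "f \<in> x" "g \<in> x" using that *(3) x by blast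
  show "f * g \<in> x" if "f \<in> x" "g \<in> x" using that *(4) x by blast
qed

definition X_open :: "(real \<times> real) set set \<Rightarrow> ('k::field) point set \<Rightarrow> bool" where
  "X_open \<Delta> U \<longleftrightarrow> U \<subseteq> toric_surface \<Delta> \<and>
     (\<forall>\<sigma>\<in>\<Delta>. zariski_open (chart_ring \<sigma>) (U \<inter> local_rings (chart_ring \<sigma>)))"

text \<open>
  Only meaningful for \<open>U \<noteq> {}\<close>. All sets to which it is applied below are non-empty: any two
  non-empty open subsets of an irreducible space meet.
\<close>

definition regular_functions :: "('k::field) point set \<Rightarrow> 'k function_field set" where
  "regular_functions U = \<Inter>U"

definition invertible_functions :: "('k::field) point set \<Rightarrow> 'k function_field set" where
  "invertible_functions U =
     {f. f \<noteq> 0 \<and> f \<in> regular_functions U \<and> inverse f \<in> regular_functions U}"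

text \<open>
  \<open>U\<close> is affine if it is the spectrum of its ring of functions, as a set of local rings and as a
  topological space.
\<close>

definition affine_open :: "(real \<times> real) set set \<Rightarrow> ('k::field) point set \<Rightarrow> bool" where
  "affine_open \<Delta> U \<longleftrightarrow> X_open \<Delta> U \<and> U = local_rings (regular_functions U) \<and>
     (\<forall>V\<subseteq>U. X_open \<Delta> V \<longleftrightarrow> zariski_open (regular_functions U) V)"


section \<open>Line bundles, sections, ampleness\<close>

text \<open>
  A line bundle is given by transition functions with respect to a trivialising open cover. There
  is no loss in indexing the cover by the points of \<open>X\<close>: \<open>cover L x\<close> is an open neighbourhood
  of \<open>x\<close> over which \<open>L\<close> is trivialised. A section is the family of its local expressions, with
  \<open>s\<^sub>x = g\<^sub>x\<^sub>y s\<^sub>y\<close> on the overlaps. As overlaps are non-empty and \<open>X\<close> is integral, all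
  identities between functions on overlaps are identities in the function field.
\<close>

record (overloaded) 'k line_bundle =
  cover :: "'k point \<Rightarrow> 'k point set"
  trans :: "'k point \<Rightarrow> 'k point \<Rightarrow> 'k function_field"

definition is_line_bundle :: "(real \<times> real) set set \<Rightarrow> ('k::field) line_bundle \<Rightarrow> bool" where
  "is_line_bundle \<Delta> L \<longleftrightarrow>
     (\<forall>x\<in>toric_surface \<Delta>. X_open \<Delta> (cover L x) \<and> x \<in> cover L x) \<and>
     (\<forall>x\<in>toric_surface \<Delta>. \<forall>y\<in>toric_surface \<Delta>.
        trans L x y \<in> invertible_functions (cover L x \<inter> cover L y)) \<and>
     (\<forall>x\<in>toric_surface \<Delta>. \<forall>y\<in>toric_surface \<Delta>. \<forall>z\<in>toric_surface \<Delta>.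
        trans L x y * trans L y z = trans L x z)"

definition tensor :: "('k::field) line_bundle \<Rightarrow> 'k line_bundle \<Rightarrow> 'k line_bundle" where
  "tensor L M = \<lparr>cover = (\<lambda>x. cover L x \<inter> cover M x), trans = (\<lambda>x y. trans L x y * trans M x y)\<rparr>"

definition tensor_power :: "('k::field) line_bundle \<Rightarrow> nat \<Rightarrow> 'k line_bundle" where
  "tensor_power L n = \<lparr>cover = cover L, trans = (\<lambda>x y. trans L x y ^ n)\<rparr>"

text \<open>Families of local expressions are extended by zero outside \<open>X\<close>.\<close>

type_synonym 'k section_family = "'k point \<Rightarrow> 'k function_field"

definition H0 :: "(real \<times> real) set set \<Rightarrow> ('k::field) line_bundle \<Rightarrow> 'k section_family set" where
  "H0 \<Delta> L = {s. (\<forall>x\<in>toric_surface \<Delta>. s x \<in> regular_functions (cover L x)) \<and>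
     (\<forall>x\<in>toric_surface \<Delta>. \<forall>y\<in>toric_surface \<Delta>. s x = trans L x y * s y) \<and>
     (\<forall>x. x \<notin> toric_surface \<Delta> \<longrightarrow> s x = 0)}"

lemma H0_D:
  assumes "s \<in> H0 \<Delta> L"
  shows "x \<in> toric_surface \<Delta> \<Longrightarrow> y \<in> cover L x \<Longrightarrow> s x \<in> y"
    and "x \<in> toric_surface \<Delta> \<Longrightarrow> y \<in> toric_surface \<Delta> \<Longrightarrow> s x = trans L x y * s y"
    and "x \<notin> toric_surface \<Delta> \<Longrightarrow> s x = 0"
  using assms unfolding H0_def regular_functions_def by blast+

lemma H0_I:
  assumes "\<And>x y. x \<in> toric_surface \<Delta> \<Longrightarrow> y \<in> cover L x \<Longrightarrow> s x \<in> y"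
    and "\<And>x y. x \<in> toric_surface \<Delta> \<Longrightarrow> y \<in> toric_surface \<Delta> \<Longrightarrow> s x = trans L x y * s y"
    and "\<And>x. x \<notin> toric_surface \<Delta> \<Longrightarrow> s x = 0"
  shows "s \<in> H0 \<Delta> L"
  using assms unfolding H0_def regular_functions_def by blast

text \<open>
  The open set \<open>X\<^sub>s\<close>: the points \<open>x\<close> at which the local expression of \<open>s\<close> near \<open>x\<close> is a unit
  of the local ring.
\<close>

definition nonvanishing_locus ::
  "(real \<times> real) set set \<Rightarrow> ('k::field) section_family \<Rightarrow> 'k point set" where
  "nonvanishing_locus \<Delta> s = {x \<in> toric_surface \<Delta>. s x \<noteq> 0 \<and> s x \<in> x \<and> inverse (s x) \<in> x}"

text \<open>
  \<open>X\<close> is quasi-compact, so \<open>L\<close> is ample iff the affine sets of the form \<open>X\<^sub>s\<close>, for \<open>s\<close> a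
  section of a positive power of \<open>L\<close>, cover \<open>X\<close> (the definition of EGA II.4.5 and of the Stacks
  project).
\<close>

definition ample :: "(real \<times> real) set set \<Rightarrow> ('k::field) line_bundle \<Rightarrow> bool" where
  "ample \<Delta> L \<longleftrightarrow> is_line_bundle \<Delta> L \<and>
     (\<forall>x\<in>toric_surface \<Delta>. \<exists>n\<ge>1. \<exists>s\<in>H0 \<Delta> (tensor_power L n).
        x \<in> nonvanishing_locus \<Delta> s \<and> affine_open \<Delta> (nonvanishing_locus \<Delta> s))"


section \<open>The cokernel of the multiplication map\<close>

definition sec_scale :: "'k::field \<Rightarrow> 'k section_family \<Rightarrow> 'k section_family" where
  "sec_scale c s = (\<lambda>x. scale c (s x))"

lemma vector_space_sec_scale: "vector_space (sec_scale :: 'k::field \<Rightarrow> _)"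
  by unfold_locales (auto simp add: sec_scale_def scale_def fun_eq_iff algebra_simps)

text \<open>
  The image of \<open>H\<^sup>0(L) \<otimes> H\<^sup>0(M)\<close>: as every tensor is a sum of pure tensors, this is the
  \<open>k\<close>-span of all products \<open>st\<close>.
\<close>

definition mult_image ::
  "(real \<times> real) set set \<Rightarrow> ('k::field) line_bundle \<Rightarrow> 'k line_bundle \<Rightarrow> 'k section_family set" where
  "mult_image \<Delta> L M = module.span sec_scale {s * t | s t. s \<in> H0 \<Delta> L \<and> t \<in> H0 \<Delta> M}"

lemma tensor_simps [simp]:
  "cover (tensor L M) x = cover L x \<inter> cover M x"
  "trans (tensor L M) x y = trans L x y * trans M x y"
  by (simp_all add: tensor_def)

lemma cover_subset:
  assumes "is_line_bundle \<Delta> L" "x \<in> toric_surface \<Delta>" "y \<in> cover L x"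
  shows "y \<in> toric_surface \<Delta>"
  using assms unfolding is_line_bundle_def X_open_def by blast

lemma subspace_H0:
  fixes L :: "('k::field) line_bundle"
  assumes cov: "\<And>x y. x \<in> toric_surface \<Delta> \<Longrightarrow> y \<in> cover L x \<Longrightarrow> y \<in> toric_surface \<Delta>"
  shows "module.subspace sec_scale (H0 \<Delta> L)"
proof -
  interpret V: vector_space "sec_scale :: 'k \<Rightarrow> _" by (rule vector_space_sec_scale)
  show ?thesis
    unfolding V.subspace_def
  proof (intro conjI ballI allI)
    have "0 \<in> y" if "y \<in> toric_surface \<Delta>" for y :: "'k point"
      using local_ring_closed(1)[OF that, of 0] by simp
    then show "0 \<in> H0 \<Delta> L"
      by (intro H0_I) (auto intro: cov)
  next
    fix s t assume s: "s \<in> H0 \<Delta> L" and t: "t \<in> H0 \<Delta> L"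
    show "s + t \<in> H0 \<Delta> L"
    proof (rule H0_I)
      fix x y assume "x \<in> toric_surface \<Delta>" "y \<in> cover L x"
      then show "(s + t) x \<in> y"
        unfolding plus_fun_apply by (intro local_ring_closed(2)[OF cov] H0_D(1)[OF s] H0_D(1)[OF t])
    next
      fix x y :: "'k point" assume xy: "x \<in> toric_surface \<Delta>" "y \<in> toric_surface \<Delta>"
      show "(s + t) x = trans L x y * (s + t) y"
        unfolding plus_fun_apply distrib_left
        by (rule arg_cong2[of _ _ _ _ "(+)", OF H0_D(2)[OF s xy] H0_D(2)[OF t xy]])
    qed (simp add: H0_D(3)[OF s] H0_D(3)[OF t])
  next
    fix c s assume s: "s \<in> H0 \<Delta> L"
    show "sec_scale c s \<in> H0 \<Delta> L"
    proof (rule H0_I)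
      fix x y assume "x \<in> toric_surface \<Delta>" "y \<in> cover L x"
      then show "sec_scale c s x \<in> y"
        unfolding sec_scale_def scale_def
        by (intro local_ring_closed(3)[OF cov] local_ring_closed(1)[OF cov] H0_D(1)[OF s])
    next
      fix x y :: "'k point" assume xy: "x \<in> toric_surface \<Delta>" "y \<in> toric_surface \<Delta>"
      show "sec_scale c s x = trans L x y * sec_scale c s y"
        unfolding sec_scale_def scale_def by (subst H0_D(2)[OF s xy]) (rule mult.left_commute)
    qed (simp add: sec_scale_def scale_def H0_D(3)[OF s])
  qed
qed

lemma times_in_H0_tensor:
  fixes L M :: "('k::field) line_bundle"
  assumes "is_line_bundle \<Delta> L" and s: "s \<in> H0 \<Delta> L" and t: "t \<in> H0 \<Delta> M"
  shows "s * t \<in> H0 \<Delta> (tensor L M)"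
proof (rule H0_I)
  fix x y assume "x \<in> toric_surface \<Delta>" "y \<in> cover (tensor L M) x"
  then have *: "x \<in> toric_surface \<Delta>" "y \<in> cover L x" "y \<in> cover M x" by simp_all
  show "(s * t) x \<in> y"
    unfolding times_fun_apply
    by (intro local_ring_closed(3)[OF cover_subset[OF assms(1) *(1,2)]] H0_D(1)[OF s] H0_D(1)[OF t] *)
next
  fix x y :: "'k point" assume xy: "x \<in> toric_surface \<Delta>" "y \<in> toric_surface \<Delta>"
  have "s x * t x = (trans L x y * s y) * (trans M x y * t y)"
    by (rule arg_cong2[of _ _ _ _ "(*)", OF H0_D(2)[OF s xy] H0_D(2)[OF t xy]])
  then show "(s * t) x = trans (tensor L M) x y * (s * t) y"
    by (simp add: ac_simps)
qed (simp add: H0_D(3)[OF s])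

text \<open>The multiplication of sections does take values in \<open>H\<^sup>0(L \<otimes> M)\<close>.\<close>

lemma mult_image_subset:
  fixes L M :: "('k::field) line_bundle"
  assumes "is_line_bundle \<Delta> L"
  shows "mult_image \<Delta> L M \<subseteq> H0 \<Delta> (tensor L M)"
proof -
  interpret V: vector_space "sec_scale :: 'k \<Rightarrow> _" by (rule vector_space_sec_scale)
  have "V.subspace (H0 \<Delta> (tensor L M))"
    by (rule subspace_H0) (auto intro: cover_subset[OF assms])
  then show ?thesis
    unfolding mult_image_def by (intro V.span_minimal) (auto intro: times_in_H0_tensor[OF assms])
qed

text \<open>
  \<open>dim V/W \<in> \<nat> \<union> {\<infinity>}\<close>, as the supremum of the sizes of finite subsets of \<open>V\<close> whose elements
  are linearly independent modulo \<open>W\<close>.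
\<close>

definition quotient_dim ::
  "('k::field \<Rightarrow> 'v \<Rightarrow> 'v) \<Rightarrow> 'v::ab_group_add set \<Rightarrow> 'v set \<Rightarrow> enat" where
  "quotient_dim sc V W = (SUP B \<in> {B. finite B \<and> B \<subseteq> V \<and>
     (\<forall>c. (\<Sum>b\<in>B. sc (c b) b) \<in> W \<longrightarrow> (\<forall>b\<in>B. c b = 0))}. enat (card B))"

definition coker_dim ::
  "(real \<times> real) set set \<Rightarrow> ('k::field) line_bundle \<Rightarrow> 'k line_bundle \<Rightarrow> enat" where
  "coker_dim \<Delta> L M = quotient_dim sec_scale (H0 \<Delta> (tensor L M)) (mult_image \<Delta> L M)"

end

theory Submission
  imports Defs "HOL-Computational_Algebra.Field_as_Ring"
begin

text \<open>
  Because the charts are spectra of localisations of the factorial ring \<open>k[x, y]\<close>, every line bundle is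
  isomorphic to that of a torus invariant divisor \<open>\<Sum> b\<^sub>v D\<^sub>v\<close>. Its sections are spanned by the Laurent
  monomials with exponents in \<open>P\<^sub>b = {m. \<langle>m, v\<rangle> \<ge> - b\<^sub>v}\<close>, and, if \<open>a\<close> belongs to \<open>L\<close> and \<open>b\<close> to \<open>M\<close>,
  the cokernel is spanned by the lattice points \<open>m\<close> of \<open>P\<^bsub>a + b\<^esub>\<close> that are not sums of lattice points
  of \<open>P\<^sub>a\<close> and \<open>P\<^sub>b\<close>.

  For such an \<open>m\<close> and a lattice point \<open>p\<close> of \<open>P\<^sub>a\<close>, the point \<open>m - p\<close> violates one of the inequalities
  of \<open>P\<^sub>b\<close>, that is, \<open>m\<close> is closer to some edge of \<open>P\<^bsub>a + b\<^esub>\<close> than \<open>p\<close> is to the corresponding edge of \<open>P\<^sub>a\<close>;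
  this edge is not the one of \<open>v\<close> if \<open>p\<close> lies on the edge of \<open>v\<close>. Two choices of \<open>p\<close> produce two
  edges at bounded distance from \<open>m\<close>. Should these be parallel, then choosing \<open>p\<close> at a suitable height
  between them produces a third edge: as \<open>L\<close> is ample, the edges of \<open>P\<^sub>a\<close> have positive length, so \<open>P\<^sub>a\<close>
  has lattice points at all heights between two parallel edges. Since \<open>m\<close> is determined by its
  distances to two edges that are not parallel, the number of such \<open>m\<close> is bounded independently of \<open>b\<close>.
\<close>

section \<open>Lattice points of polygons\<close>

text \<open>The bound has to be uniform in \<open>b\<close>, although \<open>M\<close> need be
  neither ample nor globally generated, so its polygon may be degenerate and some of its
  inequalities may be attained nowhere. The test points \<open>p\<close> are therefore taken from
  one finite subset of the polygon of \<open>L\<close>, fixed before \<open>M\<close>. Only their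
  distances from edges enter the bound, and the constant counts quadruples of two edges and two
  small distances.

  On the geometric side the trivialising covers are arbitrary, and there are many points. The tool
  against both is a test in codimension one: a rational function outside the local ring of a point
  is already outside the valuation ring of a prime element whose divisor passes through the point.
  Questions about sections, generators and units thus concern only curves meeting the torus and
  boundary divisors. On the torus a line bundle is trivial because one function absorbs the finitely
  many primes at which a transition function may fail to be a unit; along a boundary divisor only an
  integer remains.\<close>

definition pairing :: "int \<times> int \<Rightarrow> int \<times> int \<Rightarrow> int" where
  "pairing m v = fst m * fst v + snd m * snd v"

definition det2 :: "int \<times> int \<Rightarrow> int \<times> int \<Rightarrow> int" where
  "det2 v w = fst v * snd w - snd v * fst w"

text \<open>\<open>v\<close> after a quarter turn: the direction of an edge with normal
  \<open>v\<close>, one lattice step long if \<open>v\<close> is primitive.\<close>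

definition perp :: "int \<times> int \<Rightarrow> int \<times> int" where
  "perp v = (- snd v, fst v)"

definition lattice_polygon :: "(int \<times> int) set \<Rightarrow> (int \<times> int \<Rightarrow> int) \<Rightarrow> (int \<times> int) set" where
  "lattice_polygon R c = {m. \<forall>v\<in>R. - c v \<le> pairing m v}"

lemma pairing_simps:
  "pairing (m + n) v = pairing m v + pairing n v" "pairing (m - n) v = pairing m v - pairing n v"
  "pairing (- m) v = - pairing m v" "pairing 0 v = 0" "pairing m (- v) = - pairing m v"
  by (simp_all add: pairing_def algebra_simps)

lemma pairing_perp: "pairing (perp v) w = det2 v w"
  by (simp add: pairing_def perp_def det2_def)

text \<open>The functional \<open>f\<close> makes \<open>v\<close> primitive, so
  \<open>perp v\<close> generates the lattice orthogonal to \<open>v\<close>; the coefficient of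
  \<open>d\<close> is \<open>det2 f d\<close>.\<close>

lemma pairing_eq_0D:
  assumes "pairing d v = 0" "pairing f v = 1"
  obtains k where "d = (k * fst (perp v), k * snd (perp v))"
proof
  let ?k = "fst f * snd d - snd f * fst d"
  have d: "fst d * fst v + snd d * snd v = 0" and f: "fst f * fst v + snd f * snd v = 1"
    using assms by (simp_all add: pairing_def)
  have "fst d = fst d * (fst f * fst v + snd f * snd v) - fst f * (fst d * fst v + snd d * snd v)"
    using d f by simp
  also have "\<dots> = ?k * fst (perp v)" by (simp add: perp_def algebra_simps)
  finally have 1: "fst d = ?k * fst (perp v)" .
  have "snd d = snd d * (fst f * fst v + snd f * snd v) - snd f * (fst d * fst v + snd d * snd v)"
    using d f by simp
  also have "\<dots> = ?k * snd (perp v)" by (simp add: perp_def algebra_simps)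
  finally have 2: "snd d = ?k * snd (perp v)" .
  show "d = (?k * fst (perp v), ?k * snd (perp v))" using 1 2 by (simp add: prod_eq_iff)
qed

lemma eq_if_pairings_eq:
  assumes "det2 v w \<noteq> 0" "pairing m v = pairing n v" "pairing m w = pairing n w"
  shows "m = n"
proof -
  let ?x = "fst m - fst n" and ?y = "snd m - snd n"
  have 1: "?x * fst v + ?y * snd v = 0" "?x * fst w + ?y * snd w = 0"
    using assms(2,3) by (simp_all add: pairing_def algebra_simps)
  have "?x * det2 v w = (?x * fst v + ?y * snd v) * snd w - (?x * fst w + ?y * snd w) * snd v"
    "?y * det2 v w = (?x * fst w + ?y * snd w) * fst v - (?x * fst v + ?y * snd v) * fst w"
    by (simp_all add: det2_def algebra_simps)
  then have "?x * det2 v w = 0" "?y * det2 v w = 0" using 1 by simp_all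
  then show ?thesis using assms(1) by (simp add: prod_eq_iff)
qed

text \<open>Two distinct lattice points of the edge differ by a nonzero multiple of
  \<open>perp v\<close>, as \<open>v\<close> is primitive. Every inequality is affine along the
  edge, so one step from one of the points towards the other stays in the polygon.\<close>

lemma unit_edge:
  assumes f: "pairing f v = 1"
    and p: "p \<in> lattice_polygon R a" and q: "q \<in> lattice_polygon R a" and "p \<noteq> q"
    and eq: "pairing p v = - a v" "pairing q v = - a v"
  shows "\<exists>p \<in> lattice_polygon R a. p + perp v \<in> lattice_polygon R a \<and> pairing p v = - a v"
proof -
  have *: "p + perp v \<in> lattice_polygon R a"
    if p: "p \<in> lattice_polygon R a" and q: "q \<in> lattice_polygon R a"
      and k: "q - p = (k * fst (perp v), k * snd (perp v))" "k > 0" for p q k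
    unfolding lattice_polygon_def
  proof (intro CollectI ballI)
    fix l assume l: "l \<in> R"
    have "pairing (q - p) l = k * pairing (perp v) l"
      unfolding k(1) by (simp add: pairing_def algebra_simps)
    then have 1: "pairing q l = pairing p l + k * pairing (perp v) l"
      by (simp add: pairing_simps)
    have 2: "- a l \<le> pairing p l" "- a l \<le> pairing q l" using p q l by (auto simp: lattice_polygon_def)
    have "- a l \<le> pairing p l + pairing (perp v) l"
    proof (cases "pairing (perp v) l \<ge> 0")
      case False
      then have "k * pairing (perp v) l \<le> 1 * pairing (perp v) l"
        using k(2) by (intro mult_right_mono_neg) auto
      then show ?thesis using 1 2 by simp
    qed (use 2 in simp)
    then show "- a l \<le> pairing (p + perp v) l" by (simp add: pairing_simps)
  qed
  have "pairing (q - p) v = 0" using eq by (simp add: pairing_simps)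
  then obtain k where k: "q - p = (k * fst (perp v), k * snd (perp v))"
    using f by (rule pairing_eq_0D)
  then have k': "p - q = ((-k) * fst (perp v), (-k) * snd (perp v))" by (auto simp: prod_eq_iff)
  have "k \<noteq> 0" using k \<open>p \<noteq> q\<close> by (auto simp: prod_eq_iff)
  then consider "k > 0" | "- k > 0" by linarith
  then show ?thesis
  proof cases
    case 1 then show ?thesis using *[OF p q k] p eq by blast
  next
    case 2 then show ?thesis using *[OF q p k'] q eq by blast
  qed
qed

text \<open>The unit segments in direction \<open>perp v\<close> at \<open>w\<close> and
  \<open>z\<close> span a parallelogram all of whose points satisfy the inequalities. Its slice at
  height \<open>h\<close> is a translate of such a segment on a line containing lattice points, so
  it contains one itself.\<close>

lemma lattice_point_at_height:
  assumes v: "v \<in> R" "- v \<in> R" and f: "pairing f v = 1"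
    and w: "w \<in> lattice_polygon R a" "w + perp v \<in> lattice_polygon R a" "pairing w v = - a v"
    and z: "z \<in> lattice_polygon R a" "z + perp v \<in> lattice_polygon R a" "pairing z v = a (- v)"
    and h: "- a v \<le> h" "h \<le> a (- v)"
  shows "\<exists>p \<in> lattice_polygon R a. pairing p v = h"
proof (cases "h = - a v")
  case True then show ?thesis using w by blast
next
  case False
  define n where "n = a v + a (- v)"
  define h' where "h' = h + a v"
  have n: "n > 0" "0 \<le> h'" "h' \<le> n" using False h by (simp_all add: n_def h'_def)
  \<comment> \<open>\<open>n\<close> is the distance between the parallel edges, and
    \<open>N\<close> is \<open>n\<close> times the point at height \<open>h\<close> on the segment
    from \<open>w\<close> to \<open>z\<close>; the scaling keeps everything integral.\<close>
  define N where "N = ((n - h') * fst w + h' * fst z, (n - h') * snd w + h' * snd z)"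
  have pN: "pairing N l = (n - h') * pairing w l + h' * pairing z l" for l
    by (simp add: N_def pairing_def algebra_simps)
  have "pairing (N - (n * h * fst f, n * h * snd f)) v = pairing N v - n * h * pairing f v"
    by (simp add: pairing_def algebra_simps)
  also have "\<dots> = 0" using f w(3) z(3) by (simp add: pN n_def h'_def algebra_simps)
  finally obtain x where x: "N - (n * h * fst f, n * h * snd f) = (x * fst (perp v), x * snd (perp v))"
    using f by (rule pairing_eq_0D)
  \<comment> \<open>\<open>y\<close> is \<open>x / n\<close> rounded up. So \<open>q\<close> is the
    point \<open>N / n\<close> moved by the fraction \<open>r / n\<close> of \<open>perp v\<close>,
    and it stays in the slice because \<open>r\<close> is between \<open>0\<close> and
    \<open>n\<close>.\<close>
  define y where "y = - ((- x) div n)"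
  define r where "r = n * y - x"
  have "r = (- x) mod n" by (simp add: r_def y_def minus_div_mult_eq_mod[symmetric] algebra_simps)
  then have r: "0 \<le> r" "r \<le> n" using n by (simp_all add: order_less_imp_le)
  define q where "q = (h * fst f + y * fst (perp v), h * snd f + y * snd (perp v))"
  have pq: "n * pairing q l = pairing N l + r * pairing (perp v) l" for l
  proof -
    have "pairing N l - n * h * pairing f l = pairing (N - (n * h * fst f, n * h * snd f)) l"
      by (simp add: pairing_def algebra_simps)
    also have "\<dots> = x * pairing (perp v) l" unfolding x by (simp add: pairing_def algebra_simps)
    finally have "pairing N l = n * h * pairing f l + x * pairing (perp v) l" by simp
    moreover have "pairing q l = h * pairing f l + y * pairing (perp v) l"
      by (simp add: q_def pairing_def algebra_simps)
    ultimately show ?thesis by (simp add: r_def algebra_simps)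
  qed
  have "q \<in> lattice_polygon R a"
    unfolding lattice_polygon_def
  proof (intro CollectI ballI)
    fix l assume l: "l \<in> R"
    define A B E where "A = pairing w l + a l" and "B = pairing z l + a l" and "E = pairing (perp v) l"
    have AB: "0 \<le> A" "0 \<le> A + E" "0 \<le> B" "0 \<le> B + E"
      using w(1,2) z(1,2) l by (auto simp: lattice_polygon_def pairing_simps A_def B_def E_def)
    have eq: "n * (pairing q l + a l) = (n - h') * A + h' * B + r * E"
      using pq[of l] by (simp add: A_def B_def E_def pN algebra_simps)
    have "0 \<le> (n - h') * A + h' * B + r * E"
    proof (cases "E \<ge> 0")
      case True then show ?thesis using AB n r by simp
    next
      case False
      \<comment> \<open>Here \<open>perp v\<close> decreases the form, so the estimate starts from
        the other ends of the two unit segments.\<close>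
      have "(n - h') * A + h' * B + r * E = (n - h') * (A + E) + h' * (B + E) + (n - r) * (- E)"
        by (simp add: algebra_simps)
      also have "\<dots> \<ge> 0" using mult_nonneg_nonneg[of "n - h'" "A + E"] mult_nonneg_nonneg[of h' "B + E"]
          mult_nonneg_nonneg[of "n - r" "- E"] False AB n r by linarith
      finally show ?thesis .
    qed
    then have "0 \<le> pairing q l + a l" using eq n(1) by (metis zero_le_mult_iff not_less)
    then show "- a l \<le> pairing q l" by simp
  qed
  moreover have "pairing q v = h * pairing f v + y * pairing (perp v) v"
    by (simp add: q_def pairing_def algebra_simps)
  then have "pairing q v = h" using f by (simp add: pairing_perp det2_def)
  ultimately show ?thesis by blast
qed

text \<open>The combinatorial core. \<open>par\<close> and \<open>prim\<close> express that
  \<open>R\<close> consists of primitive vectors, and \<open>edge\<close>, the positive length of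
  all edges, is what ampleness contributes. \<open>C\<close> is chosen before
  \<open>b\<close>.\<close>

lemma finitely_many_non_sums:
  fixes R :: "(int \<times> int) set"
  assumes fin: "finite R" and ne: "R \<noteq> {}"
    and par: "\<And>v w. v \<in> R \<Longrightarrow> w \<in> R \<Longrightarrow> v \<noteq> w \<Longrightarrow> det2 v w = 0 \<Longrightarrow> w = - v"
    and prim: "\<And>v. v \<in> R \<Longrightarrow> \<exists>f. pairing f v = 1"
    and edge: "\<And>v. v \<in> R \<Longrightarrow> \<exists>p\<in>lattice_polygon R a. \<exists>q\<in>lattice_polygon R a.
                  p \<noteq> q \<and> pairing p v = - a v \<and> pairing q v = - a v"
  shows "\<exists>C. \<forall>b. lattice_polygon R b \<noteq> {} \<longrightarrow>
     finite (lattice_polygon R (\<lambda>v. a v + b v) - {p + q | p q. p \<in> lattice_polygon R a \<and> q \<in> lattice_polygon R b}) \<and>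
     card (lattice_polygon R (\<lambda>v. a v + b v) - {p + q | p q. p \<in> lattice_polygon R a \<and> q \<in> lattice_polygon R b}) \<le> C"
proof -
  let ?P = "lattice_polygon R"
  have "\<exists>p\<in>?P a. pairing p v = - a v" if "v \<in> R" for v using edge[OF that] by blast
  then obtain pv where pv: "\<And>v. v \<in> R \<Longrightarrow> pv v \<in> ?P a \<and> pairing (pv v) v = - a v" by metis
  have "\<exists>p\<in>?P a. pairing p v = h"
    if v: "v \<in> R" "- v \<in> R" and h: "- a v \<le> h" "h \<le> a (- v)" for v h
  proof -
    obtain f where f: "pairing f v = 1" using prim[OF \<open>v \<in> R\<close>] by blast
    then have f': "pairing (- f) (- v) = 1" by (simp add: pairing_simps)
    obtain w where w: "w \<in> ?P a" "w + perp v \<in> ?P a" "pairing w v = - a v"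
      using edge[OF v(1)] unit_edge[OF f] by metis
    obtain z where z: "z \<in> ?P a" "z + perp (- v) \<in> ?P a" "pairing z (- v) = - a (- v)"
      using edge[OF v(2)] unit_edge[OF f'] by metis
    have e: "perp (- v) = - perp v" by (simp add: perp_def)
    have "pairing (z + perp (- v)) v = a (- v)"
      using z(3) by (simp add: pairing_simps pairing_perp e det2_def)
    moreover have "z + perp (- v) + perp v \<in> ?P a" using z(1) by (simp add: e)
    ultimately show ?thesis
      using lattice_point_at_height[OF v f w z(2)] h by blast
  qed
  then obtain ph where ph: "\<And>v h. v \<in> R \<Longrightarrow> - v \<in> R \<Longrightarrow> - a v \<le> h \<Longrightarrow> h \<le> a (- v) \<Longrightarrow>
      ph v h \<in> ?P a \<and> pairing (ph v h) v = h" by metis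
  \<comment> \<open>The test points: one on each edge and, for each pair of parallel edges, one at
    each height between them. The set depends on \<open>a\<close> but not on
    \<open>b\<close>.\<close>
  define E where "E = pv ` R \<union> (\<Union>v\<in>{v\<in>R. - v \<in> R}. ph v ` {- a v..a (- v)})"
  have finE: "finite E" using fin by (auto simp: E_def)
  define K where "K = Max ((\<lambda>(p, l). pairing p l + a l) ` (E \<times> R)) + 1"
  have K: "pairing p l + a l < K" if "p \<in> E" "l \<in> R" for p l
  proof -
    have "pairing p l + a l \<le> Max ((\<lambda>(p, l). pairing p l + a l) ` (E \<times> R))"
      using that finE fin by (intro Max_ge) auto
    then show ?thesis by (simp add: K_def)
  qed
  \<comment> \<open>Counts the possible values of two edges together with two distances below
    \<open>K\<close>.\<close>
  define C where "C = card (R \<times> R \<times> {0..<K} \<times> {0..<K})"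
  have "finite D \<and> card D \<le> C"
    if b: "?P b \<noteq> {}" and D: "D = ?P (\<lambda>v. a v + b v) - {p + q | p q. p \<in> ?P a \<and> q \<in> ?P b}" for b D
  proof -
    \<comment> \<open>\<open>u m l\<close> is the distance of \<open>m\<close> from the edge of
      \<open>l\<close> in the polygon of \<open>a + b\<close>, in lattice units.\<close>
    define u where "u m l = pairing m l + a l + b l" for m l
    have near: "\<exists>l\<in>R. u m l < pairing p l + a l" if m: "m \<in> D" and p: "p \<in> ?P a" for m p
    proof (rule ccontr)
      assume *: "\<not> ?thesis"
      have "m - p \<in> ?P b"
        unfolding lattice_polygon_def
      proof (intro CollectI ballI)
        fix l assume "l \<in> R"
        then have "pairing p l + a l \<le> u m l" using * by force
        then show "- b l \<le> pairing (m - p) l" by (simp add: u_def pairing_simps)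
      qed
      then have "m = p + (m - p) \<and> p \<in> ?P a \<and> m - p \<in> ?P b" using p by simp
      then show False using m unfolding D by blast
    qed
    have u0: "0 \<le> u m l" if "m \<in> D" "l \<in> R" for m l
    proof -
      have "- (a l + b l) \<le> pairing m l" using that by (auto simp: D lattice_polygon_def)
      then show ?thesis by (simp add: u_def)
    qed
    have near2: "\<exists>i\<in>R. \<exists>l\<in>R. det2 i l \<noteq> 0 \<and> u m i < K \<and> u m l < K" if m: "m \<in> D" for m
    proof -
      have other: "\<exists>l\<in>R. l \<noteq> i \<and> u m l < K" if i: "i \<in> R" for i
      proof -
        obtain l where l: "l \<in> R" "u m l < pairing (pv i) l + a l" using near[OF m] pv[OF i] by blast
        have "pv i \<in> E" using i by (auto simp: E_def)
        then have "u m l < K" using l(2) K[OF _ l(1), of "pv i"] by simp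
        moreover have "l \<noteq> i" using l(2) pv[OF i] u0[OF m i] by auto
        ultimately show ?thesis using l(1) by blast
      qed
      obtain i0 where "i0 \<in> R" using ne by blast
      then obtain i where i: "i \<in> R" "u m i < K" using other by blast
      obtain j where j: "j \<in> R" "j \<noteq> i" "u m j < K" using other[OF i(1)] by blast
      show ?thesis
      proof (cases "det2 i j = 0")
        case False then show ?thesis using i j by blast
      next
        case True
        then have ji: "j = - i" using par i(1) j(1,2) by metis
        obtain q0 where q0: "q0 \<in> ?P b" using b by blast
        have q1: "- b i \<le> b (- i)"
        proof -
          have "- b i \<le> pairing q0 i" "- b (- i) \<le> pairing q0 (- i)"
            using q0 i(1) j(1) ji by (auto simp: lattice_polygon_def)
          then show ?thesis by (simp add: pairing_simps)
        qed
        have a1: "- a i \<le> a (- i)"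
        proof -
          have "- a (- i) \<le> pairing (pv i) (- i)" using pv[OF i(1)] j(1) ji by (auto simp: lattice_polygon_def)
          then show ?thesis using pv[OF i(1)] by (simp add: pairing_simps)
        qed
        define t where "t = pairing m i"
        have t1: "- a i - b i \<le> t" using u0[OF m i(1)] by (simp add: u_def t_def)
        have t2: "t \<le> a (- i) + b (- i)" using u0[OF m j(1)] by (simp add: u_def t_def ji pairing_simps)
        \<comment> \<open>The height \<open>t\<close> of \<open>m\<close> is split as
          \<open>(t - s) + s\<close> with \<open>t - s\<close> in the strip of \<open>a\<close> and
          \<open>s\<close> in that of \<open>b\<close>; the maximum is the least such
          \<open>s\<close>. For a test point \<open>p\<close> at height \<open>t - s\<close>, the
          difference \<open>m - p\<close> satisfies both parallel inequalities, so the violated one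
          belongs to a third edge.\<close>
        define s where "s = max (- b i) (t - a (- i))"
        have s: "- b i \<le> s" "s \<le> b (- i)" "- a i \<le> t - s" "t - s \<le> a (- i)"
          using t1 t2 q1 a1 by (auto simp: s_def)
        let ?p = "ph i (t - s)"
        have p: "?p \<in> ?P a" "pairing ?p i = t - s" using ph i(1) j(1) ji s by auto
        have "t - s \<in> {- a i..a (- i)}" "i \<in> {v \<in> R. - v \<in> R}" using i(1) j(1) ji s by simp_all
        then have pE: "?p \<in> E" unfolding E_def by blast
        obtain l where l: "l \<in> R" "u m l < pairing ?p l + a l" using near[OF m p(1)] by blast
        have "l \<noteq> i" using l(2) p(2) s by (auto simp: u_def t_def)
        moreover have "l \<noteq> - i" using l(2) p(2) s by (auto simp: u_def t_def pairing_simps)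
        ultimately have "det2 i l \<noteq> 0" using par i(1) l(1) by metis
        moreover have "u m l < K" using l(2) K[OF pE l(1)] by simp
        ultimately show ?thesis using i l(1) by blast
      qed
    qed
    then obtain gi gl where g: "\<And>m. m \<in> D \<Longrightarrow> gi m \<in> R \<and> gl m \<in> R \<and> det2 (gi m) (gl m) \<noteq> 0
        \<and> u m (gi m) < K \<and> u m (gl m) < K" by metis
    define G where "G m = (gi m, gl m, u m (gi m), u m (gl m))" for m
    have inj: "inj_on G D"
    proof (rule inj_onI)
      fix m n assume mn: "m \<in> D" "n \<in> D" "G m = G n"
      then have "pairing m (gi m) = pairing n (gi m)" "pairing m (gl m) = pairing n (gl m)"
        by (auto simp: G_def u_def)
      then show "m = n" using eq_if_pairings_eq g[OF mn(1)] by blast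
    qed
    have sub: "G ` D \<subseteq> R \<times> R \<times> {0..<K} \<times> {0..<K}"
    proof (rule image_subsetI)
      fix m assume m: "m \<in> D"
      then show "G m \<in> R \<times> R \<times> {0..<K} \<times> {0..<K}" using g[OF m] u0[OF m] by (simp add: G_def)
    qed
    have fin': "finite (R \<times> R \<times> {0..<K} \<times> {0..<K})" using fin by simp
    show ?thesis
      using inj_on_finite[OF inj sub fin'] card_inj_on_le[OF inj sub fin'] by (simp add: C_def)
  qed
  from this[OF _ refl] show ?thesis by (intro exI[of _ C] allI impI)
qed

section \<open>Localisations of factorial rings\<close>

text \<open>
  Polynomial rings over an arbitrary field are not instances of the library's class of factorial
  rings, because this class requires a normalisation on the coefficients. The field of fractions of
  a field is a copy of that field that can be equipped with one.
\<close>

instantiation fract ::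
  (idom) "{unique_euclidean_ring, normalization_euclidean_semiring, normalization_semidom_multiplicative}"
begin

definition [simp]: "normalize_fract = (normalize_field :: 'a fract \<Rightarrow> _)"
definition [simp]: "unit_factor_fract = (unit_factor_field :: 'a fract \<Rightarrow> _)"
definition [simp]: "modulo_fract = (mod_field :: 'a fract \<Rightarrow> _)"
definition [simp]: "euclidean_size_fract = (euclidean_size_field :: 'a fract \<Rightarrow> _)"
definition [simp]: "division_segment (x :: 'a fract) = 1"

instance
  by standard (simp_all add: dvd_field_iff field_split_simps split: if_splits)

end

instantiation fract :: (idom) euclidean_ring_gcd
begin

definition gcd_fract :: "'a fract \<Rightarrow> 'a fract \<Rightarrow> 'a fract" where
  "gcd_fract = Euclidean_Algorithm.gcd"
definition lcm_fract :: "'a fract \<Rightarrow> 'a fract \<Rightarrow> 'a fract" where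
  "lcm_fract = Euclidean_Algorithm.lcm"
definition Gcd_fract :: "'a fract set \<Rightarrow> 'a fract" where
  "Gcd_fract = Euclidean_Algorithm.Gcd"
definition Lcm_fract :: "'a fract set \<Rightarrow> 'a fract" where
  "Lcm_fract = Euclidean_Algorithm.Lcm"

instance
  by standard (simp_all add: gcd_fract_def lcm_fract_def Gcd_fract_def Lcm_fract_def)

end

instance fract :: (idom) field_gcd ..

section \<open>Subrings of a field, their primes and units\<close>

definition subring_set :: "'a::comm_ring_1 set \<Rightarrow> bool" where
  "subring_set A \<longleftrightarrow> 1 \<in> A \<and> (\<forall>x\<in>A. \<forall>y\<in>A. x + y \<in> A \<and> x * y \<in> A \<and> - x \<in> A)"

lemma subring_setD:
  assumes "subring_set A"
  shows "1 \<in> A" "0 \<in> A" "x \<in> A \<Longrightarrow> y \<in> A \<Longrightarrow> x + y \<in> A" "x \<in> A \<Longrightarrow> y \<in> A \<Longrightarrow> x * y \<in> A"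
    "x \<in> A \<Longrightarrow> - x \<in> A" "x \<in> A \<Longrightarrow> x ^ n \<in> A"
proof -
  show 1: "1 \<in> A" "x \<in> A \<Longrightarrow> y \<in> A \<Longrightarrow> x + y \<in> A" "x \<in> A \<Longrightarrow> - x \<in> A"
    and m: "x \<in> A \<Longrightarrow> y \<in> A \<Longrightarrow> x * y \<in> A" for x y
    using assms by (auto simp: subring_set_def)
  have "1 + - 1 \<in> A" using 1 by blast
  then show "0 \<in> A" by simp
  show "x \<in> A \<Longrightarrow> x ^ n \<in> A" by (induction n) (auto intro: 1 m)
qed

lemma cring_ring_on:
  assumes "subring_set A"
  shows "cring (ring_on A)"
proof (rule cringI)
  show "abelian_group (ring_on A)"
  proof (rule abelian_groupI)
    fix x assume "x \<in> carrier (ring_on A)"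
    then show "\<exists>y\<in>carrier (ring_on A). y \<oplus>\<^bsub>ring_on A\<^esub> x = \<zero>\<^bsub>ring_on A\<^esub>"
      by (intro bexI[of _ "- x"]) (auto simp: ring_on_def subring_setD[OF assms])
  qed (auto simp: ring_on_def subring_setD[OF assms] algebra_simps)
  show "Group.comm_monoid (ring_on A)"
    by (rule comm_monoidI) (auto simp: ring_on_def subring_setD[OF assms] algebra_simps)
qed (auto simp: ring_on_def algebra_simps)

lemma prime_spectrumI:
  assumes A: "subring_set A" and "P \<subseteq> A" "0 \<in> P" "1 \<notin> P"
    and add: "\<And>x y. x \<in> P \<Longrightarrow> y \<in> P \<Longrightarrow> x + y \<in> P"
    and mult: "\<And>x y. x \<in> A \<Longrightarrow> y \<in> P \<Longrightarrow> x * y \<in> P"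
    and prime: "\<And>x y. x \<in> A \<Longrightarrow> y \<in> A \<Longrightarrow> x * y \<in> P \<Longrightarrow> x \<in> P \<or> y \<in> P"
  shows "P \<in> prime_spectrum A"
proof -
  have cring: "cring (ring_on A)" by (rule cring_ring_on[OF A])
  interpret cring "ring_on A" by (rule cring)
  have neg: "- x \<in> P" if "x \<in> P" for x
    using mult[of "- 1" x] subring_setD[OF A] that by force
  have inv: "inv\<^bsub>add_monoid (ring_on A)\<^esub> x = - x" if "x \<in> A" for x
    using minus_equality[of "- x" x] that subring_setD(5)[OF A that]
    by (simp add: a_inv_def ring_on_def)
  have mult': "y * x \<in> P" if "x \<in> A" "y \<in> P" for x y
    using mult[OF that] by (simp add: mult.commute)
  have "additive_subgroup P (ring_on A)"
    by (intro additive_subgroupI add.subgroupI)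
      (use assms neg inv in \<open>auto simp: ring_on_def subset_iff a_inv_def\<close>)
  then have "primeideal P (ring_on A)"
    by (rule primeidealI2[OF _ cring])
      (use assms mult' subring_setD(1)[OF A] in \<open>auto simp: ring_on_def\<close>)
  then show ?thesis by (simp add: prime_spectrum_def)
qed

lemma prime_spectrumD:
  assumes "P \<in> prime_spectrum A"
  shows "P \<subseteq> A" "0 \<in> P" "1 \<notin> P" "1 \<in> A" "x \<in> P \<Longrightarrow> y \<in> P \<Longrightarrow> x + y \<in> P"
    "x \<in> A \<Longrightarrow> y \<in> P \<Longrightarrow> x * y \<in> P"
    "x \<in> A \<Longrightarrow> y \<in> A \<Longrightarrow> x * y \<in> P \<Longrightarrow> x \<in> P \<or> y \<in> P"
proof -
  interpret primeideal P "ring_on A" using assms by (simp add: prime_spectrum_def)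
  show "P \<subseteq> A" using a_subset by (simp add: ring_on_def)
  show "0 \<in> P" using additive_subgroup.zero_closed[OF is_additive_subgroup]
    by (simp add: ring_on_def)
  show "1 \<notin> P" using one_imp_carrier I_notcarr by (auto simp: ring_on_def)
  show "1 \<in> A" using one_closed by (simp add: ring_on_def)
  show "x \<in> P \<Longrightarrow> y \<in> P \<Longrightarrow> x + y \<in> P" using additive_subgroup.a_closed[OF is_additive_subgroup] by (simp add: ring_on_def)
  show "x \<in> A \<Longrightarrow> y \<in> P \<Longrightarrow> x * y \<in> P" using I_l_closed[of y x] by (simp add: ring_on_def)
  show "x \<in> A \<Longrightarrow> y \<in> A \<Longrightarrow> x * y \<in> P \<Longrightarrow> x \<in> P \<or> y \<in> P"
    using I_prime[of x y] by (simp add: ring_on_def)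
qed

text \<open>Elements of \<open>A\<close> outside \<open>P\<close> become invertible, those in
  \<open>P\<close> do not. So the prime can be recovered from its localisation, which makes
  arguments about primes available for points given as local rings.\<close>

lemma mem_prime_iff:
  fixes A :: "'a::field set"
  assumes P: "P \<in> prime_spectrum A" and "f \<in> A"
  shows "f \<in> P \<longleftrightarrow> f = 0 \<or> inverse f \<notin> localize A P"
proof (cases "f \<in> P")
  case True
  have "f = 0" if inv: "inverse f \<in> localize A P"
  proof (rule ccontr)
    assume "f \<noteq> 0"
    obtain a b where ab: "inverse f = a / b" "a \<in> A" "b \<in> A" "b \<notin> P"
      using inv unfolding localize_def by blast
    then have "b = a * f" using \<open>f \<noteq> 0\<close> prime_spectrumD(2)[OF P]
      by (auto simp: field_simps)
    then show False using prime_spectrumD(6)[OF P ab(2) True] ab by simp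
  qed
  then show ?thesis using True by blast
next
  case False
  then have "f \<noteq> 0" using prime_spectrumD(2)[OF P] by blast
  moreover have "inverse f \<in> localize A P"
    unfolding localize_def using assms(2) False prime_spectrumD(4)[OF P]
    by (intro CollectI exI[of _ 1] exI[of _ f]) (simp add: inverse_eq_divide)
  ultimately show ?thesis using False by blast
qed

lemma localize_inj:
  assumes "P \<in> prime_spectrum A" "Q \<in> prime_spectrum A" "localize A P = localize A Q"
  shows "P = Q"
  using mem_prime_iff[OF assms(1)] mem_prime_iff[OF assms(2)] assms(3)
    prime_spectrumD(1)[OF assms(1)] prime_spectrumD(1)[OF assms(2)] by blast

definition unit_in :: "'a::field set \<Rightarrow> 'a \<Rightarrow> bool" where
  "unit_in A f \<longleftrightarrow> f \<noteq> 0 \<and> f \<in> A \<and> inverse f \<in> A"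

lemma unit_in_inverse: "unit_in A f \<Longrightarrow> unit_in A (inverse f)"
  by (auto simp: unit_in_def)

definition mult_closed :: "'a::field set \<Rightarrow> bool" where
  "mult_closed A \<longleftrightarrow> 1 \<in> A \<and> (\<forall>x\<in>A. \<forall>y\<in>A. x * y \<in> A)"

lemma unit_in_mult: "mult_closed A \<Longrightarrow> unit_in A f \<Longrightarrow> unit_in A g \<Longrightarrow> unit_in A (f * g)"
  by (auto simp: unit_in_def mult_closed_def)

lemma unit_in_divide: "mult_closed A \<Longrightarrow> unit_in A f \<Longrightarrow> unit_in A g \<Longrightarrow> unit_in A (f / g)"
  using unit_in_mult[of A f "inverse g"] unit_in_inverse[of A g] by (simp add: divide_inverse)

lemma unit_in_1: "mult_closed A \<Longrightarrow> unit_in A 1"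
  by (simp add: unit_in_def mult_closed_def)

lemma unit_in_power: "mult_closed A \<Longrightarrow> unit_in A f \<Longrightarrow> unit_in A (f ^ n)"
  by (induction n) (simp_all add: unit_in_1 unit_in_mult)

lemma unit_in_powi: "mult_closed A \<Longrightarrow> unit_in A f \<Longrightarrow> unit_in A (f powi n)"
  by (auto simp: power_int_def unit_in_power unit_in_inverse)

lemma unit_in_prod:
  "mult_closed A \<Longrightarrow> (\<And>i. i \<in> I \<Longrightarrow> unit_in A (f i)) \<Longrightarrow> unit_in A (\<Prod>i\<in>I. f i)"
  by (induction I rule: infinite_finite_induct) (simp_all add: unit_in_1 unit_in_mult)

lemma unit_in_mult_cancel:
  assumes "mult_closed A" "unit_in A u"
  shows "u * f \<in> A \<longleftrightarrow> f \<in> A"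
proof
  assume "u * f \<in> A"
  then have "inverse u * (u * f) \<in> A" using assms unfolding mult_closed_def unit_in_def by blast
  then show "f \<in> A" using assms by (simp add: unit_in_def flip: mult.assoc)
qed (use assms in \<open>auto simp: mult_closed_def unit_in_def\<close>)

section \<open>Fractions over factorial rings\<close>

definition mult_set :: "'a::comm_ring_1 set \<Rightarrow> bool" where
  "mult_set S \<longleftrightarrow> 1 \<in> S \<and> 0 \<notin> S \<and> (\<forall>s\<in>S. \<forall>t\<in>S. s * t \<in> S)"

text \<open>Multiples in \<open>S\<close> of the prime factors of \<open>b\<close> are multiplied
  together. Thus \<open>b\<close> is invertible over \<open>S\<close> as soon as each of its prime
  divisors is.\<close>

lemma dvd_mult_set:
  fixes b :: "'r::factorial_ring_gcd"
  assumes S: "mult_set S" and "b \<noteq> 0"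
    and "\<And>r. prime_elem r \<Longrightarrow> r dvd b \<Longrightarrow> \<exists>s\<in>S. r dvd s"
  shows "\<exists>s\<in>S. b dvd s"
  using assms(2,3)
proof (induction b rule: prime_divisors_induct)
  case zero then show ?case by simp
next
  case (unit b) then show ?case using S by (auto simp: mult_set_def)
next
  case (factor p b)
  have "\<exists>s\<in>S. b dvd s" using factor by (intro factor.IH) auto
  moreover have "\<exists>s\<in>S. p dvd s" using factor by (intro factor.prems) auto
  ultimately obtain s t where "s \<in> S" "t \<in> S" "p dvd s" "b dvd t" by blast
  then show ?case using S by (intro bexI[of _ "s * t"]) (auto simp: mult_set_def mult_dvd_mono)
qed

text \<open>The coordinate ring of a chart is a polynomial ring, of another type than the function
  field. The locale presents the field as the field of fractions of such a factorial ring along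
  \<open>\<phi>\<close>.\<close>

locale fraction_embedding =
  fixes \<phi> :: "'r::factorial_ring_gcd \<Rightarrow> 'f::field"
  assumes add: "\<phi> (a + b) = \<phi> a + \<phi> b"
    and mult: "\<phi> (a * b) = \<phi> a * \<phi> b"
    and one: "\<phi> 1 = 1"
    and eq_0D: "\<phi> a = 0 \<Longrightarrow> a = 0"
    and fraction: "\<exists>a b. b \<noteq> 0 \<and> f = \<phi> a / \<phi> b"
begin

lemma zero: "\<phi> 0 = 0"
  using add[of 0 0] by (metis add_cancel_right_right)

lemma eq_0_iff: "\<phi> a = 0 \<longleftrightarrow> a = 0" using eq_0D zero by blast

lemma uminus: "\<phi> (- a) = - \<phi> a"
  using add[of a "- a"] by (simp add: zero eq_neg_iff_add_eq_0 add.commute)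

lemma eq_iff: "\<phi> a = \<phi> b \<longleftrightarrow> a = b"
proof -
  have "\<phi> (a + - b) = \<phi> a - \<phi> b" unfolding add uminus by simp
  then have "\<phi> a = \<phi> b \<longleftrightarrow> \<phi> (a - b) = 0" by simp
  then show ?thesis by (simp add: eq_0_iff)
qed

lemma power: "\<phi> (a ^ n) = \<phi> a ^ n"
  by (induction n) (simp_all add: one mult)

lemma reduced_fraction: "\<exists>a b. b \<noteq> 0 \<and> coprime a b \<and> f = \<phi> a / \<phi> b"
proof -
  obtain a b where ab: "b \<noteq> 0" "f = \<phi> a / \<phi> b" using fraction by blast
  then obtain a' b' where "a = a' * gcd a b" "b = b' * gcd a b" "coprime a' b'"
    using gcd_coprime_exists[of a b] by auto
  moreover from this have "\<phi> a = \<phi> a' * \<phi> (gcd a b)" "\<phi> b = \<phi> b' * \<phi> (gcd a b)"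
    by (metis mult)+
  moreover have "gcd a b \<noteq> 0" using ab by simp
  ultimately show ?thesis using ab by (intro exI[of _ a'] exI[of _ b']) (auto simp: eq_0_iff)
qed

definition fractions :: "'r set \<Rightarrow> 'f set" where
  "fractions S = {\<phi> a / \<phi> s | a s. s \<in> S}"

text \<open>For prime \<open>r\<close> this is the discrete valuation ring of \<open>r\<close>, the
  local ring at the generic point of the curve \<open>r = 0\<close>.\<close>

definition val_ring :: "'r \<Rightarrow> 'f set" where
  "val_ring r = {\<phi> a / \<phi> b | a b. \<not> r dvd b}"

definition prime_gen :: "'r \<Rightarrow> 'r set \<Rightarrow> 'f set" where
  "prime_gen r S = (\<lambda>f. \<phi> r * f) ` fractions S"

lemma val_ringI: "\<not> r dvd b \<Longrightarrow> \<phi> a / \<phi> b \<in> val_ring r"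
  by (auto simp: val_ring_def)

lemma fractionsI: "s \<in> S \<Longrightarrow> \<phi> a / \<phi> s \<in> fractions S"
  by (auto simp: fractions_def)

lemma subring_fractions:
  assumes S: "mult_set S"
  shows "subring_set (fractions S)"
  unfolding subring_set_def
proof (intro conjI ballI)
  have 0: "\<phi> s \<noteq> 0" if "s \<in> S" for s using S that by (auto simp: eq_0_iff mult_set_def)
  show "1 \<in> fractions S" using fractionsI[of 1 S 1] S by (simp add: mult_set_def one)
  fix x y assume "x \<in> fractions S" "y \<in> fractions S"
  then obtain a b s t where *: "x = \<phi> a / \<phi> s" "y = \<phi> b / \<phi> t" "s \<in> S" "t \<in> S"
    by (auto simp: fractions_def)
  then have st: "s * t \<in> S" using S by (auto simp: mult_set_def)
  have "x + y = \<phi> (a * t + b * s) / \<phi> (s * t)" using * 0 by (simp add: mult add field_simps)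
  then show "x + y \<in> fractions S" using fractionsI[OF st] by simp
  have "x * y = \<phi> (a * b) / \<phi> (s * t)" using * by (simp add: mult)
  then show "x * y \<in> fractions S" using fractionsI[OF st] by simp
  have "- x = \<phi> (- a) / \<phi> s" using * by (simp add: uminus)
  then show "- x \<in> fractions S" using fractionsI * by simp
qed

lemma range_subset_fractions: "mult_set S \<Longrightarrow> \<phi> a \<in> fractions S"
  using fractionsI[of 1 S a] by (simp add: mult_set_def one)

lemma mult_closed_val_ring:
  assumes "prime_elem r"
  shows "mult_closed (val_ring r)"
  unfolding mult_closed_def
proof (intro conjI ballI)
  show "1 \<in> val_ring r" using val_ringI[of r 1 1] assms by (simp add: one)
  fix x y assume "x \<in> val_ring r" "y \<in> val_ring r"
  then obtain a b s t where *: "x = \<phi> a / \<phi> s" "y = \<phi> b / \<phi> t" "\<not> r dvd s" "\<not> r dvd t"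
    by (auto simp: val_ring_def)
  then have "\<not> r dvd s * t" using assms by (auto simp: prime_elem_dvd_mult_iff)
  moreover have "x * y = \<phi> (a * b) / \<phi> (s * t)" using * by (simp add: mult)
  ultimately show "x * y \<in> val_ring r" using val_ringI by simp
qed

lemma unit_in_val_ring: "prime_elem r \<Longrightarrow> \<not> r dvd a \<Longrightarrow> unit_in (val_ring r) (\<phi> a)"
  using val_ringI[of r 1 a] val_ringI[of r a 1]
  by (auto simp: unit_in_def one inverse_eq_divide eq_0_iff)

lemma fractions_subset_val_ring:
  "\<forall>s\<in>S. \<not> r dvd s \<Longrightarrow> fractions S \<subseteq> val_ring r"
  by (auto simp: fractions_def intro: val_ringI)

lemma prime_gen_iff:
  assumes S: "mult_set S" and r: "prime_elem r" and rS: "\<forall>s\<in>S. \<not> r dvd s" and "s \<in> S"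
  shows "\<phi> a / \<phi> s \<in> prime_gen r S \<longleftrightarrow> r dvd a"
proof
  have 0: "\<phi> s \<noteq> 0" if "s \<in> S" for s using S that by (auto simp: eq_0_iff mult_set_def)
  assume "\<phi> a / \<phi> s \<in> prime_gen r S"
  then obtain c t where "\<phi> a / \<phi> s = \<phi> r * (\<phi> c / \<phi> t)" and t: "t \<in> S"
    by (auto simp: prime_gen_def fractions_def)
  then have "\<phi> (a * t) = \<phi> (r * c * s)"
    using 0[OF t] 0[OF \<open>s \<in> S\<close>] by (simp add: mult field_simps)
  then have "r dvd a * t" by (simp add: eq_iff mult.assoc)
  then show "r dvd a" using rS t r by (auto simp: prime_elem_dvd_mult_iff)
next
  assume "r dvd a"
  then show "\<phi> a / \<phi> s \<in> prime_gen r S"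
    using fractionsI[OF \<open>s \<in> S\<close>] unfolding prime_gen_def
    by (auto simp: mult dvd_def intro!: rev_image_eqI)
qed

text \<open>As \<open>r\<close> divides no element of \<open>S\<close>, it stays prime over
  \<open>S\<close>, and localising at it absorbs the denominators from \<open>S\<close>.\<close>

lemma prime_gen_spectrum:
  assumes S: "mult_set S" and r: "prime_elem r" and rS: "\<forall>s\<in>S. \<not> r dvd s"
  shows "prime_gen r S \<in> prime_spectrum (fractions S)"
    and "localize (fractions S) (prime_gen r S) = val_ring r"
proof -
  note A = subring_fractions[OF S]
  note iff = prime_gen_iff[OF S r rS]
  have rA: "\<phi> r \<in> fractions S" by (rule range_subset_fractions[OF S])
  have 0: "\<phi> s \<noteq> 0" if "s \<in> S" for s using S that by (auto simp: eq_0_iff mult_set_def)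
  have S1: "1 \<in> S" and Sm: "\<And>s t. s \<in> S \<Longrightarrow> t \<in> S \<Longrightarrow> s * t \<in> S" using S by (auto simp: mult_set_def)
  show "prime_gen r S \<in> prime_spectrum (fractions S)"
  proof (rule prime_spectrumI[OF A])
    show "prime_gen r S \<subseteq> fractions S" using subring_setD(4)[OF A rA] by (auto simp: prime_gen_def)
    show "0 \<in> prime_gen r S"
      unfolding prime_gen_def using subring_setD(2)[OF A] by (intro image_eqI[of _ _ 0]) auto
    show "1 \<notin> prime_gen r S" using iff[OF S1, of 1] r by (simp add: one)
    show "x + y \<in> prime_gen r S" if "x \<in> prime_gen r S" "y \<in> prime_gen r S" for x y
      using that subring_setD(3)[OF A] by (auto simp: prime_gen_def simp flip: distrib_left)
    show "x * y \<in> prime_gen r S" if "x \<in> fractions S" "y \<in> prime_gen r S" for x y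
      using that subring_setD(4)[OF A] by (auto simp: prime_gen_def mult.left_commute[of x])
    show "x \<in> prime_gen r S \<or> y \<in> prime_gen r S"
      if xy: "x \<in> fractions S" "y \<in> fractions S" "x * y \<in> prime_gen r S" for x y
    proof -
      obtain a b s t where *: "x = \<phi> a / \<phi> s" "y = \<phi> b / \<phi> t" "s \<in> S" "t \<in> S"
        using xy by (auto simp: fractions_def)
      then have "x * y = \<phi> (a * b) / \<phi> (s * t)" by (simp add: mult)
      then have "r dvd a * b" using xy(3) iff[OF Sm[OF *(3,4)]] by simp
      then show ?thesis using r * iff by (auto simp: prime_elem_dvd_mult_iff)
    qed
  qed
  show "localize (fractions S) (prime_gen r S) = val_ring r"
  proof (intro equalityI subsetI)
    fix f assume "f \<in> localize (fractions S) (prime_gen r S)"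
    then obtain a b s t where *: "f = (\<phi> a / \<phi> s) / (\<phi> b / \<phi> t)" "s \<in> S" "t \<in> S"
      "\<phi> b / \<phi> t \<notin> prime_gen r S"
      by (auto simp: localize_def fractions_def)
    have "\<not> r dvd b * s" using *(4) iff[OF *(3)] rS *(2) r by (simp add: prime_elem_dvd_mult_iff)
    moreover have "f = \<phi> (a * t) / \<phi> (b * s)" using *(1) by (simp add: mult)
    ultimately show "f \<in> val_ring r" using val_ringI by simp
  next
    fix f assume "f \<in> val_ring r"
    then obtain a b where ab: "f = \<phi> a / \<phi> b" "\<not> r dvd b" by (auto simp: val_ring_def)
    then have "\<phi> b / \<phi> 1 \<notin> prime_gen r S" using iff[OF S1] by simp
    then have "\<phi> b \<notin> prime_gen r S" by (simp add: one)
    then show "f \<in> localize (fractions S) (prime_gen r S)"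
      unfolding localize_def using ab range_subset_fractions[OF S] by blast
  qed
qed

text \<open>The denominator of the reduced fraction of \<open>f\<close> lies in \<open>P\<close>,
  hence so does one of its prime factors \<open>r\<close>. By coprimality \<open>r\<close> does not
  divide the numerator, so \<open>f\<close> has a pole along \<open>r\<close>. Elements of
  \<open>S\<close> are units and have no divisor in \<open>P\<close>.\<close>

lemma prime_divisor_of_denominator:
  assumes S: "mult_set S" and P: "P \<in> prime_spectrum (fractions S)"
    and f: "f \<notin> localize (fractions S) P"
  shows "\<exists>r. prime_elem r \<and> \<phi> r \<in> P \<and> f \<notin> val_ring r \<and> (\<forall>s\<in>S. \<not> r dvd s)"
proof -
  note rA = range_subset_fractions[OF S]
  obtain a b where ab: "b \<noteq> 0" "coprime a b" "f = \<phi> a / \<phi> b" using reduced_fraction by blast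
  have bP: "\<phi> b \<in> P" using f ab(3) rA by (auto simp: localize_def)
  have ex: "\<exists>r. prime_elem r \<and> r dvd b \<and> \<phi> r \<in> P"
    using ab(1) bP
  proof (induction b rule: prime_divisors_induct)
    case (unit b)
    then have "\<phi> (1 div b) * \<phi> b = 1" by (simp add: one flip: mult)
    then show ?case using prime_spectrumD(3,6)[OF P] rA unit by metis
  next
    case (factor p b)
    then have "\<phi> p \<in> P \<or> \<phi> b \<in> P" using prime_spectrumD(7)[OF P] rA by (auto simp: mult)
    then show ?case
    proof
      assume "\<phi> b \<in> P"
      then obtain r where "prime_elem r" "r dvd b" "\<phi> r \<in> P" using factor by auto
      then show ?thesis by auto
    qed (use factor in auto)
  qed auto
  then obtain r where r: "prime_elem r" "r dvd b" "\<phi> r \<in> P" by blast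
  have "f \<notin> val_ring r"
  proof
    assume "f \<in> val_ring r"
    then obtain c d where cd: "f = \<phi> c / \<phi> d" "\<not> r dvd d" by (auto simp: val_ring_def)
    then have "d \<noteq> 0" by auto
    then have "\<phi> (a * d) = \<phi> (c * b)" using cd(1) ab by (simp add: mult eq_0_iff field_simps)
    then have "r dvd a * d" using r(2) by (simp add: eq_iff)
    then have "r dvd a" using r(1) cd(2) by (simp add: prime_elem_dvd_mult_iff)
    then show False using ab(2) r coprime_common_divisor prime_elem_not_unit by blast
  qed
  moreover have "\<not> r dvd s" if s: "s \<in> S" for s
  proof
    assume "r dvd s"
    then obtain c where c: "s = r * c" by (elim dvdE)
    then have "(\<phi> c / \<phi> s) * \<phi> r = 1" using S s by (auto simp: mult mult_set_def eq_0_iff)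
    moreover have "\<phi> c / \<phi> s \<in> fractions S" by (rule fractionsI[OF s])
    ultimately show False using prime_spectrumD(3,6)[OF P] r(3) by metis
  qed
  ultimately show ?thesis using r by blast
qed

text \<open>Algebraic Hartogs principle: if a prime factor of the reduced denominator divided no
  element of \<open>S\<close>, then \<open>f\<close> would have a pole in codimension one.\<close>

lemma mem_fractionsI:
  assumes S: "mult_set S"
    and f: "\<And>r. prime_elem r \<Longrightarrow> \<forall>s\<in>S. \<not> r dvd s \<Longrightarrow> f \<in> val_ring r"
  shows "f \<in> fractions S"
proof -
  obtain a b where ab: "b \<noteq> 0" "coprime a b" "f = \<phi> a / \<phi> b" using reduced_fraction by blast
  have "\<exists>s\<in>S. b dvd s"
  proof (rule dvd_mult_set[OF S ab(1)])
    fix r assume r: "prime_elem r" "r dvd b"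
    show "\<exists>s\<in>S. r dvd s"
    proof (rule ccontr)
      assume "\<not> ?thesis"
      then have "f \<in> val_ring r" using f[OF r(1)] by blast
      then obtain c d where cd: "f = \<phi> c / \<phi> d" "\<not> r dvd d" by (auto simp: val_ring_def)
      then have "d \<noteq> 0" by auto
      then have "\<phi> (a * d) = \<phi> (c * b)" using cd(1) ab by (simp add: mult eq_0_iff field_simps)
      then have "r dvd a * d" using r(2) by (simp add: eq_iff)
      then have "r dvd a" using r(1) cd(2) by (simp add: prime_elem_dvd_mult_iff)
      then show False using ab(2) r coprime_common_divisor prime_elem_not_unit by blast
    qed
  qed
  then obtain s c where sc: "s \<in> S" "s = b * c" by (auto simp: dvd_def)
  then have "c \<noteq> 0" using S by (auto simp: mult_set_def)
  then have "f = \<phi> (a * c) / \<phi> s" using ab sc by (simp add: mult eq_0_iff)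
  then show ?thesis using fractionsI[OF sc(1)] by simp
qed

text \<open>The exponent is the valuation of \<open>f\<close>: the multiplicity of \<open>r\<close>
  in a numerator minus that in a denominator.\<close>

lemma val_ring_decomp:
  assumes r: "prime_elem r" and "f \<noteq> 0"
  shows "\<exists>n w. unit_in (val_ring r) w \<and> f = \<phi> r powi n * w"
proof -
  obtain a b where ab: "b \<noteq> 0" "f = \<phi> a / \<phi> b" using fraction by blast
  have a0: "a \<noteq> 0" using ab assms(2) by (auto simp: zero)
  have nu: "\<not> is_unit r" using r by simp
  obtain a' where a': "a = r ^ multiplicity r a * a'" "\<not> r dvd a'"
    using multiplicity_decompose'[OF a0 nu] by blast
  obtain b' where b': "b = r ^ multiplicity r b * b'" "\<not> r dvd b'"
    using multiplicity_decompose'[OF ab(1) nu] by blast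
  let ?n = "int (multiplicity r a) - int (multiplicity r b)"
  have r0: "\<phi> r \<noteq> 0" using r by (auto simp: eq_0_iff)
  have "\<phi> a = \<phi> r ^ multiplicity r a * \<phi> a'" "\<phi> b = \<phi> r ^ multiplicity r b * \<phi> b'"
    by (metis a'(1) mult power, metis b'(1) mult power)
  then have "f = \<phi> r powi ?n * (\<phi> a' / \<phi> b')"
    using ab r0 by (simp add: power_int_diff)
  moreover have "unit_in (val_ring r) (\<phi> a' / \<phi> b')"
    by (intro unit_in_divide mult_closed_val_ring unit_in_val_ring r a' b')
  ultimately show ?thesis by blast
qed

lemma val_ring_normalize: "val_ring (normalize r) = val_ring r"
  by (simp add: val_ring_def)

end

section \<open>Laurent polynomials in the function field\<close>

interpretation fs: vector_space "scale :: 'k::field \<Rightarrow> 'k function_field \<Rightarrow> 'k function_field"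
  by (rule vector_space_scale)

definition monomial_span :: "(int \<times> int) set \<Rightarrow> 'k::field function_field set" where
  "monomial_span C = fs.span (monomial ` C)"

lemma chart_ring_eq: "chart_ring \<sigma> = monomial_span {m. \<forall>v\<in>\<sigma>. 0 \<le> inner (lat m) v}"
  unfolding chart_ring_def monomial_span_def by (rule arg_cong[of _ _ fs.span]) auto

lemma var_neq_0 [simp]: "to_fract [:[:0, 1::'k::field:]:] \<noteq> 0" "to_fract [:0, 1::'k::field poly:] \<noteq> 0"
  by (simp_all add: to_fract_eq_0_iff)

lemma monomial_neq_0 [simp]: "monomial m \<noteq> 0"
  by (simp add: monomial_def)

lemma monomial_0 [simp]: "monomial 0 = 1"
  by (simp add: monomial_def)

lemma monomial_add: "monomial (m + n) = monomial m * monomial n"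
  by (simp add: monomial_def power_int_add)

lemma monomial_uminus: "monomial (- m) = inverse (monomial m)"
  by (simp add: monomial_def power_int_minus)

lemma monomial_diff: "monomial (m - n) = monomial m / monomial n"
  using monomial_add[of m "- n"] by (simp add: monomial_uminus divide_inverse)

text \<open>The first exponent belongs to the inner polynomial variable and the second to the outer
  one, hence the nesting of \<open>monom\<close>.\<close>

lemma monomial_of_nat:
  "scale c (monomial (int i, int j)) = to_fract (monom (monom c i) j)"
proof -
  have pow: "to_fract (p ^ n) = to_fract p ^ n" for p :: "'a poly poly" and n
    by (induction n) simp_all
  have eq: "monom (monom c i) j = [:[:c:]:] * [:[:0,1:]:] ^ i * [:0,1:] ^ j"
  proof -
    have "[:[:0,1::'a:]:] ^ i = [:[:0,1:] ^ i:]"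
      by (induction i) (simp_all add: one_pCons)
    then show ?thesis by (simp add: monom_altdef)
  qed
  show ?thesis
    unfolding eq
    by (simp only: to_fract_mult pow scale_def const_def monomial_def fst_conv snd_conv
        power_int_of_nat mult.assoc)
qed

lemma monomial_span_mono: "C \<subseteq> D \<Longrightarrow> monomial_span C \<subseteq> monomial_span D"
  unfolding monomial_span_def by (intro fs.span_mono image_mono)

lemma monomial_span_base: "m \<in> C \<Longrightarrow> monomial m \<in> monomial_span C"
  unfolding monomial_span_def by (intro fs.span_base imageI)

lemma monomial_span_closed:
  "0 \<in> monomial_span C" "f \<in> monomial_span C \<Longrightarrow> g \<in> monomial_span C \<Longrightarrow> f + g \<in> monomial_span C"
  "f \<in> monomial_span C \<Longrightarrow> - f \<in> monomial_span C" "f \<in> monomial_span C \<Longrightarrow> scale c f \<in> monomial_span C"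
  unfolding monomial_span_def by (auto intro: fs.span_zero fs.span_add fs.span_neg fs.span_scale)

lemma monomial_span_induct [consumes 1, case_names zero step]:
  assumes "f \<in> monomial_span C" "P 0"
    and "\<And>c m g. m \<in> C \<Longrightarrow> P g \<Longrightarrow> P (scale c (monomial m) + g)"
  shows "P f"
  using assms(1) unfolding monomial_span_def
  by (induction rule: fs.span_induct_alt) (use assms(2,3) in auto)

lemma monomial_span_mult:
  assumes "f \<in> monomial_span C" "g \<in> monomial_span D"
    and CD: "\<And>c d. c \<in> C \<Longrightarrow> d \<in> D \<Longrightarrow> c + d \<in> E"
  shows "f * g \<in> monomial_span E"
proof -
  have 1: "monomial c * g \<in> monomial_span E" if c: "c \<in> C" for c
    using assms(2)
  proof (induction rule: monomial_span_induct)
    case (step k m g)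
    have "monomial c * (scale k (monomial m) + g) = scale k (monomial (c + m)) + monomial c * g"
      by (simp add: scale_def monomial_add algebra_simps)
    then show ?case using step CD[OF c] by (simp add: monomial_span_closed monomial_span_base)
  qed (simp add: monomial_span_closed)
  show ?thesis
    using assms(1)
  proof (induction rule: monomial_span_induct)
    case (step k m f)
    have "(scale k (monomial m) + f) * g = scale k (monomial m * g) + f * g"
      by (simp add: scale_def algebra_simps)
    then show ?case using step 1 by (simp add: monomial_span_closed)
  qed (simp add: monomial_span_closed)
qed

lemma monomial_shift_iff:
  "monomial m * f \<in> monomial_span {n. P n} \<longleftrightarrow> f \<in> monomial_span {n. P (m + n)}"
proof
  assume *: "monomial m * f \<in> monomial_span {n. P n}"
  have "monomial (- m) * (monomial m * f) \<in> monomial_span {n. P (m + n)}"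
    by (rule monomial_span_mult[OF monomial_span_base[of "- m" "{- m}"] *]) auto
  then show "f \<in> monomial_span {n. P (m + n)}" by (simp add: monomial_uminus flip: mult.assoc)
next
  assume *: "f \<in> monomial_span {n. P (m + n)}"
  show "monomial m * f \<in> monomial_span {n. P n}"
    by (rule monomial_span_mult[OF monomial_span_base[of m "{m}"] *]) auto
qed

lemma subring_monomial_span:
  assumes "0 \<in> C" "\<And>m n. m \<in> C \<Longrightarrow> n \<in> C \<Longrightarrow> m + n \<in> C"
  shows "subring_set (monomial_span C)"
  using monomial_span_base[OF assms(1)] monomial_span_mult[of _ C _ C C] assms(2)
  by (auto simp: subring_set_def monomial_span_closed)

text \<open>A shift of all exponents by a large \<open>(N, N)\<close> turns the combination into an
  ordinary polynomial in two variables, whose coefficients can be compared.\<close>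

lemma monomial_combination_eq_0:
  fixes c :: "int \<times> int \<Rightarrow> 'k::field"
  assumes fin: "finite F" and sum: "(\<Sum>m\<in>F. scale (c m) (monomial m)) = 0" and m: "m \<in> F"
  shows "c m = 0"
proof -
  define N where "N = (\<Sum>m\<in>F. \<bar>fst m\<bar> + \<bar>snd m\<bar>)"
  have N: "0 \<le> fst m + N" "0 \<le> snd m + N" if "m \<in> F" for m
  proof -
    have "\<bar>fst m\<bar> + \<bar>snd m\<bar> \<le> N" unfolding N_def using fin that by (intro member_le_sum) auto
    then show "0 \<le> fst m + N" "0 \<le> snd m + N" by linarith+
  qed
  let ?p = "\<Sum>m\<in>F. monom (monom (c m) (nat (fst m + N))) (nat (snd m + N))"
  have "to_fract ?p = (\<Sum>m\<in>F. scale (c m) (monomial (m + (N, N))))"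
    unfolding to_fract_sum
  proof (rule sum.cong)
    fix m assume "m \<in> F"
    then have "m + (N, N) = (int (nat (fst m + N)), int (nat (snd m + N)))"
      using N by (simp add: prod_eq_iff)
    then show "to_fract (monom (monom (c m) (nat (fst m + N))) (nat (snd m + N))) = scale (c m) (monomial (m + (N, N)))"
      by (simp only: monomial_of_nat)
  qed simp
  also have "\<dots> = (\<Sum>m\<in>F. scale (c m) (monomial m)) * monomial (N, N)"
    by (simp add: sum_distrib_right scale_def monomial_add mult.assoc)
  also have "\<dots> = 0" using sum by simp
  finally have "?p = 0" by (simp only: to_fract_eq_0_iff)
  then have "0 = coeff (coeff ?p (nat (snd m + N))) (nat (fst m + N))" by simp
  also have "\<dots> = (\<Sum>n\<in>F. if n = m then c m else 0)"
    unfolding coeff_sum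
  proof (rule sum.cong)
    fix n assume "n \<in> F"
    then have "nat (fst n + N) = nat (fst m + N) \<longleftrightarrow> fst n = fst m"
      "nat (snd n + N) = nat (snd m + N) \<longleftrightarrow> snd n = snd m"
      using N[of n] N[OF m] by auto
    then show "coeff (coeff (monom (monom (c n) (nat (fst n + N))) (nat (snd n + N))) (nat (snd m + N)))
        (nat (fst m + N)) = (if n = m then c m else 0)"
      by (cases n; cases m) auto
  qed simp
  also have "\<dots> = c m" using fin m by simp
  finally show ?thesis by simp
qed

lemma inj_monomial: "inj (monomial :: _ \<Rightarrow> 'k::field function_field)"
proof (rule injI, rule ccontr)
  fix m n assume eq: "monomial m = (monomial n :: 'k function_field)" and ne: "m \<noteq> n"
  let ?c = "\<lambda>k. if k = m then 1 else - 1 :: 'k"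
  have "(\<Sum>k\<in>{m, n}. scale (?c k) (monomial k)) = (0 :: 'k function_field)"
    using eq ne by simp
  then have "?c m = 0" by (rule monomial_combination_eq_0[rotated]) simp_all
  then show False by simp
qed

lemma independent_monomials: "fs.independent (range (monomial :: _ \<Rightarrow> 'k::field function_field))"
  unfolding fs.independent_explicit_module
proof (intro allI impI)
  fix T :: "'k function_field set" and u v
  assume T: "finite T" "T \<subseteq> range monomial" "(\<Sum>v\<in>T. scale (u v) v) = 0" "v \<in> T"
  obtain F where F: "T = monomial ` F" using T(2) by (auto simp: subset_image_iff)
  have inj: "inj_on (monomial :: _ \<Rightarrow> 'k function_field) F"
    using inj_monomial by (rule inj_on_subset) simp
  have fin: "finite F" using T(1) F inj by (simp add: finite_image_iff)
  obtain m where m: "v = monomial m" "m \<in> F" using T(4) F by blast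
  have "(\<Sum>m\<in>F. scale (u (monomial m)) (monomial m)) = 0"
    using T(3) unfolding F by (simp add: sum.reindex[OF inj])
  from monomial_combination_eq_0[OF fin this m(2)] show "u v = 0" by (simp add: m)
qed

text \<open>Outside \<open>laurent\<close> the value is zero by the convention of
  \<open>fs.representation\<close>, so additivity is available only for Laurent polynomials.\<close>

definition coefficient :: "int \<times> int \<Rightarrow> 'k::field function_field \<Rightarrow> 'k" where
  "coefficient m f = fs.representation (range monomial) f (monomial m)"

abbreviation laurent :: "'k::field function_field set" where
  "laurent \<equiv> monomial_span UNIV"

lemma coefficient_0 [simp]: "coefficient m 0 = 0"
  by (simp add: coefficient_def fs.representation_zero)

lemma coefficient_add:
  "f \<in> laurent \<Longrightarrow> g \<in> laurent \<Longrightarrow> coefficient m (f + g) = coefficient m f + coefficient m g"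
  unfolding coefficient_def monomial_span_def
  by (simp add: fs.representation_add[OF independent_monomials])

lemma coefficient_scale: "f \<in> laurent \<Longrightarrow> coefficient m (scale c f) = c * coefficient m f"
  unfolding coefficient_def monomial_span_def
  by (simp add: fs.representation_scale[OF independent_monomials])

lemma coefficient_monomial: "coefficient m (monomial n) = (if m = n then 1 else 0)"
  unfolding coefficient_def
  by (subst fs.representation_basis[OF independent_monomials])
    (auto simp: inj_eq[OF inj_monomial])

lemma monomial_span_subset_laurent: "f \<in> monomial_span C \<Longrightarrow> f \<in> laurent"
  using monomial_span_mono[of C UNIV] by blast

lemma coefficient_step:
  assumes "g \<in> laurent"
  shows "coefficient n (scale c (monomial m) + g) = (if n = m then c else 0) + coefficient n g"
  using assms
  by (simp add: coefficient_add coefficient_scale coefficient_monomial monomial_span_closed monomial_span_base)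

lemma coefficient_outside: "f \<in> monomial_span C \<Longrightarrow> m \<notin> C \<Longrightarrow> coefficient m f = 0"
proof -
  assume "f \<in> monomial_span C" "m \<notin> C"
  then have "f \<in> laurent \<and> coefficient m f = 0"
    by (induction rule: monomial_span_induct)
      (auto simp: coefficient_step monomial_span_closed monomial_span_base)
  then show ?thesis by simp
qed

lemma laurent_expansion:
  assumes "f \<in> laurent"
  shows "finite {m. coefficient m f \<noteq> 0}"
    and "f = (\<Sum>m | coefficient m f \<noteq> 0. scale (coefficient m f) (monomial m))"
proof -
  let ?R = "fs.representation (range monomial) f"
  have sub: "{b. ?R b \<noteq> 0} = monomial ` {m. coefficient m f \<noteq> 0}"
    using fs.representation_ne_zero[of "range monomial" f] by (auto simp: coefficient_def)
  have inj: "inj_on monomial {m. coefficient m f \<noteq> 0}"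
    using inj_monomial by (rule inj_on_subset) simp
  show "finite {m. coefficient m f \<noteq> 0}"
    using fs.finite_representation[of "range monomial" f] unfolding sub by (simp add: finite_image_iff[OF inj])
  have "f = (\<Sum>b | ?R b \<noteq> 0. scale (?R b) b)"
    using assms unfolding monomial_span_def
    by (simp add: fs.sum_nonzero_representation_eq[OF independent_monomials])
  also have "\<dots> = (\<Sum>m | coefficient m f \<noteq> 0. scale (coefficient m f) (monomial m))"
    unfolding sub by (subst sum.reindex[OF inj]) (simp add: o_def coefficient_def)
  finally show "f = (\<Sum>m | coefficient m f \<noteq> 0. scale (coefficient m f) (monomial m))" .
qed

lemma mem_monomial_span_iff:
  "f \<in> monomial_span C \<longleftrightarrow> f \<in> laurent \<and> (\<forall>m. coefficient m f \<noteq> 0 \<longrightarrow> m \<in> C)"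
proof (intro iffI conjI)
  assume f: "f \<in> laurent \<and> (\<forall>m. coefficient m f \<noteq> 0 \<longrightarrow> m \<in> C)"
  then have "(\<Sum>m | coefficient m f \<noteq> 0. scale (coefficient m f) (monomial m)) \<in> monomial_span C"
    unfolding monomial_span_def by (intro fs.span_sum fs.span_scale fs.span_base) auto
  then show "f \<in> monomial_span C" using laurent_expansion(2)[of f] f by simp
qed (use monomial_span_subset_laurent coefficient_outside in blast)+

lemma coefficient_monomial_mult:
  assumes "f \<in> laurent"
  shows "coefficient n (monomial m * f) = coefficient (n - m) f"
proof -
  have "f \<in> laurent \<and> monomial m * f \<in> laurent \<and> coefficient n (monomial m * f) = coefficient (n - m) f"
    using assms
  proof (induction rule: monomial_span_induct)
    case (step c k g)
    have *: "monomial m * (scale c (monomial k) + g) = scale c (monomial (m + k)) + monomial m * g"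
      by (simp add: scale_def monomial_add algebra_simps)
    have k: "scale c (monomial k) \<in> laurent" "scale c (monomial (m + k)) \<in> laurent"
      by (intro monomial_span_closed monomial_span_base UNIV_I)+
    have "n = m + k \<longleftrightarrow> n - m = k" by auto
    then have "coefficient n (scale c (monomial (m + k)) + monomial m * g)
        = coefficient (n - m) (scale c (monomial k) + g)"
      using step by (simp add: coefficient_step)
    then show ?case
      unfolding * using step k monomial_span_closed(2) by blast
  qed (simp add: monomial_span_closed)
  then show ?thesis by blast
qed

section \<open>Charts of smooth cones\<close>

text \<open>Over a field \<open>to_fract\<close> is bijective. This inverse returns to
  \<open>'k\<close> the coefficients that were moved to \<open>'k fract\<close> for the sake of
  unique factorisation.\<close>

definition the_scalar :: "'k::field fract \<Rightarrow> 'k" where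
  "the_scalar z = (THE c. to_fract c = z)"

lemma the_scalar_to_fract [simp]: "the_scalar (to_fract c) = c"
  by (simp add: the_scalar_def)

lemma to_fract_the_scalar [simp]: "to_fract (the_scalar z) = (z :: 'k::field fract)"
proof (cases z)
  case (Fract a b)
  have "to_fract (a / b) * to_fract b = to_fract a" using Fract(2) by (simp flip: to_fract_mult)
  moreover have "z * to_fract b = to_fract a" using Fract by (simp add: Fract_conv_to_fract)
  ultimately have "z = to_fract (a / b)" using Fract(2) by (metis mult_right_cancel to_fract_eq_0_iff)
  then show ?thesis by simp
qed

lemma the_scalar_simps [simp]:
  "the_scalar 0 = 0" "the_scalar 1 = 1" "the_scalar (a + b) = the_scalar a + the_scalar b"
  "the_scalar (a * b) = the_scalar a * the_scalar b"
proof -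
  show "the_scalar 0 = 0" "the_scalar 1 = 1"
    using the_scalar_to_fract[of 0] the_scalar_to_fract[of 1] by simp_all
  have "to_fract (the_scalar a + the_scalar b) = a + b" "to_fract (the_scalar a * the_scalar b) = a * b"
    by simp_all
  then show "the_scalar (a + b) = the_scalar a + the_scalar b"
    "the_scalar (a * b) = the_scalar a * the_scalar b"
    by (metis the_scalar_to_fract)+
qed

lemma the_scalar_eq_0_iff [simp]: "the_scalar z = 0 \<longleftrightarrow> z = 0"
  by (metis to_fract_the_scalar to_fract_eq_0_iff)

text \<open>The coefficient map \<open>h\<close> is arbitrary so that an evaluation can serve as
  \<open>h\<close> for another one, which gives evaluation in two variables.\<close>

definition eval_poly :: "('a::comm_ring_1 \<Rightarrow> 'b::comm_ring_1) \<Rightarrow> 'b \<Rightarrow> 'a poly \<Rightarrow> 'b" where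
  "eval_poly h x p = poly (map_poly h p) x"

context
  fixes h :: "'a::comm_ring_1 \<Rightarrow> 'b::comm_ring_1"
  assumes h: "h 0 = 0" "h 1 = 1" "\<And>a b. h (a + b) = h a + h b" "\<And>a b. h (a * b) = h a * h b"
begin

lemma eval_poly_pCons: "eval_poly h x (pCons a p) = h a + x * eval_poly h x p"
  by (simp add: eval_poly_def map_poly_pCons h)

lemma eval_poly_0: "eval_poly h x 0 = 0"
  by (simp add: eval_poly_def)

lemma eval_poly_1: "eval_poly h x 1 = 1"
  by (simp add: one_pCons eval_poly_pCons eval_poly_0 h)

lemma eval_poly_add: "eval_poly h x (p + q) = eval_poly h x p + eval_poly h x q"
  by (induction p q rule: poly_induct2) (simp_all add: eval_poly_0 eval_poly_pCons h algebra_simps)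

lemma eval_poly_smult: "eval_poly h x (smult c p) = h c * eval_poly h x p"
  by (induction p) (simp_all add: eval_poly_0 eval_poly_pCons h algebra_simps)

lemma eval_poly_mult: "eval_poly h x (p * q) = eval_poly h x p * eval_poly h x q"
  by (induction p)
    (simp_all add: eval_poly_0 eval_poly_pCons eval_poly_add eval_poly_smult h algebra_simps)

lemma eval_poly_monom: "eval_poly h x (monom c n) = h c * x ^ n"
  by (simp add: eval_poly_def map_poly_monom h poly_monom)

end

lemma poly_monom_induct [case_names zero add]:
  assumes "P 0" "\<And>c i p. P p \<Longrightarrow> P (monom c i + p)"
  shows "P p"
proof -
  have *: "P (\<Sum>i\<in>I. monom (c i) i)" for I :: "nat set" and c
    by (induction I rule: infinite_finite_induct) (auto intro: assms)
  have "P (\<Sum>i\<le>degree p. monom (coeff p i) i)" by (rule *)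
  then show ?thesis by (simp add: poly_as_sum_of_monoms)
qed

lemma poly_poly_monom_induct [case_names zero add]:
  assumes "P 0" and add: "\<And>c i j p. P p \<Longrightarrow> P (monom (monom c j) i + p)"
  shows "P p"
proof (induction p rule: poly_monom_induct)
  case (add q i p)
  have "P (monom q i + p)" for q
    using add
  proof (induction q rule: poly_monom_induct)
    case (add c j q)
    have "P (monom (monom c j) i + (monom q i + p))" using add by (intro assms(2))
    then show ?case by (simp add: add_monom[symmetric] add.assoc)
  qed simp
  then show ?case .
qed (rule assms(1))

text \<open>For a lattice basis, the character whose pairings with \<open>v\<close> and
  \<open>w\<close> are \<open>i\<close> and \<open>j\<close>. Cramer's rule divides by the
  determinant, which is its own inverse here.\<close>

definition dual_point :: "int \<times> int \<Rightarrow> int \<times> int \<Rightarrow> int \<Rightarrow> int \<Rightarrow> int \<times> int" where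
  "dual_point v w i j = (det2 v w * (i * snd w - j * snd v), det2 v w * (j * fst v - i * fst w))"

text \<open>The outer variable goes to the character dual to \<open>v\<close>, the inner one to that
  dual to \<open>w\<close>. For a lattice basis the image is the coordinate ring of the maximal cone
  on \<open>v\<close> and \<open>w\<close>.\<close>

definition chart_map :: "int \<times> int \<Rightarrow> int \<times> int \<Rightarrow> 'k::field fract poly poly \<Rightarrow> 'k function_field" where
  "chart_map v w = eval_poly (eval_poly (\<lambda>z. const (the_scalar z)) (monomial (dual_point v w 0 1)))
     (monomial (dual_point v w 1 0))"

lemma const_the_scalar_hom:
  "const (the_scalar 0) = 0" "const (the_scalar 1) = 1"
  "const (the_scalar (a + b)) = const (the_scalar a) + const (the_scalar b)"
  "const (the_scalar (a * b)) = const (the_scalar a) * const (the_scalar b)"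
  by simp_all

lemmas inner_hom =
  eval_poly_0[OF const_the_scalar_hom] eval_poly_1[OF const_the_scalar_hom]
  eval_poly_add[OF const_the_scalar_hom] eval_poly_mult[OF const_the_scalar_hom]

lemma chart_map_hom:
  "chart_map v w 0 = 0" "chart_map v w 1 = 1"
  "chart_map v w (p + q) = chart_map v w p + chart_map v w q"
  "chart_map v w (p * q) = chart_map v w p * chart_map v w q"
  unfolding chart_map_def
  by (rule eval_poly_0[OF inner_hom] eval_poly_1[OF inner_hom]
      eval_poly_add[OF inner_hom] eval_poly_mult[OF inner_hom])+

lemma dual_point_add:
  "dual_point v w (i + i') (j + j') = dual_point v w i j + dual_point v w i' j'"
  by (simp add: dual_point_def algebra_simps)

lemma dual_point_0: "dual_point v w 0 0 = 0"
  by (simp add: dual_point_def zero_prod_def)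

lemma monomial_dual_point_power:
  "monomial (dual_point v w 1 0) ^ i * monomial (dual_point v w 0 1) ^ j = monomial (dual_point v w (int i) (int j))"
proof -
  have 1: "monomial (dual_point v w 1 0) ^ i = monomial (dual_point v w (int i) 0)"
    by (induction i) (simp_all add: dual_point_0 flip: monomial_add dual_point_add)
  have 2: "monomial (dual_point v w 0 1) ^ j = monomial (dual_point v w 0 (int j))"
    by (induction j) (simp_all add: dual_point_0 flip: monomial_add dual_point_add)
  show ?thesis unfolding 1 2 by (simp flip: monomial_add dual_point_add)
qed

lemma chart_map_monom:
  "chart_map v w (monom (monom c j) i) = scale (the_scalar c) (monomial (dual_point v w (int i) (int j)))"
  unfolding chart_map_def eval_poly_monom[OF inner_hom] eval_poly_monom[OF const_the_scalar_hom]
  by (simp add: scale_def mult.assoc flip: monomial_dual_point_power)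

lemma to_fract_in_laurent: "to_fract p \<in> laurent"
proof (induction p rule: poly_poly_monom_induct)
  case (add c i j p)
  then show ?case
    by (simp add: monomial_span_closed monomial_span_base flip: monomial_of_nat)
qed (simp add: monomial_span_closed)

section \<open>Monomials in two variables and their prime divisors\<close>

definition var_X :: "'a::comm_semiring_1 poly poly" where "var_X = [:0, 1:]"
definition var_Y :: "'a::comm_semiring_1 poly poly" where "var_Y = [:[:0, 1:]:]"

lemma monom_var: "var_X ^ i * var_Y ^ j = (monom (monom 1 j) i :: 'a::comm_ring_1 poly poly)"
proof -
  have "var_Y ^ j = ([:[:0,1:] ^ j:] :: 'a poly poly)"
    by (induction j) (simp_all add: one_pCons var_Y_def)
  then show ?thesis by (simp add: var_X_def monom_altdef)
qed

lemma var_X_dvd_iff: "var_X dvd p \<longleftrightarrow> coeff p 0 = (0 :: 'a::comm_ring_1 poly)"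
  using monom_1_dvd_iff'[of 1 p] by (simp add: var_X_def monom_altdef)

lemma prime_elem_var: "prime_elem (var_X :: 'k::field poly poly)" "prime_elem (var_Y :: 'k poly poly)"
proof -
  show "prime_elem (var_Y :: 'k poly poly)"
    unfolding var_Y_def by (intro lift_prime_elem_poly prime_elem_linear_field_poly) simp
  show "prime_elem (var_X :: 'k poly poly)"
  proof (rule prime_elemI)
    fix p q :: "'k poly poly"
    assume "var_X dvd p * q"
    then show "var_X dvd p \<or> var_X dvd q" by (simp add: var_X_dvd_iff coeff_mult)
  qed (auto simp: var_X_def is_unit_poly_iff)
qed

text \<open>The denominators allowed on the chart of a face of the cone on \<open>v\<close> and
  \<open>w\<close>: the flag \<open>hv\<close> says that \<open>v\<close> belongs to the face, and
  then the coordinate \<open>var_X\<close> must not be inverted; likewise \<open>hw\<close> and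
  \<open>var_Y\<close>.\<close>

definition var_powers :: "bool \<Rightarrow> bool \<Rightarrow> 'a::comm_semiring_1 poly poly set" where
  "var_powers hv hw = {var_X ^ i * var_Y ^ j | i j. (hv \<longrightarrow> i = 0) \<and> (hw \<longrightarrow> j = 0)}"

lemma var_not_dvd:
  fixes s :: "'k::field poly poly"
  shows "s \<in> var_powers True hw \<Longrightarrow> \<not> var_X dvd s" "s \<in> var_powers hv True \<Longrightarrow> \<not> var_Y dvd s"
proof -
  have X: "\<not> (var_X :: 'k poly poly) dvd var_Y ^ j" for j
  proof
    assume "(var_X :: 'k poly poly) dvd var_Y ^ j"
    then have "(var_X :: 'k poly poly) dvd var_Y"
      using prime_elem_dvd_power[OF prime_elem_var(1)] by blast
    then show False by (simp add: var_X_dvd_iff var_Y_def)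
  qed
  have Y: "\<not> (var_Y :: 'k poly poly) dvd var_X ^ j" for j
  proof
    assume "(var_Y :: 'k poly poly) dvd var_X ^ j"
    then have "(var_Y :: 'k poly poly) dvd var_X"
      using prime_elem_dvd_power[OF prime_elem_var(2)] by blast
    then have "[:0, 1:] dvd (1 :: 'k poly)"
      unfolding var_X_def var_Y_def const_poly_dvd_iff by (metis coeff_pCons_0 coeff_pCons_Suc)
    then show False by (simp add: is_unit_poly_iff)
  qed
  show "s \<in> var_powers True hw \<Longrightarrow> \<not> var_X dvd s" "s \<in> var_powers hv True \<Longrightarrow> \<not> var_Y dvd s"
    using X Y by (auto simp: var_powers_def)
qed

lemma mult_set_var_powers: "mult_set (var_powers hv hw :: 'k::field poly poly set)"
  unfolding mult_set_def
proof (intro conjI ballI)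
  show "1 \<in> (var_powers hv hw :: 'k poly poly set)"
    unfolding var_powers_def by (intro CollectI exI[of _ 0]) simp
  show "0 \<notin> (var_powers hv hw :: 'k poly poly set)"
    using prime_elem_var[where 'k = 'k] by (auto simp: var_powers_def)
  fix s t :: "'k poly poly" assume "s \<in> var_powers hv hw" "t \<in> var_powers hv hw"
  then obtain i j i' j' where "s = var_X ^ i * var_Y ^ j" "t = var_X ^ i' * var_Y ^ j'"
    "(hv \<longrightarrow> i = 0) \<and> (hw \<longrightarrow> j = 0)" "(hv \<longrightarrow> i' = 0) \<and> (hw \<longrightarrow> j' = 0)"
    unfolding var_powers_def by blast
  then show "s * t \<in> var_powers hv hw"
    unfolding var_powers_def
    by (intro CollectI exI[of _ "i + i'"] exI[of _ "j + j'"]) (simp add: power_add algebra_simps)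
qed

text \<open>A prime divisor of a monomial divides one of the variables, and since these are prime it
  is associated to it.\<close>

lemma prime_dvd_var_powers:
  fixes r :: "'k::field poly poly"
  assumes "prime_elem r" "s \<in> var_powers hv hw" "r dvd s"
  shows "(\<not> hv \<and> r dvd var_X \<and> var_X dvd r) \<or> (\<not> hw \<and> r dvd var_Y \<and> var_Y dvd r)"
proof -
  have assoc: "p dvd r" if "prime_elem p" "r dvd p" for p :: "'k poly poly"
  proof -
    obtain c where c: "p = r * c" using \<open>r dvd p\<close> by (elim dvdE)
    have "p dvd r * c" using c by simp
    then have "p dvd r \<or> p dvd c" using prime_elem_dvd_mult_iff[OF \<open>prime_elem p\<close>] by blast
    moreover have "\<not> p dvd c"
    proof
      assume "p dvd c"
      then obtain d where "c = p * d" by (elim dvdE)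
      then have "p * 1 = p * (r * d)" using c by (metis mult.left_commute mult_1_right)
      then have "1 = r * d" using \<open>prime_elem p\<close> by (metis mult_left_cancel prime_elem_def)
      then have "r dvd 1" by (rule dvdI)
      then show False using assms(1) by auto
    qed
    ultimately show ?thesis by blast
  qed
  obtain i j where s: "s = var_X ^ i * var_Y ^ j" "hv \<longrightarrow> i = 0" "hw \<longrightarrow> j = 0"
    using assms(2) by (auto simp: var_powers_def)
  have "r dvd var_X ^ i \<or> r dvd var_Y ^ j" using assms(1,3) s by (simp add: prime_elem_dvd_mult_iff)
  then show ?thesis
  proof
    assume *: "r dvd var_X ^ i"
    then have "i \<noteq> 0" using assms(1) by (intro notI) auto
    then show ?thesis using * s assoc[OF prime_elem_var(1)] prime_elem_dvd_power[OF assms(1)] by blast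
  next
    assume *: "r dvd var_Y ^ j"
    then have "j \<noteq> 0" using assms(1) by (intro notI) auto
    then show ?thesis using * s assoc[OF prime_elem_var(2)] prime_elem_dvd_power[OF assms(1)] by blast
  qed
qed

text \<open>For a ray generator \<open>v\<close>, the prime ideal of its boundary divisor in the
  chart of the ray.\<close>

definition divisor_ideal :: "int \<times> int \<Rightarrow> 'k::field function_field set" where
  "divisor_ideal v = monomial_span {m. 1 \<le> pairing m v}"

text \<open>The local ring of the generic point of the boundary divisor of the ray spanned by \<open>v\<close>.\<close>

definition divisor_ring :: "int \<times> int \<Rightarrow> 'k::field function_field set" where
  "divisor_ring v = localize (monomial_span {m. 0 \<le> pairing m v}) (divisor_ideal v)"

text \<open>The squared determinant covers both orientations of a lattice basis, so that
  \<open>v\<close> and \<open>w\<close> may be exchanged.\<close>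

locale chart =
  fixes v w :: "int \<times> int" and \<phi> :: "'k::field fract poly poly \<Rightarrow> 'k function_field"
  assumes det: "det2 v w * det2 v w = 1"
    and phi_def: "\<phi> = chart_map v w"
begin

abbreviation "dual \<equiv> dual_point v w"

lemma det_neq_0: "det2 v w \<noteq> 0"
  using det by auto

lemma pairing_dual: "pairing (dual i j) v = i" "pairing (dual i j) w = j"
proof -
  have "pairing (dual i j) v = (det2 v w * det2 v w) * i"
    by (simp add: pairing_def dual_point_def det2_def algebra_simps)
  then show "pairing (dual i j) v = i" using det by simp
  have "pairing (dual i j) w = (det2 v w * det2 v w) * j"
    by (simp add: pairing_def dual_point_def det2_def algebra_simps)
  then show "pairing (dual i j) w = j" using det by simp
qed

lemma dual_pairing: "dual (pairing m v) (pairing m w) = m"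
  by (rule eq_if_pairings_eq[OF det_neq_0]) (simp_all add: pairing_dual)

lemma dual_eq_iff: "dual i j = m \<longleftrightarrow> i = pairing m v \<and> j = pairing m w"
  using pairing_dual dual_pairing by metis

definition cone_points :: "bool \<Rightarrow> bool \<Rightarrow> (int \<times> int) set" where
  "cone_points hv hw = {m. (hv \<longrightarrow> 0 \<le> pairing m v) \<and> (hw \<longrightarrow> 0 \<le> pairing m w)}"

lemma phi_step: "\<phi> (monom (monom c j) i + p) = scale (the_scalar c) (monomial (dual (int i) (int j))) + \<phi> p"
  by (simp add: phi_def chart_map_hom chart_map_monom)

lemma phi_mem: "\<phi> p \<in> monomial_span (cone_points True True)"
proof (induction p rule: poly_poly_monom_induct)
  case (add c i j p)
  then show ?case
    unfolding phi_step
    by (intro monomial_span_closed monomial_span_base) (simp_all add: cone_points_def pairing_dual)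
qed (simp add: phi_def chart_map_hom monomial_span_closed)

lemma phi_laurent: "\<phi> p \<in> laurent"
  using phi_mem by (rule monomial_span_subset_laurent)

text \<open>Distinct pairs of exponents go to distinct characters, so \<open>\<phi>\<close>
  preserves coefficients; its injectivity is read off from this.\<close>

lemma coefficient_phi: "coefficient (dual (int i) (int j)) (\<phi> p) = the_scalar (coeff (coeff p i) j)"
proof (induction p rule: poly_poly_monom_induct)
  case (add c i' j' p)
  have "dual (int i) (int j) = dual (int i') (int j') \<longleftrightarrow> i = i' \<and> j = j'"
    by (simp add: dual_eq_iff pairing_dual)
  then show ?case
    unfolding phi_step coefficient_step[OF phi_laurent] using add by auto
qed (simp add: phi_def chart_map_hom)

lemma phi_var_powers: "\<phi> (var_X ^ i * var_Y ^ j) = monomial (dual (int i) (int j))"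
  using chart_map_monom[of v w 1 j i] by (simp add: monom_var phi_def scale_def)

lemma laurent_fraction:
  assumes "f \<in> monomial_span (cone_points hv hw)"
  shows "\<exists>a. \<exists>s\<in>var_powers hv hw. f = \<phi> a / \<phi> s"
  using assms
proof (induction rule: monomial_span_induct)
  case zero
  show ?case using mult_set_var_powers[of hv hw] unfolding mult_set_def
    by (intro exI[of _ 0] bexI[of _ 1]) (auto simp: phi_def chart_map_hom)
next
  case (step c m g)
  obtain a s where g: "g = \<phi> a / \<phi> s" "s \<in> var_powers hv hw" using step by blast
  obtain i j where s: "s = var_X ^ i * var_Y ^ j" "hv \<longrightarrow> i = 0" "hw \<longrightarrow> j = 0"
    using g(2) by (auto simp: var_powers_def)
  define p q where "p = pairing m v" and "q = pairing m w"
  \<comment> \<open>The pole orders of \<open>monomial m\<close> along the two coordinate axes; they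
    vanish where the flags forbid a denominator.\<close>
  define i' j' where "i' = nat (- p)" and "j' = nat (- q)"
  let ?s = "var_X ^ i' * var_Y ^ j' :: 'k fract poly poly"
  let ?b = "monom (monom (to_fract c) (nat q)) (nat p)"
  have s': "?s * s \<in> var_powers hv hw"
  proof -
    have "?s * s = var_X ^ (i' + i) * var_Y ^ (j' + j)" by (simp add: s power_add algebra_simps)
    moreover have "(hv \<longrightarrow> i' + i = 0) \<and> (hw \<longrightarrow> j' + j = 0)"
      using s step(1) by (auto simp: cone_points_def i'_def j'_def p_def q_def)
    ultimately show ?thesis unfolding var_powers_def by blast
  qed
  have "dual (int (nat p)) (int (nat q)) = m + dual (int i') (int j')"
  proof -
    have "int (nat p) = p + int i'" "int (nat q) = q + int j'" by (simp_all add: i'_def j'_def)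
    then show ?thesis using dual_pairing[of m] by (simp add: dual_point_add p_def q_def)
  qed
  then have "\<phi> ?b = scale c (monomial m) * \<phi> ?s"
    by (simp add: phi_var_powers) (simp add: phi_def chart_map_monom scale_def monomial_add)
  moreover have nz: "\<phi> ?s \<noteq> 0" "\<phi> s \<noteq> 0" by (simp_all add: s phi_var_powers)
  ultimately have "scale c (monomial m) = \<phi> ?b / \<phi> ?s" by (simp add: field_simps)
  then have "scale c (monomial m) + g = \<phi> (?b * s + a * ?s) / \<phi> (?s * s)"
    using nz unfolding g(1) by (simp add: phi_def chart_map_hom add_frac_eq)
  then show ?case using s' by blast
qed

lemma cone_points_UNIV: "cone_points False False = UNIV"
  by (simp add: cone_points_def)

lemma laurent_mult: "f \<in> laurent \<Longrightarrow> g \<in> laurent \<Longrightarrow> f * g \<in> laurent"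
  by (rule monomial_span_mult) auto

text \<open>A rational function is a quotient of two Laurent polynomials, and each of these is a
  fraction in the coordinates of the chart.\<close>

sublocale fraction_embedding \<phi>
proof
  show inj: "p = 0" if "\<phi> p = 0" for p
  proof (intro poly_eqI)
    fix i j
    show "coeff (coeff p i) j = coeff (coeff 0 i) j"
      using coefficient_phi[of i j p] that by simp
  qed
  show "\<exists>a b. b \<noteq> 0 \<and> f = \<phi> a / \<phi> b" for f
  proof -
    obtain x y where xy: "f = Fract x y" "y \<noteq> 0" by (cases f)
    obtain a s where a: "to_fract x = \<phi> a / \<phi> s" "s \<in> var_powers False False"
      using laurent_fraction[of "to_fract x" False False] to_fract_in_laurent[of x]
      by (auto simp: cone_points_UNIV)
    obtain b t where b: "to_fract y = \<phi> b / \<phi> t" "t \<in> var_powers False False"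
      using laurent_fraction[of "to_fract y" False False] to_fract_in_laurent[of y]
      by (auto simp: cone_points_UNIV)
    have "b \<noteq> 0" using b xy by (auto simp: phi_def chart_map_hom)
    moreover have "s \<noteq> 0" using a mult_set_var_powers[of False False] by (auto simp: mult_set_def)
    moreover have "f = \<phi> (a * t) / \<phi> (b * s)"
      using xy a b by (simp add: Fract_conv_to_fract phi_def chart_map_hom)
    ultimately show ?thesis by (metis mult_eq_0_iff)
  qed
qed (simp_all add: phi_def chart_map_hom)

lemma fractions_var_powers: "fractions (var_powers hv hw) = monomial_span (cone_points hv hw)"
proof (intro equalityI subsetI)
  fix f assume "f \<in> fractions (var_powers hv hw)"
  then obtain a i j where f: "f = \<phi> a / \<phi> (var_X ^ i * var_Y ^ j)" "hv \<longrightarrow> i = 0" "hw \<longrightarrow> j = 0"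
    unfolding fractions_def var_powers_def by blast
  let ?d = "dual (int i) (int j)"
  have "f = \<phi> a * monomial (- ?d)" using f(1) by (simp add: phi_var_powers monomial_uminus divide_inverse)
  moreover have "\<phi> a * monomial (- ?d) \<in> monomial_span (cone_points hv hw)"
    by (rule monomial_span_mult[OF phi_mem monomial_span_base[of _ "{- ?d}"]])
      (use f in \<open>auto simp: cone_points_def pairing_simps pairing_dual\<close>)
  ultimately show "f \<in> monomial_span (cone_points hv hw)" by simp
next
  fix f :: "'k function_field" assume "f \<in> monomial_span (cone_points hv hw)"
  then show "f \<in> fractions (var_powers hv hw)"
    using laurent_fraction[of f hv hw] by (auto intro: fractionsI)
qed

lemmas fractions_laurent = fractions_var_powers[of False False, unfolded cone_points_UNIV]

lemma val_ring_torus: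
  assumes "prime_elem r" "\<forall>s\<in>var_powers False False. \<not> r dvd s"
  shows "val_ring r \<in> local_rings laurent"
  using prime_gen_spectrum[OF mult_set_var_powers assms] unfolding local_rings_def fractions_laurent
  by blast

lemma phi_var_X: "\<phi> var_X = monomial (dual 1 0)"
  using phi_var_powers[of 1 0] by simp

lemma phi_var_Y: "\<phi> var_Y = monomial (dual 0 1)"
  using phi_var_powers[of 0 1] by simp

lemma image_monomial_span:
  "(\<lambda>f. monomial m * f) ` monomial_span {n. P (m + n)} = monomial_span {n. P n}"
proof (intro equalityI subsetI)
  fix f assume f: "f \<in> monomial_span {n. P n}"
  have f': "f = monomial m * (monomial (- m) * f)" by (simp add: monomial_uminus)
  then have "monomial (- m) * f \<in> monomial_span {n. P (m + n)}" using f monomial_shift_iff by metis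
  then show "f \<in> (\<lambda>f. monomial m * f) ` monomial_span {n. P (m + n)}" using f' by blast
qed (auto simp: monomial_shift_iff)

lemma prime_gen_X: "prime_gen var_X (var_powers True False) = divisor_ideal v"
  using image_monomial_span[of "dual 1 0" "\<lambda>n. 1 \<le> pairing n v"]
  by (simp add: prime_gen_def fractions_var_powers phi_var_X divisor_ideal_def cone_points_def
      pairing_simps pairing_dual)

lemma prime_gen_Y: "prime_gen var_Y (var_powers False True) = divisor_ideal w"
  using image_monomial_span[of "dual 0 1" "\<lambda>n. 1 \<le> pairing n w"]
  by (simp add: prime_gen_def fractions_var_powers phi_var_Y divisor_ideal_def cone_points_def
      pairing_simps pairing_dual)

text \<open>With \<open>var_Y\<close> inverted, the chart is that of the ray of \<open>v\<close>,
  and \<open>var_X\<close> generates the ideal of its divisor. The resulting ring does not involve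
  \<open>w\<close>, so different charts containing the ray can be compared.\<close>

lemma val_ring_X: "val_ring var_X = divisor_ring v"
  and divisor_ideal_prime:
    "(divisor_ideal v :: 'k function_field set) \<in> prime_spectrum (monomial_span {m. 0 \<le> pairing m v})"
proof -
  have *: "cone_points True False = {m. 0 \<le> pairing m v}" by (simp add: cone_points_def)
  have "\<forall>s\<in>var_powers True False. \<not> (var_X :: 'k fract poly poly) dvd s" using var_not_dvd(1) by blast
  from prime_gen_spectrum[OF mult_set_var_powers prime_elem_var(1) this]
  show "val_ring var_X = divisor_ring v"
    and "(divisor_ideal v :: 'k function_field set) \<in> prime_spectrum (monomial_span {m. 0 \<le> pairing m v})"
    by (simp_all add: prime_gen_X fractions_var_powers * divisor_ring_def)
qed

lemma val_ring_Y: "val_ring var_Y = divisor_ring w"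
proof -
  have *: "cone_points False True = {m. 0 \<le> pairing m w}" by (simp add: cone_points_def)
  have "\<forall>s\<in>var_powers False True. \<not> (var_Y :: 'k fract poly poly) dvd s" using var_not_dvd(2) by blast
  from prime_gen_spectrum[OF mult_set_var_powers prime_elem_var(2) this]
  show ?thesis by (simp_all add: prime_gen_Y fractions_var_powers * divisor_ring_def)
qed

text \<open>Either \<open>r\<close> divides no monomial and defines a curve meeting the torus, or it
  is associated to a coordinate, which the assumption on \<open>S\<close> permits only for the rays
  of the face.\<close>

lemma val_ring_cases:
  assumes r: "prime_elem r" and S: "\<forall>s\<in>var_powers hv hw. \<not> r dvd s"
  obtains (torus) "val_ring r \<in> local_rings laurent" "\<forall>s\<in>var_powers False False. \<not> r dvd s"
  | (first) hv "val_ring r = divisor_ring v" | (second) hw "val_ring r = divisor_ring w"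
proof (cases "\<forall>s\<in>var_powers False False. \<not> r dvd s")
  case True
  then show ?thesis using val_ring_torus[OF r] torus by blast
next
  case False
  then have "(r dvd var_X \<and> var_X dvd r) \<or> (r dvd var_Y \<and> var_Y dvd r)"
    using prime_dvd_var_powers[OF r] by blast
  then show ?thesis
  proof
    assume *: "r dvd var_X \<and> var_X dvd r"
    then have "val_ring r = val_ring var_X" unfolding val_ring_def by (metis dvd_trans)
    moreover have hv
    proof (rule ccontr)
      assume "\<not> hv"
      then have "var_X ^ 1 * var_Y ^ 0 \<in> var_powers hv hw" unfolding var_powers_def by blast
      then show False using S * by force
    qed
    ultimately show ?thesis using first val_ring_X by simp
  next
    assume *: "r dvd var_Y \<and> var_Y dvd r"
    then have "val_ring r = val_ring var_Y" unfolding val_ring_def by (metis dvd_trans)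
    moreover have hw
    proof (rule ccontr)
      assume "\<not> hw"
      then have "var_X ^ 0 * var_Y ^ 1 \<in> var_powers hv hw" unfolding var_powers_def by blast
      then show False using S * by force
    qed
    ultimately show ?thesis using second val_ring_Y by simp
  qed
qed

end

section \<open>Smooth complete fans\<close>

lemma inner_lat: "inner (lat m) (lat n) = real_of_int (pairing m n)"
  by (simp add: lat_def pairing_def)

lemma lattice_basis_det:
  assumes "lattice_basis v w"
  shows "det2 v w * det2 v w = 1"
proof -
  have surj: "\<exists>a b. a * fst v + b * fst w = x \<and> a * snd v + b * snd w = y" for x y
  proof -
    have "(x, y) \<in> range (\<lambda>(a, b). (a * fst v + b * fst w, a * snd v + b * snd w))"
      using bij_is_surj[OF assms[unfolded lattice_basis_def]] by simp
    then show ?thesis by auto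
  qed
  obtain a b where ab: "a * fst v + b * fst w = 1" "a * snd v + b * snd w = 0" using surj by blast
  obtain c d where cd: "c * fst v + d * fst w = 0" "c * snd v + d * snd w = 1" using surj by blast
  have "(a * d - b * c) * det2 v w =
      (a * fst v + b * fst w) * (c * snd v + d * snd w) - (c * fst v + d * fst w) * (a * snd v + b * snd w)"
    by (simp add: det2_def algebra_simps)
  also have "\<dots> = 1" using ab cd by simp
  finally have "det2 v w dvd 1" by (metis dvd_triv_right)
  then show ?thesis by (auto simp: zdvd1_eq abs_if split: if_splits)
qed

lemma det2_commute: "det2 w v = - det2 v w"
  by (simp add: det2_def)

lemma convex_cone_hull_lat:
  assumes "B \<subseteq> {v, w}" "v \<noteq> w"
  shows "convex_cone hull (lat ` B) =
    {a *\<^sub>R lat v + b *\<^sub>R lat w | a b. 0 \<le> a \<and> 0 \<le> b \<and> (v \<notin> B \<longrightarrow> a = 0) \<and> (w \<notin> B \<longrightarrow> b = 0)}"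
    (is "_ = ?C")
proof (rule hull_unique)
  show "lat ` B \<subseteq> ?C"
  proof (rule image_subsetI)
    fix x assume x: "x \<in> B"
    then consider "x = v" | "x = w" using assms by blast
    then show "lat x \<in> ?C"
    proof cases
      case 1 then show ?thesis using x by (intro CollectI exI[of _ 1] exI[of _ 0]) auto
    next
      case 2 then show ?thesis using x by (intro CollectI exI[of _ 0] exI[of _ 1]) auto
    qed
  qed
  show "convex_cone ?C"
    unfolding convex_cone_iff
  proof (intro conjI ballI allI impI)
    show "0 \<in> ?C" by (intro CollectI exI[of _ 0]) auto
  next
    fix x y assume "x \<in> ?C" "y \<in> ?C"
    then obtain a b a' b' where "x = a *\<^sub>R lat v + b *\<^sub>R lat w" "y = a' *\<^sub>R lat v + b' *\<^sub>R lat w"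
      "0 \<le> a \<and> 0 \<le> b \<and> (v \<notin> B \<longrightarrow> a = 0) \<and> (w \<notin> B \<longrightarrow> b = 0)"
      "0 \<le> a' \<and> 0 \<le> b' \<and> (v \<notin> B \<longrightarrow> a' = 0) \<and> (w \<notin> B \<longrightarrow> b' = 0)" by blast
    then show "x + y \<in> ?C"
      by (intro CollectI exI[of _ "a + a'"] exI[of _ "b + b'"]) (auto simp: algebra_simps)
  next
    fix x c assume "x \<in> ?C" "0 \<le> (c::real)"
    then obtain a b where "x = a *\<^sub>R lat v + b *\<^sub>R lat w"
      "0 \<le> a \<and> 0 \<le> b \<and> (v \<notin> B \<longrightarrow> a = 0) \<and> (w \<notin> B \<longrightarrow> b = 0)" by blast
    then show "c *\<^sub>R x \<in> ?C" using \<open>0 \<le> c\<close>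
      by (intro CollectI exI[of _ "c * a"] exI[of _ "c * b"]) (auto simp: algebra_simps)
  qed
  fix D assume D: "lat ` B \<subseteq> D" "convex_cone D"
  show "?C \<subseteq> D"
  proof
    fix x assume "x \<in> ?C"
    then obtain a b where x: "x = a *\<^sub>R lat v + b *\<^sub>R lat w"
      "0 \<le> a \<and> 0 \<le> b \<and> (v \<notin> B \<longrightarrow> a = 0) \<and> (w \<notin> B \<longrightarrow> b = 0)" by blast
    have "a *\<^sub>R lat v \<in> D" "b *\<^sub>R lat w \<in> D"
      using x D unfolding convex_cone_iff by (metis image_subset_iff scaleR_zero_left)+
    then show "x \<in> D" unfolding x using D unfolding convex_cone_iff by blast
  qed
qed

text \<open>The determinant condition, that \<open>v\<close> can be completed to a lattice basis,
  says that \<open>v\<close> is primitive.\<close>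

definition rays :: "(real \<times> real) set set \<Rightarrow> (int \<times> int) set" where
  "rays \<Delta> = {v. (\<exists>w. det2 v w * det2 v w = 1) \<and> convex_cone hull (lat ` {v}) \<in> \<Delta>}"

context chart
begin

lemma v_neq_w: "v \<noteq> w"
  using det by (auto simp: det2_def)

lemma coordinates_lat:
  "inner (lat (dual i j)) (a *\<^sub>R lat v + b *\<^sub>R lat w) = a * i + b * j"
  by (simp add: inner_add_right inner_lat pairing_dual)

lemma chart_ring_cone:
  assumes "B \<subseteq> {v, w}"
  shows "chart_ring (convex_cone hull (lat ` B)) = monomial_span (cone_points (v \<in> B) (w \<in> B))"
proof -
  have "(\<forall>z\<in>convex_cone hull (lat ` B). 0 \<le> inner (lat m) z) \<longleftrightarrow> m \<in> cone_points (v \<in> B) (w \<in> B)" for m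
  proof
    assume *: "\<forall>z\<in>convex_cone hull (lat ` B). 0 \<le> inner (lat m) z"
    have "0 \<le> inner (lat m) (lat x)" if "x \<in> B" for x
      using * hull_inc[of "lat x" "lat ` B"] that by blast
    then show "m \<in> cone_points (v \<in> B) (w \<in> B)"
      by (auto simp: cone_points_def inner_lat)
  next
    assume "m \<in> cone_points (v \<in> B) (w \<in> B)"
    then show "\<forall>z\<in>convex_cone hull (lat ` B). 0 \<le> inner (lat m) z"
      unfolding convex_cone_hull_lat[OF assms v_neq_w]
      by (auto simp: cone_points_def inner_add_right inner_lat)
  qed
  then show ?thesis unfolding chart_ring_eq by (intro arg_cong[of _ _ monomial_span]) blast
qed

text \<open>The pairings with the dual basis are the coordinates of \<open>y\<close> with respect to
  \<open>v\<close> and \<open>w\<close>, so integers suffice to decide membership.\<close>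

lemma lat_mem_cone:
  assumes "B \<subseteq> {v, w}"
  shows "lat y \<in> convex_cone hull (lat ` B) \<longleftrightarrow>
    0 \<le> pairing (dual 1 0) y \<and> 0 \<le> pairing (dual 0 1) y \<and>
    (v \<notin> B \<longrightarrow> pairing (dual 1 0) y = 0) \<and> (w \<notin> B \<longrightarrow> pairing (dual 0 1) y = 0)"
    (is "_ \<longleftrightarrow> ?R")
proof
  let ?a = "pairing (dual 1 0) y" and ?b = "pairing (dual 0 1) y"
  assume "lat y \<in> convex_cone hull (lat ` B)"
  then obtain a b where ab: "lat y = a *\<^sub>R lat v + b *\<^sub>R lat w"
    "0 \<le> a \<and> 0 \<le> b \<and> (v \<notin> B \<longrightarrow> a = 0) \<and> (w \<notin> B \<longrightarrow> b = 0)"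
    unfolding convex_cone_hull_lat[OF assms v_neq_w] by blast
  have "real_of_int ?a = a" "real_of_int ?b = b"
    using coordinates_lat[of 1 0 a b] coordinates_lat[of 0 1 a b] by (simp_all add: inner_lat flip: ab(1))
  then show ?R using ab(2) by auto
next
  let ?a = "pairing (dual 1 0) y" and ?b = "pairing (dual 0 1) y"
  assume R: ?R
  have "?a * fst v + ?b * fst w = det2 v w * det2 v w * fst y"
    "?a * snd v + ?b * snd w = det2 v w * det2 v w * snd y"
    by (simp_all add: pairing_def dual_point_def det2_def algebra_simps)
  then have "fst y = ?a * fst v + ?b * fst w" "snd y = ?a * snd v + ?b * snd w" using det by simp_all
  then have "lat y = real_of_int ?a *\<^sub>R lat v + real_of_int ?b *\<^sub>R lat w"
    by (simp add: lat_def)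
  then show "lat y \<in> convex_cone hull (lat ` B)"
    unfolding convex_cone_hull_lat[OF assms v_neq_w] using R
    by (intro CollectI exI[of _ "real_of_int ?a"] exI[of _ "real_of_int ?b"]) auto
qed

lemma ray_cone: "convex_cone hull (lat ` {v}) = {a *\<^sub>R lat v | a. 0 \<le> a}"
proof -
  have "{v} \<subseteq> {v, w}" by blast
  from convex_cone_hull_lat[OF this v_neq_w] show ?thesis using v_neq_w by simp
qed

lemma ray_face:
  assumes "B \<subseteq> {v, w}" "v \<in> B"
  shows "cone_face (convex_cone hull (lat ` {v})) (convex_cone hull (lat ` B))"
  unfolding cone_face_def
proof (intro exI conjI ballI)
  fix z assume "z \<in> convex_cone hull (lat ` B)"
  then show "0 \<le> inner (lat (dual 0 1)) z"
    unfolding convex_cone_hull_lat[OF assms(1) v_neq_w]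
    by (auto simp: inner_add_right inner_lat pairing_dual)
next
  show "convex_cone hull (lat ` {v}) = {z \<in> convex_cone hull (lat ` B). inner (lat (dual 0 1)) z = 0}"
    unfolding convex_cone_hull_lat[OF assms(1) v_neq_w] ray_cone
  proof (intro equalityI subsetI)
    fix z assume "z \<in> {a *\<^sub>R lat v | a. 0 \<le> a}"
    then obtain a where "z = a *\<^sub>R lat v + 0 *\<^sub>R lat w" "0 \<le> a" by auto
    then show "z \<in> {z \<in> {a *\<^sub>R lat v + b *\<^sub>R lat w |a b. 0 \<le> a \<and> 0 \<le> b \<and>
        (v \<notin> B \<longrightarrow> a = 0) \<and> (w \<notin> B \<longrightarrow> b = 0)}. inner (lat (dual 0 1)) z = 0}"
      using assms(2) coordinates_lat[of 0 1 a 0] by fastforce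
  next
    fix z assume "z \<in> {z \<in> {a *\<^sub>R lat v + b *\<^sub>R lat w |a b. 0 \<le> a \<and> 0 \<le> b \<and>
        (v \<notin> B \<longrightarrow> a = 0) \<and> (w \<notin> B \<longrightarrow> b = 0)}. inner (lat (dual 0 1)) z = 0}"
    then obtain a b where ab: "z = a *\<^sub>R lat v + b *\<^sub>R lat w" "0 \<le> a" "inner (lat (dual 0 1)) z = 0"
      by blast
    then have "b = 0" using coordinates_lat[of 0 1 a b] by simp
    then show "z \<in> {a *\<^sub>R lat v | a. 0 \<le> a}" using ab by auto
  qed
qed

lemma origin_face:
  assumes "B \<subseteq> {v, w}"
  shows "cone_face {0} (convex_cone hull (lat ` B))"
  unfolding cone_face_def
proof (intro exI conjI ballI)
  fix z assume "z \<in> convex_cone hull (lat ` B)"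
  then show "0 \<le> inner (lat (dual 1 1)) z"
    unfolding convex_cone_hull_lat[OF assms v_neq_w]
    by (auto simp: inner_add_right inner_lat pairing_dual)
next
  show "{0} = {z \<in> convex_cone hull (lat ` B). inner (lat (dual 1 1)) z = 0}"
  proof (intro equalityI subsetI)
    fix z assume "z \<in> {z \<in> convex_cone hull (lat ` B). inner (lat (dual 1 1)) z = 0}"
    then obtain a b where ab: "z = a *\<^sub>R lat v + b *\<^sub>R lat w" "0 \<le> a" "0 \<le> b"
      "inner (lat (dual 1 1)) z = 0"
      unfolding convex_cone_hull_lat[OF assms v_neq_w] by blast
    then have "a + b = 0" using coordinates_lat[of 1 1 a b] by simp
    then have "a = 0 \<and> b = 0" using ab(2,3) by linarith
    then show "z \<in> {0}" using ab(1) by simp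
  qed (simp add: convex_cone_hull_contains_0)
qed

end

section \<open>Rays and adjacent maximal cones\<close>

lemma pairing_witness:
  assumes "det2 v w * det2 v w = 1"
  shows "\<exists>f. pairing f v = 1"
proof -
  interpret chart v w "chart_map v w" by unfold_locales (simp_all add: assms)
  show ?thesis using pairing_dual(1)[of 1 0] by blast
qed

text \<open>Each vector is an integral multiple of the other, and the two factors have product
  \<open>1\<close>.\<close>

lemma primitive_parallel:
  assumes v: "pairing f v = 1" and w: "pairing g w = 1" and det: "det2 v w = 0"
  shows "w = v \<or> w = - v"
proof -
  have "pairing (perp w) v = 0" "pairing (perp v) w = 0"
    using det det2_commute[of v w] by (simp_all add: pairing_perp)
  then obtain k l where k: "perp w = (k * fst (perp v), k * snd (perp v))"
    and l: "perp v = (l * fst (perp w), l * snd (perp w))"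
    using pairing_eq_0D v w by metis
  have w: "w = (k * fst v, k * snd v)" and v': "v = (l * fst w, l * snd w)"
    using k l by (auto simp: perp_def prod_eq_iff)
  have "pairing f v = l * pairing f w" by (subst v') (simp add: pairing_def algebra_simps)
  moreover have "pairing f w = k * pairing f v" by (subst w) (simp add: pairing_def algebra_simps)
  ultimately have "1 = k * l" using v by (simp add: mult.commute)
  then have "k dvd 1" by (rule dvdI)
  then have "k = 1 \<or> k = - 1" by (auto simp: abs_if split: if_splits)
  then show ?thesis using w by (auto simp: prod_eq_iff)
qed

locale smooth_fan =
  fixes \<Delta> :: "(real \<times> real) set set"
  assumes smooth_complete: "smooth_complete_fan \<Delta>"
begin

lemma finite_fan: "finite \<Delta>" and fan_nonempty: "\<Delta> \<noteq> {}"
  and face_mem: "\<sigma> \<in> \<Delta> \<Longrightarrow> cone_face \<tau> \<sigma> \<Longrightarrow> \<tau> \<in> \<Delta>"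
  and Int_face: "\<sigma> \<in> \<Delta> \<Longrightarrow> \<tau> \<in> \<Delta> \<Longrightarrow> cone_face (\<sigma> \<inter> \<tau>) \<sigma>"
    "\<sigma> \<in> \<Delta> \<Longrightarrow> \<tau> \<in> \<Delta> \<Longrightarrow> cone_face (\<sigma> \<inter> \<tau>) \<tau>"
  and complete: "\<Union>\<Delta> = UNIV"
  and smooth: "\<sigma> \<in> \<Delta> \<Longrightarrow> smooth_cone \<sigma>"
  using smooth_complete unfolding smooth_complete_fan_def complete_fan_def fan_def by blast+

lemma ray_witness: "v \<in> rays \<Delta> \<Longrightarrow> \<exists>f. pairing f v = 1"
  unfolding rays_def using pairing_witness by blast

lemma ray_parallel: "v \<in> rays \<Delta> \<Longrightarrow> w \<in> rays \<Delta> \<Longrightarrow> v \<noteq> w \<Longrightarrow> det2 v w = 0 \<Longrightarrow> w = - v"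
  using primitive_parallel ray_witness by metis

lemma coneE:
  assumes "\<sigma> \<in> \<Delta>"
  obtains v w B where "det2 v w * det2 v w = 1" "B \<subseteq> {v, w}" "\<sigma> = convex_cone hull (lat ` B)"
    "B \<subseteq> rays \<Delta>"
proof -
  obtain v w B where *: "lattice_basis v w" "B \<subseteq> {v, w}" "\<sigma> = convex_cone hull (lat ` B)"
    using smooth[OF assms] unfolding smooth_cone_def by blast
  note det = lattice_basis_det[OF *(1)]
  then have det': "det2 w v * det2 w v = 1" by (simp add: det2_commute[of v w])
  interpret A: chart v w "chart_map v w" by unfold_locales (simp_all add: det)
  interpret B: chart w v "chart_map w v" by unfold_locales (simp_all add: det')
  have "v \<in> rays \<Delta>" if "v \<in> B"
    using face_mem[OF assms] A.ray_face[OF *(2) that] det unfolding rays_def *(3) by blast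
  moreover have "w \<in> rays \<Delta>" if "w \<in> B"
    using face_mem[OF assms] B.ray_face[of B] that det' *(2) unfolding rays_def *(3) by blast
  ultimately have "B \<subseteq> rays \<Delta>" using *(2) by blast
  then show ?thesis using that det * by blast
qed

lemma origin_mem: "{0} \<in> \<Delta>"
proof -
  obtain \<sigma> where \<sigma>: "\<sigma> \<in> \<Delta>" using fan_nonempty by blast
  then obtain v w B where *: "det2 v w * det2 v w = 1" "B \<subseteq> {v, w}" "\<sigma> = convex_cone hull (lat ` B)"
    by (rule coneE)
  interpret chart v w "chart_map v w" by unfold_locales (simp_all add: *)
  show ?thesis using face_mem[OF \<sigma>] origin_face[OF *(2)] *(3) by blast
qed

lemma lat_mem_ray:
  assumes "v \<in> rays \<Delta>" "lat y \<in> convex_cone hull (lat ` {v})"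
  shows "det2 v y = 0" "y \<noteq> - v"
proof -
  obtain w where "det2 v w * det2 v w = 1" using assms(1) by (auto simp: rays_def)
  then interpret chart v w "chart_map v w" by unfold_locales simp_all
  have "{v} \<subseteq> {v, w}" by blast
  from lat_mem_cone[OF this, of y] assms(2) v_neq_w
  have *: "0 \<le> pairing (dual 1 0) y" "pairing (dual 0 1) y = 0" by auto
  have "pairing (dual 0 1) y = det2 v w * det2 v y"
    by (simp add: pairing_def dual_point_def det2_def algebra_simps)
  then show "det2 v y = 0" using * det_neq_0 by simp
  show "y \<noteq> - v" using *(1) pairing_dual(1)[of 1 0] by (auto simp: pairing_simps)
qed

lemma finite_rays: "finite (rays \<Delta>)"
proof -
  have "inj_on (\<lambda>v. convex_cone hull (lat ` {v})) (rays \<Delta>)"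
  proof (rule inj_onI, rule ccontr)
    fix v w assume vw: "v \<in> rays \<Delta>" "w \<in> rays \<Delta>" "v \<noteq> w"
      "convex_cone hull (lat ` {v}) = convex_cone hull (lat ` {w})"
    have "lat w \<in> convex_cone hull (lat ` {v})" unfolding vw(4) by (rule hull_inc) simp
    from lat_mem_ray[OF vw(1) this] ray_parallel[OF vw(1-3)] show False by blast
  qed
  moreover have "(\<lambda>v. convex_cone hull (lat ` {v})) ` rays \<Delta> \<subseteq> \<Delta>" by (auto simp: rays_def)
  ultimately show ?thesis using finite_fan inj_on_finite by blast
qed

text \<open>
  The cone on the given side of the ray spanned by \<open>v\<close> is found by moving from \<open>v\<close> slightly into
  that direction: as the fan is finite, one of its cones contains \<open>n v \<plusminus> perp v\<close> for arbitrarily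
  large \<open>n\<close>.
\<close>

lemma adjacent_cone:
  assumes v: "v \<in> rays \<Delta>" and e: "e * e = (1::int)"
  obtains w where "det2 v w = e" "w \<in> rays \<Delta>" "convex_cone hull (lat ` {v, w}) \<in> \<Delta>"
proof -
  define y where "y n = (int n * fst v + e * fst (perp v), int n * snd v + e * snd (perp v))" for n
  have py: "pairing m (y n) = int n * pairing m v + e * pairing m (perp v)" for m n
    by (simp add: y_def pairing_def algebra_simps)
  obtain f where f: "pairing f v = 1" using ray_witness[OF v] by blast
  define N where "N = fst v * fst v + snd v * snd v"
  have N: "N > 0"
  proof -
    have "v \<noteq> 0" using f by (auto simp: pairing_def)
    then show ?thesis by (auto simp: N_def sum_squares_gt_zero_iff prod_eq_iff)
  qed
  have dy: "det2 v (y n) = e * N" for n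
    by (simp add: y_def det2_def perp_def N_def algebra_simps)
  have e0: "e \<noteq> 0" using e by auto
  have "\<exists>\<sigma>\<in>\<Delta>. infinite {n\<in>UNIV. lat (y n) \<in> \<sigma>}"
    by (rule pigeonhole_infinite_rel[OF _ finite_fan]) (use complete in auto)
  then obtain \<sigma> where \<sigma>: "\<sigma> \<in> \<Delta>" "infinite {n. lat (y n) \<in> \<sigma>}" by auto
  obtain p q B where *: "det2 p q * det2 p q = 1" "B \<subseteq> {p, q}" "\<sigma> = convex_cone hull (lat ` B)"
    "B \<subseteq> rays \<Delta>" using coneE[OF \<sigma>(1)] by blast
  interpret chart p q "chart_map p q" by unfold_locales (simp_all add: *)
  note mem = lat_mem_cone[OF *(2), folded *(3)]
  define K where "K = nat (\<bar>pairing (dual 1 0) (perp v)\<bar> + \<bar>pairing (dual 0 1) (perp v)\<bar>)"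
  obtain n where n: "n > K" "lat (y n) \<in> \<sigma>" using \<sigma>(2) unfolding infinite_nat_iff_unbounded by blast
  have e1: "e = 1 \<or> e = - 1" using e by (simp add: zmult_eq_1_iff)
  \<comment> \<open>For such \<open>n\<close> a nonzero pairing with \<open>v\<close> outweighs the
    one with \<open>perp v\<close> and decides the sign at \<open>y n\<close>. This forces
    \<open>v\<close> into the cone of \<open>y n\<close>.\<close>
  have small: "(0 \<le> pairing m (y n) \<longrightarrow> 0 \<le> pairing m v) \<and> (pairing m (y n) = 0 \<longrightarrow> pairing m v = 0)"
    if "\<bar>pairing m (perp v)\<bar> < int n" for m
  proof -
    have "\<bar>e * pairing m (perp v)\<bar> < int n" using that e1 by auto
    moreover have "int n * pairing m v \<le> - int n" if "pairing m v < 0"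
      using mult_left_mono[of "pairing m v" "- 1" "int n"] that by simp
    moreover have "int n * pairing m v \<ge> int n" if "pairing m v > 0"
      using mult_left_mono[of 1 "pairing m v" "int n"] that by simp
    ultimately show ?thesis unfolding py by (smt (verit))
  qed
  have small': "\<bar>pairing (dual 1 0) (perp v)\<bar> < int n" "\<bar>pairing (dual 0 1) (perp v)\<bar> < int n"
    using n(1) by (auto simp: K_def)
  have v\<sigma>: "lat v \<in> \<sigma>"
    using n(2) small[OF small'(1)] small[OF small'(2)] unfolding mem by blast
  let ?\<rho> = "convex_cone hull (lat ` {v})"
  have \<rho>: "?\<rho> \<in> \<Delta>" using v by (simp add: rays_def)
  have v\<rho>: "lat v \<in> ?\<rho>" by (rule hull_inc) simp
  have y\<rho>: "lat (y n) \<notin> ?\<rho>" using lat_mem_ray(1)[OF v, of "y n"] dy e0 N by auto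
  \<comment> \<open>The intersection with the ray is a face, cut out by some \<open>u\<close> that
    vanishes at \<open>v\<close> but not at \<open>y n\<close>.\<close>
  obtain u where u: "\<forall>z\<in>\<sigma>. 0 \<le> inner u z" "\<sigma> \<inter> ?\<rho> = {z\<in>\<sigma>. inner u z = 0}"
    using Int_face(1)[OF \<sigma>(1) \<rho>] unfolding cone_face_def by blast
  have uv: "inner u (lat v) = 0" using u(2) v\<sigma> v\<rho> by blast
  have uy: "inner u (lat (y n)) \<noteq> 0" using u(2) n(2) y\<rho> by blast
  define a b where "a = pairing (dual 1 0) v" and "b = pairing (dual 0 1) v"
  have ab: "0 \<le> a" "0 \<le> b" using v\<sigma> unfolding mem a_def b_def by auto
  have v_eq: "v = (a * fst p + b * fst q, a * snd p + b * snd q)"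
  proof -
    have "a * fst p + b * fst q = det2 p q * det2 p q * fst v"
      "a * snd p + b * snd q = det2 p q * det2 p q * snd v"
      by (simp_all add: a_def b_def pairing_def dual_point_def det2_def algebra_simps)
    then show ?thesis using det by (simp add: prod_eq_iff)
  qed
  have y_eq: "y n = (a' * fst p + b' * fst q, a' * snd p + b' * snd q)"
    if "a' = pairing (dual 1 0) (y n)" "b' = pairing (dual 0 1) (y n)" for a' b'
  proof -
    have "a' * fst p + b' * fst q = det2 p q * det2 p q * fst (y n)"
      "a' * snd p + b' * snd q = det2 p q * det2 p q * snd (y n)"
      by (simp_all add: that pairing_def dual_point_def det2_def algebra_simps)
    then show ?thesis using det by (simp add: prod_eq_iff)
  qed
  define a' b' where "a' = pairing (dual 1 0) (y n)" and "b' = pairing (dual 0 1) (y n)"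
  note y_eq = y_eq[OF a'_def b'_def]
  have ab': "0 \<le> a'" "0 \<le> b'" using n(2) unfolding mem a'_def b'_def by auto
  have det_vy: "det2 v (y n) = (a * b' - b * a') * det2 p q"
    by (subst v_eq, subst y_eq) (simp add: det2_def algebra_simps)
  then have nz: "a * b' - b * a' \<noteq> 0" using dy e0 N by auto
  have B: "p \<in> B" "q \<in> B"
  proof -
    show "p \<in> B"
    proof (rule ccontr)
      assume "p \<notin> B"
      then have "a = 0" "a' = 0" using v\<sigma> n(2) unfolding mem a_def a'_def by auto
      then show False using nz by simp
    qed
    show "q \<in> B"
    proof (rule ccontr)
      assume "q \<notin> B"
      then have "b = 0" "b' = 0" using v\<sigma> n(2) unfolding mem b_def b'_def by auto
      then show False using nz by simp
    qed
  qed
  have lat_comb: "lat (c * fst p + d * fst q, c * snd p + d * snd q) = real_of_int c *\<^sub>R lat p + real_of_int d *\<^sub>R lat q"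
    for c d by (simp add: lat_def)
  have up: "0 \<le> inner u (lat p)" "0 \<le> inner u (lat q)"
    using u(1) B hull_inc[of _ "lat ` B"] unfolding *(3) by blast+
  have uv': "a * inner u (lat p) + b * inner u (lat q) = 0"
    using uv by (subst (asm) v_eq) (simp add: lat_comb inner_add_right)
  have uy': "a' * inner u (lat p) + b' * inner u (lat q) \<noteq> 0"
    using uy by (subst (asm) y_eq) (simp add: lat_comb inner_add_right)
  have prim_p: "\<exists>g. pairing g p = 1" "\<exists>g. pairing g q = 1"
    using pairing_dual(1)[of 1 0] pairing_dual(2)[of 0 1] by blast+
  \<comment> \<open>If both coordinates of \<open>v\<close> were positive, then \<open>u\<close>,
    nonnegative on both generators, would vanish on them and thus at \<open>y n\<close>. So
    \<open>v\<close> is one of the generators.\<close>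
  have "a = 0 \<or> b = 0"
  proof (rule ccontr)
    assume "\<not> ?thesis"
    then have "0 < a" "0 < b" using ab by auto
    then have "inner u (lat p) = 0 \<and> inner u (lat q) = 0"
      using uv' up by (smt (verit) mult_nonneg_nonneg mult_pos_pos of_int_0_less_iff)
    then show False using uy' by simp
  qed
  then have "v = p \<and> a = 1 \<and> b = 0 \<or> v = q \<and> a = 0 \<and> b = 1"
  proof
    assume a: "a = 0"
    then have "det2 q v = 0" by (subst v_eq) (simp add: det2_def)
    then have "v = q \<or> v = - q" using primitive_parallel prim_p(2) f by blast
    moreover have "pairing (dual 0 1) q = 1" using pairing_dual by simp
    ultimately show ?thesis using ab a by (auto simp: b_def pairing_simps)
  next
    assume b: "b = 0"
    then have "det2 p v = 0" by (subst v_eq) (simp add: det2_def)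
    then have "v = p \<or> v = - p" using primitive_parallel prim_p(1) f by blast
    moreover have "pairing (dual 1 0) p = 1" using pairing_dual by simp
    ultimately show ?thesis using ab b by (auto simp: a_def pairing_simps)
  qed
  \<comment> \<open>Since \<open>det2 v (y n) = e * N\<close> and \<open>y n\<close> has nonnegative
    coordinates, the other generator lies on the side given by \<open>e\<close>.\<close>
  then have "\<exists>w. det2 v w = e \<and> w \<in> B \<and> B = {v, w}"
  proof
    assume v: "v = p \<and> a = 1 \<and> b = 0"
    have "b' * det2 p q = e * N" using det_vy dy v by simp
    moreover have "det2 p q = 1 \<or> det2 p q = - 1" using *(1) by (auto simp: zmult_eq_1_iff)
    ultimately have "det2 p q = e" using ab' N e1 by auto
    then show ?thesis using v B *(2) by blast
  next
    assume v: "v = q \<and> a = 0 \<and> b = 1"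
    have "a' * det2 q p = e * N" using det_vy dy v det2_commute[of p q] by simp
    moreover have "det2 q p = 1 \<or> det2 q p = - 1"
      using *(1) det2_commute[of p q] by (auto simp: zmult_eq_1_iff)
    ultimately have "det2 q p = e" using ab' N e1 by auto
    then show ?thesis using v B *(2) by blast
  qed
  then show ?thesis using that *(3,4) \<sigma>(1) by blast
qed

lemma rays_nonempty: "rays \<Delta> \<noteq> {}"
proof
  assume R: "rays \<Delta> = {}"
  have "(1, 0) \<in> \<Union>\<Delta>" using complete by simp
  then obtain \<sigma> where \<sigma>: "\<sigma> \<in> \<Delta>" "(1, 0) \<in> \<sigma>" by blast
  then obtain v w B where "B \<subseteq> rays \<Delta>" "\<sigma> = convex_cone hull (lat ` B)" using coneE[OF \<sigma>(1)] by metis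
  then have "\<sigma> = {0}" using R by simp
  then show False using \<sigma>(2) by (simp add: zero_prod_def)
qed

end

section \<open>Line bundles and divisors\<close>

lemma (in fraction_embedding) prime_gen_subset:
  assumes "mult_set S" "P \<in> prime_spectrum (fractions S)" "\<phi> r \<in> P"
  shows "prime_gen r S \<subseteq> P"
  using prime_spectrumD(6)[OF assms(2) _ assms(3)] by (auto simp: prime_gen_def mult.commute)

section \<open>Specialisation of points and cocycles\<close>

lemma subset_localize:
  assumes "P \<in> prime_spectrum A"
  shows "A \<subseteq> localize A P"
  using prime_spectrumD(3,4)[OF assms] unfolding localize_def by force

lemma mult_closed_point:
  fixes x :: "'k::field point"
  assumes "x \<in> toric_surface \<Delta>"
  shows "mult_closed x"
  using local_ring_closed(1)[OF assms, of 1] local_ring_closed(3)[OF assms]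
  by (simp add: mult_closed_def)

lemma unit_in_invertible: "f \<in> invertible_functions U \<Longrightarrow> y \<in> U \<Longrightarrow> unit_in y f"
  by (auto simp: invertible_functions_def regular_functions_def unit_in_def)

lemma monomial_powi: "monomial m powi n = monomial (n * fst m, n * snd m)"
  by (simp add: monomial_def power_int_mult_distrib mult.commute flip: power_int_mult)

text \<open>\<open>x\<close> lies in the closure of \<open>y\<close>. A trivialising neighbourhood
  of \<open>x\<close> then contains \<open>y\<close>, which is how the openness of covers enters
  when transition functions are moved from \<open>x\<close> to \<open>y\<close>.\<close>

definition specializes :: "(real \<times> real) set set \<Rightarrow> 'k::field point \<Rightarrow> 'k point \<Rightarrow> bool" where
  "specializes \<Delta> y x \<longleftrightarrow> (\<forall>U. X_open \<Delta> U \<longrightarrow> x \<in> U \<longrightarrow> y \<in> U)"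

text \<open>The generic point of the surface; its local ring is the whole function field. Sections
  become rational functions when expressed there.\<close>

definition base_point :: "'k::field point" where
  "base_point = localize laurent {0}"

lemma subring_laurent: "subring_set laurent"
  by (rule subring_monomial_span) auto

lemma zero_prime: "{0} \<in> prime_spectrum (laurent :: 'k::field function_field set)"
  by (rule prime_spectrumI[OF subring_laurent]) (auto simp: monomial_span_closed)

text \<open>What the arguments on sections use of a line bundle. Openness of the cover is kept out,
  so that tensor products and powers inherit the property from the transition functions
  alone.\<close>

definition is_cocycle :: "(real \<times> real) set set \<Rightarrow> 'k::field line_bundle \<Rightarrow> bool" where
  "is_cocycle \<Delta> M \<longleftrightarrow>
     (\<forall>x\<in>toric_surface \<Delta>. x \<in> cover M x \<and> cover M x \<subseteq> toric_surface \<Delta>) \<and>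
     (\<forall>x\<in>toric_surface \<Delta>. \<forall>y\<in>toric_surface \<Delta>.
        trans M x y \<in> invertible_functions (cover M x \<inter> cover M y)) \<and>
     (\<forall>x\<in>toric_surface \<Delta>. \<forall>y\<in>toric_surface \<Delta>. \<forall>z\<in>toric_surface \<Delta>.
        trans M x y * trans M y z = trans M x z)"

lemma is_cocycleD:
  assumes "is_cocycle \<Delta> M" "x \<in> toric_surface \<Delta>"
  shows "x \<in> cover M x" "cover M x \<subseteq> toric_surface \<Delta>"
    "y \<in> toric_surface \<Delta> \<Longrightarrow> trans M x y \<in> invertible_functions (cover M x \<inter> cover M y)"
    "y \<in> toric_surface \<Delta> \<Longrightarrow> z \<in> toric_surface \<Delta> \<Longrightarrow> trans M x y * trans M y z = trans M x z"
  using assms unfolding is_cocycle_def by blast+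

lemma is_line_bundle_cocycle: "is_line_bundle \<Delta> M \<Longrightarrow> is_cocycle \<Delta> M"
  unfolding is_line_bundle_def is_cocycle_def X_open_def by blast

lemma invertible_mult:
  assumes "f \<in> invertible_functions U" "g \<in> invertible_functions V" "U \<subseteq> toric_surface \<Delta>"
  shows "f * g \<in> invertible_functions (U \<inter> V)"
proof -
  have "unit_in y (f * g)" if "y \<in> U" "y \<in> V" for y
    using that assms mult_closed_point unit_in_mult unit_in_invertible by blast
  moreover have "f * g \<noteq> 0" using assms by (auto simp: invertible_functions_def)
  ultimately show ?thesis by (auto simp: invertible_functions_def regular_functions_def unit_in_def)
qed

lemma invertible_power:
  assumes "f \<in> invertible_functions U" "U \<subseteq> toric_surface \<Delta>"
  shows "f ^ n \<in> invertible_functions U"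
proof -
  have "unit_in y (f ^ n)" if "y \<in> U" for y
    using that assms mult_closed_point unit_in_power unit_in_invertible by blast
  moreover have "f \<noteq> 0" using assms by (auto simp: invertible_functions_def)
  ultimately show ?thesis by (auto simp: invertible_functions_def regular_functions_def unit_in_def)
qed

lemma is_cocycle_tensor:
  assumes "is_cocycle \<Delta> L" "is_cocycle \<Delta> M"
  shows "is_cocycle \<Delta> (tensor L M)"
  unfolding is_cocycle_def tensor_simps
proof (intro conjI ballI)
  fix x y :: "'a point" assume xy: "x \<in> toric_surface \<Delta>" "y \<in> toric_surface \<Delta>"
  have "trans L x y * trans M x y \<in> invertible_functions ((cover L x \<inter> cover L y) \<inter> (cover M x \<inter> cover M y))"
    by (rule invertible_mult[OF is_cocycleD(3)[OF assms(1) xy] is_cocycleD(3)[OF assms(2) xy]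
        le_infI1[OF is_cocycleD(2)[OF assms(1) xy(1)]]])
  moreover have "(cover L x \<inter> cover L y) \<inter> (cover M x \<inter> cover M y) = cover L x \<inter> cover M x \<inter> (cover L y \<inter> cover M y)"
    by blast
  ultimately show "trans L x y * trans M x y \<in> invertible_functions (cover L x \<inter> cover M x \<inter> (cover L y \<inter> cover M y))"
    by simp
  fix z :: "'a point" assume z: "z \<in> toric_surface \<Delta>"
  have "trans L x y * trans L y z = trans L x z" "trans M x y * trans M y z = trans M x z"
    using is_cocycleD(4)[OF assms(1) xy z] is_cocycleD(4)[OF assms(2) xy z] .
  moreover have "trans L x y * trans M x y * (trans L y z * trans M y z) =
      (trans L x y * trans L y z) * (trans M x y * trans M y z)"
    by (simp only: ac_simps)
  ultimately show "trans L x y * trans M x y * (trans L y z * trans M y z) = trans L x z * trans M x z"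
    by simp
next
  fix x :: "'a point" assume x: "x \<in> toric_surface \<Delta>"
  show "x \<in> cover L x \<inter> cover M x"
    using is_cocycleD(1)[OF assms(1) x] is_cocycleD(1)[OF assms(2) x] by (rule IntI)
  show "cover L x \<inter> cover M x \<subseteq> toric_surface \<Delta>"
    by (rule le_infI1[OF is_cocycleD(2)[OF assms(1) x]])
qed

lemma is_cocycle_power:
  assumes "is_cocycle \<Delta> L"
  shows "is_cocycle \<Delta> (tensor_power L n)"
  unfolding is_cocycle_def tensor_power_def line_bundle.simps
proof (intro conjI ballI)
  fix x y :: "'a point" assume xy: "x \<in> toric_surface \<Delta>" "y \<in> toric_surface \<Delta>"
  show "trans L x y ^ n \<in> invertible_functions (cover L x \<inter> cover L y)"
    by (rule invertible_power[OF is_cocycleD(3)[OF assms xy] le_infI1[OF is_cocycleD(2)[OF assms xy(1)]]])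
  fix z :: "'a point" assume z: "z \<in> toric_surface \<Delta>"
  have "trans L x y * trans L y z = trans L x z"
    by (rule is_cocycleD(4)[OF assms xy z])
  then show "trans L x y ^ n * trans L y z ^ n = trans L x z ^ n"
    by (simp flip: power_mult_distrib)
next
  fix x :: "'a point" assume x: "x \<in> toric_surface \<Delta>"
  show "x \<in> cover L x" "cover L x \<subseteq> toric_surface \<Delta>"
    by (rule is_cocycleD(1,2)[OF assms x])+
qed

text \<open>
  A line bundle is compared with the trivial one at the base point. The rational function \<open>u\<close> and
  the integers \<open>b\<close> express an isomorphism with the line bundle of the torus invariant divisor
  \<open>\<Sum> b\<^sub>v D\<^sub>v\<close>, as far as it is visible at the points of the torus and at the generic points of the
  boundary divisors; \<open>t x\<close> is the transition function from the base point to \<open>x\<close>.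
\<close>

definition divisor_data ::
  "(real \<times> real) set set \<Rightarrow> ('k::field point \<Rightarrow> 'k function_field) \<Rightarrow> 'k function_field \<Rightarrow> (int \<times> int \<Rightarrow> int) \<Rightarrow> bool" where
  "divisor_data \<Delta> t u b \<longleftrightarrow> u \<noteq> 0 \<and> (\<forall>x\<in>toric_surface \<Delta>. t x \<noteq> 0) \<and>
     (\<forall>x\<in>toric_surface \<Delta>. \<forall>y\<in>toric_surface \<Delta>. specializes \<Delta> y x \<longrightarrow> unit_in y (t x / t y)) \<and>
     (\<forall>x\<in>local_rings laurent. unit_in x (t x / u)) \<and>
     (\<forall>v\<in>rays \<Delta>. \<forall>m. pairing m v = b v \<longrightarrow>
        unit_in (divisor_ring v) (t (divisor_ring v) / (u * monomial m)))"

lemma divisor_dataD: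
  assumes "divisor_data \<Delta> t u b"
  shows "u \<noteq> 0" "x \<in> toric_surface \<Delta> \<Longrightarrow> t x \<noteq> 0"
    "x \<in> toric_surface \<Delta> \<Longrightarrow> y \<in> toric_surface \<Delta> \<Longrightarrow> specializes \<Delta> y x \<Longrightarrow> unit_in y (t x / t y)"
    "x \<in> local_rings laurent \<Longrightarrow> unit_in x (t x / u)"
    "v \<in> rays \<Delta> \<Longrightarrow> pairing m v = b v \<Longrightarrow>
      unit_in (divisor_ring v) (t (divisor_ring v) / (u * monomial m))"
  using assms unfolding divisor_data_def by blast+

context smooth_fan
begin

lemma chart_ring_origin: "chart_ring {0} = laurent"
  by (simp add: chart_ring_eq)

lemma torus_points: "local_rings (laurent :: 'k::field function_field set) \<subseteq> toric_surface \<Delta>"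
  using UN_upper[OF origin_mem, of "\<lambda>\<sigma>. local_rings (chart_ring \<sigma> :: 'k function_field set)"]
  by (simp add: toric_surface_def chart_ring_origin)

lemma base_point: "(base_point :: 'k::field point) \<in> local_rings laurent"
  unfolding base_point_def local_rings_def using zero_prime by blast

lemma base_point_mem: "(base_point :: 'k::field point) \<in> toric_surface \<Delta>"
  using base_point torus_points by blast

lemma ray_chart:
  assumes "v \<in> rays \<Delta>"
  obtains w where "chart v w (chart_map v w :: 'k::field fract poly poly \<Rightarrow> _)"
  using assms that by (auto simp: rays_def chart_def)

lemma divisor_ring_point:
  assumes "v \<in> rays \<Delta>"
  shows "(divisor_ring v :: 'k::field point) \<in> toric_surface \<Delta>"
proof -
  obtain w where "chart v w (chart_map v w :: 'k fract poly poly \<Rightarrow> _)" using ray_chart[OF assms] .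
  then interpret chart v w "chart_map v w :: 'k fract poly poly \<Rightarrow> _" .
  have "{v} \<subseteq> {v, w}" by blast
  from chart_ring_cone[OF this]
  have eq: "chart_ring (convex_cone hull (lat ` {v})) = (monomial_span {m. 0 \<le> pairing m v} :: 'k point)"
    using v_neq_w by (simp add: cone_points_def)
  have "(divisor_ring v :: 'k point) \<in> local_rings (chart_ring (convex_cone hull (lat ` {v})))"
    unfolding eq local_rings_def divisor_ring_def by (rule imageI[OF divisor_ideal_prime])
  moreover have "convex_cone hull (lat ` {v}) \<in> \<Delta>" using assms unfolding rays_def by blast
  ultimately show ?thesis unfolding toric_surface_def by blast
qed

lemma divisor_ring_contains:
  assumes "v \<in> rays \<Delta>"
  shows "monomial_span {m. 0 \<le> pairing m v} \<subseteq> (divisor_ring v :: 'k::field point)"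
proof -
  obtain w where "chart v w (chart_map v w :: 'k fract poly poly \<Rightarrow> _)" using ray_chart[OF assms] .
  then interpret chart v w "chart_map v w :: 'k fract poly poly \<Rightarrow> _" .
  show ?thesis unfolding divisor_ring_def by (rule subset_localize[OF divisor_ideal_prime])
qed

lemma divisor_ring_monomial:
  assumes "v \<in> rays \<Delta>" "pairing m v = 0"
  shows "unit_in (divisor_ring v) (monomial m)"
  using divisor_ring_contains[OF assms(1)] monomial_span_base[of m "{m. 0 \<le> pairing m v}"]
    monomial_span_base[of "- m" "{m. 0 \<le> pairing m v}"] assms(2)
  by (auto simp: unit_in_def pairing_simps simp flip: monomial_uminus)

lemma torus_contains: "x \<in> local_rings laurent \<Longrightarrow> laurent \<subseteq> x"
  unfolding local_rings_def using subset_localize by blast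

lemma torus_monomial: "x \<in> local_rings laurent \<Longrightarrow> unit_in x (monomial m)"
  using torus_contains[of x] monomial_span_base[of m UNIV] monomial_span_base[of "- m" UNIV]
  by (auto simp: unit_in_def simp flip: monomial_uminus)

text \<open>In codimension one the chart of the ray consists of the torus and the divisor of
  \<open>v\<close>, so regularity on both is regularity on the chart.\<close>

lemma laurent_Int_divisor_ring:
  assumes v: "v \<in> rays \<Delta>" and g: "g \<in> laurent" "g \<in> (divisor_ring v :: 'k::field point)"
  shows "g \<in> monomial_span {m. 0 \<le> pairing m v}"
proof -
  obtain w where "chart v w (chart_map v w :: 'k fract poly poly \<Rightarrow> _)" using ray_chart[OF v] .
  then interpret chart v w "chart_map v w :: 'k fract poly poly \<Rightarrow> _" .
  have "g \<in> fractions (var_powers True False)"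
  proof (rule mem_fractionsI[OF mult_set_var_powers])
    fix r :: "'k fract poly poly" assume r: "prime_elem r" "\<forall>s\<in>var_powers True False. \<not> r dvd s"
    show "g \<in> val_ring r"
      using r
    proof (cases rule: val_ring_cases)
      case torus
      then show ?thesis using g(1) fractions_subset_val_ring[OF torus(2)] fractions_laurent by blast
    qed (use g in auto)
  qed
  then show ?thesis unfolding fractions_var_powers by (simp add: cone_points_def)
qed

text \<open>A basic fact of the Zariski topology: the ideal generated by \<open>r\<close> lies in
  \<open>P\<close>, so an ideal not contained in \<open>P\<close> is not contained in the smaller
  one either.\<close>

lemma specializes_val_ring:
  fixes \<phi> :: "'k::field fract poly poly \<Rightarrow> 'k function_field"
  assumes "chart v w \<phi>" and \<sigma>: "\<sigma> \<in> \<Delta>" "\<sigma> = convex_cone hull (lat ` B)" "B \<subseteq> {v, w}"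
    and P: "P \<in> prime_spectrum (chart_ring \<sigma>)" and r: "prime_elem r" "\<phi> r \<in> P"
      "\<forall>s\<in>var_powers (v \<in> B) (w \<in> B). \<not> r dvd s"
  shows "specializes \<Delta> (fraction_embedding.val_ring \<phi> r) (localize (chart_ring \<sigma>) P)"
proof -
  interpret chart v w \<phi> by fact
  let ?S = "var_powers (v \<in> B) (w \<in> B)"
  have A: "chart_ring \<sigma> = fractions ?S"
    unfolding \<sigma>(2) chart_ring_cone[OF \<sigma>(3)] fractions_var_powers ..
  show ?thesis
    unfolding specializes_def
  proof (intro allI impI)
    fix U :: "'k point set" assume U: "X_open \<Delta> U" "localize (chart_ring \<sigma>) P \<in> U"
    have "zariski_open (chart_ring \<sigma>) (U \<inter> local_rings (chart_ring \<sigma>))"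
      using U(1) \<sigma>(1) unfolding X_open_def by blast
    then obtain I where I: "U \<inter> local_rings (chart_ring \<sigma>) =
        localize (chart_ring \<sigma>) ` {P \<in> prime_spectrum (chart_ring \<sigma>). \<not> I \<subseteq> P}"
      unfolding zariski_open_def by blast
    have "localize (chart_ring \<sigma>) P \<in> U \<inter> local_rings (chart_ring \<sigma>)"
      using U(2) P unfolding local_rings_def by blast
    then obtain P' where "P' \<in> prime_spectrum (chart_ring \<sigma>)" "\<not> I \<subseteq> P'"
      "localize (chart_ring \<sigma>) P = localize (chart_ring \<sigma>) P'"
      unfolding I by blast
    then have "\<not> I \<subseteq> P" using localize_inj[OF P] by metis
    moreover have "prime_gen r ?S \<subseteq> P"
      using prime_gen_subset[OF mult_set_var_powers P[unfolded A] r(2)] .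
    ultimately have "\<not> I \<subseteq> prime_gen r ?S" by blast
    moreover note gen = prime_gen_spectrum[OF mult_set_var_powers r(1,3), folded A]
    ultimately have "val_ring r \<in> U \<inter> local_rings (chart_ring \<sigma>)"
      unfolding I gen(2)[symmetric] using gen(1) by blast
    then show "val_ring r \<in> U" by blast
  qed
qed

lemma not_mem_pointE:
  fixes \<phi> :: "'k::field fract poly poly \<Rightarrow> 'k function_field"
  assumes "chart v w \<phi>" and \<sigma>: "\<sigma> \<in> \<Delta>" "\<sigma> = convex_cone hull (lat ` B)" "B \<subseteq> {v, w}"
    and x: "x \<in> local_rings (chart_ring \<sigma>)" and F: "F \<notin> x"
  obtains r where "prime_elem r" "\<forall>s\<in>var_powers (v \<in> B) (w \<in> B). \<not> r dvd s"
    "F \<notin> fraction_embedding.val_ring \<phi> r" "specializes \<Delta> (fraction_embedding.val_ring \<phi> r) x"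
proof -
  interpret chart v w \<phi> by fact
  let ?S = "var_powers (v \<in> B) (w \<in> B)"
  have A: "chart_ring \<sigma> = fractions ?S"
    unfolding \<sigma>(2) chart_ring_cone[OF \<sigma>(3)] fractions_var_powers ..
  obtain P where P: "P \<in> prime_spectrum (chart_ring \<sigma>)" "x = localize (chart_ring \<sigma>) P"
    using x by (auto simp: local_rings_def)
  obtain r where r: "prime_elem r" "\<phi> r \<in> P" "F \<notin> val_ring r" "\<forall>s\<in>?S. \<not> r dvd s"
    using prime_divisor_of_denominator[OF mult_set_var_powers P(1)[unfolded A]] F
    unfolding P(2) A by blast
  then show ?thesis
    using that specializes_val_ring[OF assms(1) \<sigma> P(1) r(1,2,4)] unfolding P(2) by blast
qed

text \<open>The failure of \<open>F\<close> at \<open>x\<close> is moved to a point of the torus or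
  to the generic point of a boundary divisor, exactly the places that \<open>divisor_data\<close>
  controls.\<close>

lemma not_mem_point_cases:
  fixes x :: "'k::field point"
  assumes "det2 v w * det2 v w = 1" and \<sigma>: "\<sigma> \<in> \<Delta>" "\<sigma> = convex_cone hull (lat ` B)" "B \<subseteq> {v, w}"
    and x: "x \<in> local_rings (chart_ring \<sigma>)" and F: "F \<notin> x"
  obtains y where "F \<notin> y" "specializes \<Delta> y x" "y \<in> local_rings laurent \<or> (\<exists>v\<in>B. y = divisor_ring v)"
proof -
  have chart: "chart v w (chart_map v w :: 'k fract poly poly \<Rightarrow> _)" using assms(1) by (simp add: chart_def)
  then interpret chart v w "chart_map v w :: 'k fract poly poly \<Rightarrow> _" .
  obtain r where r: "prime_elem r" "\<forall>s\<in>var_powers (v \<in> B) (w \<in> B). \<not> r dvd s"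
    "F \<notin> val_ring r" "specializes \<Delta> (val_ring r) x"
    using not_mem_pointE[OF chart \<sigma> x F] by blast
  from r(1,2) have "val_ring r \<in> local_rings laurent \<or> (\<exists>v\<in>B. val_ring r = divisor_ring v)"
    by (cases rule: val_ring_cases) auto
  then show ?thesis using that r by blast
qed

lemma H0_section:
  assumes M: "is_cocycle \<Delta> M" and s: "s \<in> H0 \<Delta> M" and x: "x \<in> toric_surface \<Delta>"
  shows "s x = trans M x base_point * s base_point" "trans M x base_point * s base_point \<in> x"
proof -
  show *: "s x = trans M x base_point * s base_point"
    by (rule H0_D(2)[OF s x base_point_mem])
  have "x \<in> cover M x" by (rule is_cocycleD(1)[OF M x])
  then show "trans M x base_point * s base_point \<in> x"
    using H0_D(1)[OF s x] unfolding * by blast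
qed

text \<open>Regularity at each point in its own trivialisation suffices, since at another point
  \<open>y\<close> of the cover the transition function from \<open>x\<close> to \<open>y\<close> is
  a unit.\<close>

lemma H0_from_base_point:
  fixes M :: "'k::field line_bundle"
  assumes M: "is_cocycle \<Delta> M"
    and f: "\<And>x. x \<in> toric_surface \<Delta> \<Longrightarrow> trans M x base_point * f \<in> x"
  shows "(\<lambda>x. if x \<in> toric_surface \<Delta> then trans M x base_point * f else 0) \<in> H0 \<Delta> M"
proof (rule H0_I)
  fix x y :: "'k point" assume x: "x \<in> toric_surface \<Delta>" and y: "y \<in> cover M x"
  have y': "y \<in> toric_surface \<Delta>" using is_cocycleD(2)[OF M x] y by (rule subsetD)
  have "unit_in y (trans M x y)"
    by (rule unit_in_invertible[OF is_cocycleD(3)[OF M x y'] IntI[OF y is_cocycleD(1)[OF M y']]])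
  moreover have "trans M y base_point * f \<in> y" by (rule f[OF y'])
  ultimately have "trans M x y * (trans M y base_point * f) \<in> y"
    using unit_in_mult_cancel[OF mult_closed_point[OF y']] by blast
  moreover have "trans M x y * trans M y base_point = trans M x base_point"
    by (rule is_cocycleD(4)[OF M x y' base_point_mem])
  ultimately have "trans M x base_point * f \<in> y" by (metis mult.assoc)
  then show "(if x \<in> toric_surface \<Delta> then trans M x base_point * f else 0) \<in> y"
    using x by simp
next
  fix x y :: "'k point" assume xy: "x \<in> toric_surface \<Delta>" "y \<in> toric_surface \<Delta>"
  have "trans M x y * trans M y base_point = trans M x base_point"
    by (rule is_cocycleD(4)[OF M xy base_point_mem])
  then have "trans M x base_point * f = trans M x y * (trans M y base_point * f)"
    by (metis mult.assoc)
  then show "(if x \<in> toric_surface \<Delta> then trans M x base_point * f else 0) =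
      trans M x y * (if y \<in> toric_surface \<Delta> then trans M y base_point * f else 0)"
    using xy by simp
qed simp

lemma scaled_witness: "v \<in> rays \<Delta> \<Longrightarrow> \<exists>m. pairing m v = k"
proof -
  assume "v \<in> rays \<Delta>"
  then obtain f where f: "pairing f v = 1" using ray_witness by blast
  have "pairing (k * fst f, k * snd f) v = k * pairing f v" by (simp add: pairing_def algebra_simps)
  then show ?thesis using f by auto
qed

lemma divisor_data_mult:
  fixes t t' :: "'k::field point \<Rightarrow> 'k function_field"
  assumes "divisor_data \<Delta> t u b" "divisor_data \<Delta> t' u' b'"
  shows "divisor_data \<Delta> (\<lambda>x. t x * t' x) (u * u') (\<lambda>v. b v + b' v)"
  unfolding divisor_data_def
proof (intro conjI ballI impI allI)
  fix x y :: "'k point" assume xy: "x \<in> toric_surface \<Delta>" "y \<in> toric_surface \<Delta>" "specializes \<Delta> y x"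
  then have "unit_in y ((t x / t y) * (t' x / t' y))"
    by (intro unit_in_mult mult_closed_point[OF xy(2)] divisor_dataD(3)[OF assms(1)]
        divisor_dataD(3)[OF assms(2)])
  then show "unit_in y (t x * t' x / (t y * t' y))" by simp
next
  fix x :: "'k point" assume x: "x \<in> local_rings laurent"
  then have "mult_closed x" using torus_points mult_closed_point by blast
  then have "unit_in x ((t x / u) * (t' x / u'))"
    using x by (intro unit_in_mult divisor_dataD(4)[OF assms(1)] divisor_dataD(4)[OF assms(2)])
  then show "unit_in x (t x * t' x / (u * u'))" by simp
next
  fix v m assume v: "v \<in> rays \<Delta>" and m: "pairing m v = b v + b' v"
  \<comment> \<open>The character is split into one part for each factor.\<close>
  obtain n where n: "pairing n v = b v" using scaled_witness[OF v] by blast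
  then have n': "pairing (m - n) v = b' v" using m by (simp add: pairing_simps)
  let ?D = "divisor_ring v :: 'k point"
  have "unit_in ?D ((t ?D / (u * monomial n)) * (t' ?D / (u' * monomial (m - n))))"
    by (intro unit_in_mult mult_closed_point[OF divisor_ring_point[OF v]]
        divisor_dataD(5)[OF assms(1) v n] divisor_dataD(5)[OF assms(2) v n'])
  moreover have "(u * monomial n) * (u' * monomial (m - n)) = u * u' * monomial m"
    by (simp add: monomial_diff)
  ultimately show "unit_in ?D (t ?D * t' ?D / (u * u' * monomial m))"
    by simp
qed (use divisor_dataD(1,2)[OF assms(1)] divisor_dataD(1,2)[OF assms(2)] in simp_all)

lemma divisor_data_power:
  fixes t :: "'k::field point \<Rightarrow> 'k function_field"
  assumes "divisor_data \<Delta> t u b"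
  shows "divisor_data \<Delta> (\<lambda>x. t x ^ n) (u ^ n) (\<lambda>v. int n * b v)"
proof (induction n)
  case 0
  have "unit_in x 1" if "x \<in> toric_surface \<Delta>" for x :: "'k point"
    using that by (intro unit_in_1 mult_closed_point)
  moreover have "unit_in (divisor_ring v) (inverse (monomial m) :: 'k function_field)"
    if "v \<in> rays \<Delta>" "pairing m v = 0" for v m
    using that by (intro unit_in_inverse divisor_ring_monomial)
  ultimately show ?case
    unfolding divisor_data_def using torus_points by (auto simp: inverse_eq_divide)
next
  case (Suc n)
  from divisor_data_mult[OF assms Suc] show ?case
    by (simp only: power_Suc of_nat_Suc distrib_right mult_1_left)
qed

text \<open>Regularity on the torus makes \<open>u * f\<close> a Laurent polynomial, and regularity
  along the divisor of \<open>v\<close> bounds the pairings of its exponents with \<open>v\<close>.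
  Conversely, a failure at any point would be visible at a point of the torus or along a boundary
  divisor, where \<open>t x\<close> may be replaced by the recorded generator.\<close>

lemma divisor_data_sections:
  fixes t :: "'k::field point \<Rightarrow> 'k function_field"
  assumes t: "divisor_data \<Delta> t u b"
  shows "(\<forall>x\<in>toric_surface \<Delta>. t x * f \<in> x) \<longleftrightarrow> u * f \<in> monomial_span (lattice_polygon (rays \<Delta>) b)"
proof
  have u: "u \<noteq> 0" by (rule divisor_dataD(1)[OF t])
  assume f: "\<forall>x\<in>toric_surface \<Delta>. t x * f \<in> x"
  interpret chart "(1, 0)" "(0, 1)" "chart_map (1, 0) (0, 1) :: 'k fract poly poly \<Rightarrow> _"
    by unfold_locales (simp_all add: det2_def)
  have "u * f \<in> fractions (var_powers False False)"
  proof (rule mem_fractionsI[OF mult_set_var_powers])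
    fix r :: "'k fract poly poly"
    assume r: "prime_elem r" "\<forall>s\<in>var_powers False False. \<not> r dvd s"
    let ?y = "val_ring r"
    have y: "?y \<in> local_rings laurent" by (rule val_ring_torus[OF r])
    then have y': "?y \<in> toric_surface \<Delta>" using torus_points by blast
    have "t ?y * f = (t ?y / u) * (u * f)" using u by simp
    moreover have "unit_in ?y (t ?y / u)" by (rule divisor_dataD(4)[OF t y])
    ultimately show "u * f \<in> ?y"
      using f y' unit_in_mult_cancel[OF mult_closed_point[OF y']] by metis
  qed
  then have uf: "u * f \<in> laurent" by (simp add: fractions_laurent)
  have "- b v \<le> pairing m v" if v: "v \<in> rays \<Delta>" and m: "coefficient m (u * f) \<noteq> 0" for v m
  proof -
    let ?D = "divisor_ring v :: 'k point"
    have D: "?D \<in> toric_surface \<Delta>" by (rule divisor_ring_point[OF v])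
    obtain n where n: "pairing n v = b v" using scaled_witness[OF v] by blast
    have "t ?D * f = (t ?D / (u * monomial n)) * (monomial n * (u * f))" using u by simp
    moreover have "unit_in ?D (t ?D / (u * monomial n))" by (rule divisor_dataD(5)[OF t v n])
    ultimately have 1: "monomial n * (u * f) \<in> ?D"
      using f D unit_in_mult_cancel[OF mult_closed_point[OF D]] by metis
    have "monomial n * (u * f) \<in> laurent"
      by (rule laurent_mult[OF monomial_span_base[OF UNIV_I] uf])
    then have "monomial n * (u * f) \<in> monomial_span {m. 0 \<le> pairing m v}"
      using laurent_Int_divisor_ring[OF v] 1 by blast
    then have "u * f \<in> monomial_span {m. 0 \<le> pairing (n + m) v}" by (simp add: monomial_shift_iff)
    then have "m \<in> {m. 0 \<le> pairing (n + m) v}" using m coefficient_outside by blast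
    then have "0 \<le> pairing (n + m) v" by simp
    then show ?thesis using n by (simp add: pairing_simps)
  qed
  then show "u * f \<in> monomial_span (lattice_polygon (rays \<Delta>) b)"
    using uf by (subst mem_monomial_span_iff) (auto simp: lattice_polygon_def)
next
  have u: "u \<noteq> 0" by (rule divisor_dataD(1)[OF t])
  assume uf: "u * f \<in> monomial_span (lattice_polygon (rays \<Delta>) b)"
  show "\<forall>x\<in>toric_surface \<Delta>. t x * f \<in> x"
  proof (intro ballI, rule ccontr)
    fix x :: "'k point" assume x: "x \<in> toric_surface \<Delta>" and nx: "t x * f \<notin> x"
    obtain \<sigma> where \<sigma>: "\<sigma> \<in> \<Delta>" "x \<in> local_rings (chart_ring \<sigma>)" using x by (auto simp: toric_surface_def)
    obtain v w B where c: "det2 v w * det2 v w = 1" "B \<subseteq> {v, w}" "\<sigma> = convex_cone hull (lat ` B)"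
      "B \<subseteq> rays \<Delta>" using coneE[OF \<sigma>(1)] by blast
    obtain y where y: "t x * f \<notin> y" "specializes \<Delta> y x"
      "y \<in> local_rings laurent \<or> (\<exists>v\<in>B. y = divisor_ring v)"
      using not_mem_point_cases[OF c(1) \<sigma>(1) c(3,2) \<sigma>(2) nx] by blast
    have y': "y \<in> toric_surface \<Delta>" using y(3) torus_points divisor_ring_point c(4) by blast
    note my = mult_closed_point[OF y']
    have ty: "t y \<noteq> 0" by (rule divisor_dataD(2)[OF t y'])
    have "t x * f = (t x / t y) * (t y * f)" using ty by simp
    moreover have "unit_in y (t x / t y)" by (rule divisor_dataD(3)[OF t x y' y(2)])
    ultimately have nty: "t y * f \<notin> y" using y(1) unit_in_mult_cancel[OF my] by metis
    from y(3) show False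
    proof
      assume yt: "y \<in> local_rings laurent"
      have "u * f \<in> y" using torus_contains[OF yt] monomial_span_subset_laurent[OF uf] by blast
      moreover have "unit_in y (t y / u)" by (rule divisor_dataD(4)[OF t yt])
      moreover have "t y * f = (t y / u) * (u * f)" using u by simp
      ultimately show False using nty unit_in_mult_cancel[OF my] by metis
    next
      assume "\<exists>v\<in>B. y = divisor_ring v"
      then obtain v where v: "v \<in> rays \<Delta>" "y = divisor_ring v" using c(4) by blast
      obtain n where n: "pairing n v = b v" using scaled_witness[OF v(1)] by blast
      have "lattice_polygon (rays \<Delta>) b \<subseteq> {m. 0 \<le> pairing (n + m) v}"
        using v(1) n by (fastforce simp: lattice_polygon_def pairing_simps)
      then have "u * f \<in> monomial_span {m. 0 \<le> pairing (n + m) v}" using uf monomial_span_mono by blast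
      then have "monomial n * (u * f) \<in> monomial_span {m. 0 \<le> pairing m v}"
        by (simp add: monomial_shift_iff)
      then have "monomial n * (u * f) \<in> y" using divisor_ring_contains[OF v(1)] v(2) by blast
      moreover have "unit_in y (t y / (u * monomial n))" unfolding v(2) by (rule divisor_dataD(5)[OF t v(1) n])
      moreover have "t y * f = (t y / (u * monomial n)) * (monomial n * (u * f))" using u by simp
      ultimately show False using nty unit_in_mult_cancel[OF my] by metis
    qed
  qed
qed

end

section \<open>Divisors of line bundles\<close>

context smooth_fan
begin

lemma chart_origin_cone:
  "{0} = convex_cone hull (lat ` {})" "{} \<subseteq> {v, w}"
  by simp_all

lemma line_bundle_trans:
  fixes M :: "'k::field line_bundle"
  assumes M: "is_line_bundle \<Delta> M"
  shows "x \<in> toric_surface \<Delta> \<Longrightarrow> trans M x base_point \<noteq> 0"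
    and "x \<in> toric_surface \<Delta> \<Longrightarrow> y \<in> toric_surface \<Delta> \<Longrightarrow> specializes \<Delta> y x \<Longrightarrow>
      unit_in y (trans M x base_point / trans M y base_point)"
    and "y \<in> toric_surface \<Delta> \<Longrightarrow> y \<in> cover M base_point \<Longrightarrow> unit_in y (trans M y base_point)"
proof -
  note C = is_line_bundle_cocycle[OF M]
  show nz: "trans M x base_point \<noteq> 0" if "x \<in> toric_surface \<Delta>" for x
    using is_cocycleD(3)[OF C that base_point_mem] by (simp add: invertible_functions_def)
  show "unit_in y (trans M x base_point / trans M y base_point)"
    if x: "x \<in> toric_surface \<Delta>" and y: "y \<in> toric_surface \<Delta>" and sp: "specializes \<Delta> y x"
  proof -
    have "X_open \<Delta> (cover M x)" "x \<in> cover M x" using M x unfolding is_line_bundle_def by simp_all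
    then have "y \<in> cover M x" using sp unfolding specializes_def by simp
    then have "unit_in y (trans M x y)"
      using is_cocycleD(1)[OF C y] by (intro unit_in_invertible[OF is_cocycleD(3)[OF C x y]] IntI)
    moreover have "trans M x base_point / trans M y base_point = trans M x y"
      using is_cocycleD(4)[OF C x y base_point_mem] nz[OF y] by (simp add: field_simps)
    ultimately show ?thesis by simp
  qed
  show "unit_in y (trans M y base_point)"
    if y: "y \<in> toric_surface \<Delta>" and b: "y \<in> cover M base_point"
    by (rule unit_in_invertible[OF is_cocycleD(3)[OF C y base_point_mem]
          IntI[OF is_cocycleD(1)[OF C y] b]])
qed

text \<open>A nonempty open subset of the torus contains the locus where some nonzero
  \<open>g\<close> does not vanish; \<open>a\<close> is a numerator of such a
  \<open>g\<close>.\<close>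

lemma torus_divisor_support:
  fixes M :: "'k::field line_bundle"
  assumes M: "is_line_bundle \<Delta> M" and chart: "chart v w \<phi>"
  shows "\<exists>a. a \<noteq> 0 \<and> (\<forall>r. prime_elem r \<longrightarrow> (\<forall>s\<in>var_powers False False. \<not> r dvd s) \<longrightarrow> \<not> r dvd a \<longrightarrow>
    fraction_embedding.val_ring \<phi> r \<in> cover M base_point)"
proof -
  interpret chart v w \<phi> by fact
  have op: "X_open \<Delta> (cover M base_point)" "base_point \<in> cover M base_point"
    using bspec[OF conjunct1[OF M[unfolded is_line_bundle_def]] base_point_mem] by simp_all
  then have "zariski_open laurent (cover M base_point \<inter> local_rings laurent)"
    using origin_mem chart_ring_origin unfolding X_open_def by metis
  then obtain I where I: "I \<subseteq> laurent" "cover M base_point \<inter> local_rings laurent =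
      localize laurent ` {P \<in> prime_spectrum laurent. \<not> I \<subseteq> P}"
    unfolding zariski_open_def by (elim exE conjE)
  have "base_point \<in> localize laurent ` {P \<in> prime_spectrum laurent. \<not> I \<subseteq> P}"
    unfolding I(2)[symmetric] using op(2) base_point by (rule IntI)
  then obtain P where P: "P \<in> prime_spectrum laurent" "\<not> I \<subseteq> P" by auto
  then obtain g where g: "g \<in> I" "g \<noteq> 0" using prime_spectrumD(2)[OF P(1)] by (metis subsetI)
  have "g \<in> fractions (var_powers False False)" using g(1) I(1) unfolding fractions_laurent by (rule subsetD[rotated])
  then obtain a s where a: "g = \<phi> a / \<phi> s" "s \<in> var_powers False False" by (auto simp: fractions_def)
  have "val_ring r \<in> cover M base_point"
    if r: "prime_elem r" "\<forall>s\<in>var_powers False False. \<not> r dvd s" "\<not> r dvd a" for r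
  proof -
    note gen = prime_gen_spectrum[OF mult_set_var_powers r(1,2), unfolded fractions_laurent]
    have "g \<notin> prime_gen r (var_powers False False)"
      unfolding a(1) prime_gen_iff[OF mult_set_var_powers r(1,2) a(2)] by (rule r(3))
    then have "\<not> I \<subseteq> prime_gen r (var_powers False False)" using g(1) by (metis subsetD)
    then have "val_ring r \<in> cover M base_point \<inter> local_rings laurent"
      unfolding I(2) gen(2)[symmetric] using gen(1) by simp
    then show ?thesis by simp
  qed
  moreover have "a \<noteq> 0" using g a by (auto simp: zero)
  ultimately show ?thesis by (metis (no_types))
qed

text \<open>The Picard group of the torus is trivial: \<open>u\<close> is the product of the
  finitely many primes off the trivialising set of the base point, each raised to the valuation of
  the transition function. The codimension-one test, applied to the quotient and to its inverse,
  extends the unit property to all points.\<close>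

lemma torus_trivialization:
  fixes M :: "'k::field line_bundle"
  assumes M: "is_line_bundle \<Delta> M"
  shows "\<exists>u. u \<noteq> 0 \<and> (\<forall>x\<in>local_rings laurent. unit_in x (trans M x base_point / u))"
proof -
  let ?t = "\<lambda>x. trans M x base_point"
  let ?\<phi> = "chart_map (1, 0) (0, 1) :: 'k fract poly poly \<Rightarrow> 'k function_field"
  let ?S = "var_powers False False :: 'k fract poly poly set"
  have chart: "chart (1, 0) (0, 1) ?\<phi>" by (simp add: chart_def det2_def)
  interpret chart "(1, 0)" "(0, 1)" ?\<phi> by (rule chart)
  obtain a where a: "a \<noteq> 0" "\<And>r. prime_elem r \<Longrightarrow> \<forall>s\<in>?S. \<not> r dvd s \<Longrightarrow> \<not> r dvd a \<Longrightarrow>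
      val_ring r \<in> cover M base_point"
    using torus_divisor_support[OF M chart] by metis
  \<comment> \<open>\<open>prime_factors\<close> contains normalised primes only, so each curve is
    counted once; primes dividing a monomial have no point on the torus.\<close>
  define Q where "Q = {r \<in> prime_factors a. \<forall>s\<in>?S. \<not> r dvd s}"
  have Q: "finite Q" "\<And>r. r \<in> Q \<Longrightarrow> prime r" by (auto simp: Q_def)
  have point: "val_ring r \<in> toric_surface \<Delta>" if "prime_elem r" "\<forall>s\<in>?S. \<not> r dvd s" for r
    using val_ring_torus[OF that] torus_points by (rule subsetD[rotated])
  have "\<exists>n w. unit_in (val_ring r) w \<and> ?t (val_ring r) = ?\<phi> r powi n * w" if "r \<in> Q" for r
    using that Q(2)[OF that] point
    by (intro val_ring_decomp line_bundle_trans(1)[OF M]) (auto simp: Q_def)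
  then obtain n w where nw: "\<And>r. r \<in> Q \<Longrightarrow> unit_in (val_ring r) (w r) \<and> ?t (val_ring r) = ?\<phi> r powi n r * w r"
    by metis
  define u where "u = (\<Prod>r\<in>Q. ?\<phi> r powi n r)"
  have r0: "?\<phi> r \<noteq> 0" if "r \<in> Q" for r using Q(2)[OF that] by (auto simp: eq_0_iff)
  then have u0: "u \<noteq> 0" using Q(1) by (simp add: u_def)
  have unit: "unit_in (val_ring q) (?t (val_ring q) / u)" if q: "prime_elem q" "\<forall>s\<in>?S. \<not> q dvd s" for q
  proof (cases "q dvd a")
    case False
    have "unit_in (val_ring q) (?t (val_ring q))"
      by (rule line_bundle_trans(3)[OF M point[OF q] a(2)[OF q False]])
    moreover have "unit_in (val_ring q) u"
      unfolding u_def
    proof (intro unit_in_prod unit_in_powi mult_closed_val_ring q unit_in_val_ring)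
      fix r assume "r \<in> Q"
      then have "r dvd a" by (auto simp: Q_def)
      then show "\<not> q dvd r" using False dvd_trans by blast
    qed
    ultimately show ?thesis by (intro unit_in_divide mult_closed_val_ring q)
  next
    case True
    let ?q = "normalize q"
    have q': "prime ?q" using q(1) by simp
    have qQ: "?q \<in> Q" using True q a(1) q' by (auto simp: Q_def prime_factors_dvd)
    \<comment> \<open>At \<open>?q\<close> its own factor in \<open>u\<close> cancels against the
      valuation of the transition function, and the remaining primes are units.\<close>
    have "unit_in (val_ring ?q) (w ?q / (\<Prod>r\<in>Q - {?q}. ?\<phi> r powi n r))"
    proof (intro unit_in_divide unit_in_prod unit_in_powi mult_closed_val_ring unit_in_val_ring)
      fix r assume "r \<in> Q - {?q}"
      then show "\<not> ?q dvd r" using Q(2) q' primes_dvd_imp_eq by blast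
    qed (use q' nw[OF qQ] in auto)
    moreover have "u = ?\<phi> ?q powi n ?q * (\<Prod>r\<in>Q - {?q}. ?\<phi> r powi n r)"
      unfolding u_def by (rule prod.remove[OF Q(1) qQ])
    then have "?t (val_ring ?q) / u = w ?q / (\<Prod>r\<in>Q - {?q}. ?\<phi> r powi n r)"
      using nw[OF qQ] r0[OF qQ] by simp
    ultimately show ?thesis by (simp only: val_ring_normalize)
  qed
  have "unit_in x (?t x / u)" if x: "x \<in> local_rings laurent" for x
  proof -
    have x': "x \<in> toric_surface \<Delta>" using x torus_points by (rule subsetD[rotated])
    have x'': "x \<in> local_rings (chart_ring {0})" using x by (simp only: chart_ring_origin)
    have *: "F \<in> x" if F: "F = ?t x / u \<or> F = inverse (?t x / u)" for F
    proof (rule ccontr)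
      assume "F \<notin> x"
      from not_mem_pointE[OF chart origin_mem chart_origin_cone x'' this]
      obtain r where r: "prime_elem r" "\<forall>s\<in>?S. \<not> r dvd s" "F \<notin> val_ring r" "specializes \<Delta> (val_ring r) x"
        by auto
      let ?y = "val_ring r"
      have "unit_in ?y (?t x / ?t ?y * (?t ?y / u))"
        by (intro unit_in_mult mult_closed_val_ring r unit line_bundle_trans(2)[OF M x' point])
      moreover have "?t ?y \<noteq> 0" by (rule line_bundle_trans(1)[OF M point[OF r(1,2)]])
      ultimately have "unit_in ?y (?t x / u)" by simp
      then show False using r(3) F unfolding unit_in_def by blast
    qed
    show ?thesis
      using *[of "?t x / u"] *[of "inverse (?t x / u)"] u0 line_bundle_trans(1)[OF M x'] by (simp add: unit_in_def)
  qed
  then show ?thesis using u0 by metis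
qed

text \<open>\<open>b v\<close> is the valuation of the transition function over \<open>u\<close>
  along the divisor of \<open>v\<close>. Characters with equal pairing with \<open>v\<close> differ
  by a unit there, so any of them serves.\<close>

lemma line_bundle_divisor_data:
  fixes M :: "'k::field line_bundle"
  assumes M: "is_line_bundle \<Delta> M"
  shows "\<exists>u b. divisor_data \<Delta> (\<lambda>x. trans M x base_point) u b"
proof -
  let ?t = "\<lambda>x. trans M x base_point"
  obtain u where u: "u \<noteq> 0" "\<And>x. x \<in> local_rings laurent \<Longrightarrow> unit_in x (?t x / u)"
    using torus_trivialization[OF M] by metis
  have "\<exists>n. \<forall>m. pairing m v = n \<longrightarrow> unit_in (divisor_ring v) (?t (divisor_ring v) / (u * monomial m))"
    if v: "v \<in> rays \<Delta>" for v
  proof -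
    obtain w where "chart v w (chart_map v w :: 'k fract poly poly \<Rightarrow> _)" using ray_chart[OF v] .
    then interpret chart v w "chart_map v w :: 'k fract poly poly \<Rightarrow> _" .
    let ?D = "divisor_ring v :: 'k point"
    have D: "?D \<in> toric_surface \<Delta>" by (rule divisor_ring_point[OF v])
    have "?t ?D / u \<noteq> 0" using u(1) line_bundle_trans(1)[OF M D] by simp
    from val_ring_decomp[OF prime_elem_var(1) this] obtain n e
      where ne: "unit_in ?D e" "?t ?D / u = monomial (dual 1 0) powi n * e"
      unfolding val_ring_X phi_var_X by metis
    have "unit_in ?D (?t ?D / (u * monomial m))" if m: "pairing m v = n" for m
    proof -
      let ?d = "(n * fst (dual 1 0), n * snd (dual 1 0))"
      have "pairing ?d v = n * pairing (dual 1 0) v" by (simp add: pairing_def algebra_simps)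
      then have "pairing (?d - m) v = 0" using m by (simp add: pairing_simps pairing_dual)
      then have "unit_in ?D (e * monomial (?d - m))"
        by (intro unit_in_mult mult_closed_point[OF D] ne(1) divisor_ring_monomial[OF v])
      moreover have "?t ?D / (u * monomial m) = (?t ?D / u) / monomial m" by simp
      then have "?t ?D / (u * monomial m) = e * monomial (?d - m)"
        unfolding ne(2) monomial_powi monomial_diff by simp
      ultimately show ?thesis by simp
    qed
    then show ?thesis by metis
  qed
  then obtain b where b: "\<And>v m. v \<in> rays \<Delta> \<Longrightarrow> pairing m v = b v \<Longrightarrow>
      unit_in (divisor_ring v) (?t (divisor_ring v) / (u * monomial m))" by metis
  have "divisor_data \<Delta> ?t u b"
    unfolding divisor_data_def
    by (intro conjI ballI allI impI u b line_bundle_trans(1,2)[OF M])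
  then show ?thesis by (intro exI)
qed

end

section \<open>Ample line bundles\<close>

lemma unit_in_localize_iff:
  assumes "P \<in> prime_spectrum A" "f \<in> A"
  shows "unit_in (localize A P) f \<longleftrightarrow> f \<notin> P"
  using mem_prime_iff[OF assms] subset_localize[OF assms(1)] assms(2) by (auto simp: unit_in_def)

lemma mem_nonvanishing_locus_iff:
  "x \<in> nonvanishing_locus \<Delta> s \<longleftrightarrow> x \<in> toric_surface \<Delta> \<and> unit_in x (s x)"
  by (simp add: nonvanishing_locus_def unit_in_def)

lemma unit_in_mult_iff:
  assumes "mult_closed A" "unit_in A e"
  shows "unit_in A (e * f) \<longleftrightarrow> unit_in A f"
proof
  assume "unit_in A (e * f)"
  then have "unit_in A (e * f / e)" using assms by (intro unit_in_divide)
  moreover have "e * f / e = f" using assms(2) by (simp add: unit_in_def)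
  ultimately show "unit_in A f" by simp
qed (use assms in \<open>intro unit_in_mult\<close>)

definition dual_cone :: "int \<times> int \<Rightarrow> int \<times> int \<Rightarrow> (int \<times> int) set" where
  "dual_cone v w = {m. 0 \<le> pairing m v \<and> 0 \<le> pairing m w}"

text \<open>The maximal ideal of the origin, when the chart of a maximal cone is viewed as an affine
  plane.\<close>

definition vertex_ideal :: "int \<times> int \<Rightarrow> int \<times> int \<Rightarrow> 'k::field function_field set" where
  "vertex_ideal v w = {f \<in> monomial_span (dual_cone v w). coefficient 0 f = 0}"

text \<open>The local ring of the torus fixed point of a maximal cone.\<close>

definition fixed_point :: "int \<times> int \<Rightarrow> int \<times> int \<Rightarrow> 'k::field point" where
  "fixed_point v w = localize (monomial_span (dual_cone v w)) (vertex_ideal v w)"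

lemma subring_dual_cone: "subring_set (monomial_span (dual_cone v w))"
  by (rule subring_monomial_span) (auto simp: dual_cone_def pairing_simps)

section \<open>Units at the fixed point of a maximal cone\<close>

context chart
begin

lemma cone_points_dual_cone: "cone_points True True = dual_cone v w"
  by (simp add: cone_points_def dual_cone_def)

lemma var_powers_True: "var_powers True True = {1 :: 'k fract poly poly}"
  by (auto simp: var_powers_def)

lemma dual_cone_phi:
  assumes "(f :: 'k function_field) \<in> monomial_span (dual_cone v w)"
  obtains p where "f = \<phi> p"
proof -
  have "f \<in> fractions {1}"
    using assms fractions_var_powers[of True True] by (simp add: cone_points_dual_cone var_powers_True)
  then show ?thesis using that by (auto simp: fractions_def one)
qed

lemma phi_dual_cone: "\<phi> p \<in> monomial_span (dual_cone v w)"
  using phi_mem[of p] by (simp add: cone_points_dual_cone)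

text \<open>In the coordinates of the chart this is the constant term of a polynomial, the value at
  the fixed point.\<close>

lemma coefficient_0_mult:
  fixes f g :: "'k function_field"
  assumes "f \<in> monomial_span (dual_cone v w)" "g \<in> monomial_span (dual_cone v w)"
  shows "coefficient 0 (f * g) = coefficient 0 f * coefficient 0 g"
proof -
  obtain p q where pq: "f = \<phi> p" "g = \<phi> q" using dual_cone_phi assms by metis
  have *: "coefficient 0 (\<phi> r) = the_scalar (coeff (coeff r 0) 0)" for r
    using coefficient_phi[of 0 0 r] by (simp add: dual_point_0)
  show ?thesis unfolding pq mult[symmetric] * by (simp add: coeff_mult_0)
qed

lemma vertex_ideal_prime:
  "(vertex_ideal v w :: 'k function_field set) \<in> prime_spectrum (monomial_span (dual_cone v w))"
proof (rule prime_spectrumI[OF subring_dual_cone])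
  let ?A = "monomial_span (dual_cone v w) :: 'k function_field set"
  note closed = monomial_span_closed subring_setD(4)[OF subring_dual_cone]
  show "vertex_ideal v w \<subseteq> ?A" "0 \<in> (vertex_ideal v w :: 'k function_field set)"
    using closed(1) by (auto simp: vertex_ideal_def)
  have "coefficient 0 (1 :: 'k function_field) = 1" using coefficient_monomial[of 0 0] by simp
  then show "1 \<notin> (vertex_ideal v w :: 'k function_field set)" by (simp add: vertex_ideal_def)
  show "x + y \<in> vertex_ideal v w" if "x \<in> vertex_ideal v w" "y \<in> vertex_ideal v w" for x y :: "'k function_field"
  proof -
    have "x \<in> ?A" "y \<in> ?A" "coefficient 0 x = 0" "coefficient 0 y = 0"
      using that by (simp_all add: vertex_ideal_def)
    then show ?thesis
      unfolding vertex_ideal_def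
      by (intro CollectI conjI closed(2))
        (simp_all add: coefficient_add[OF monomial_span_subset_laurent monomial_span_subset_laurent])
  qed
  show "x * y \<in> vertex_ideal v w" if "x \<in> ?A" "y \<in> vertex_ideal v w" for x y
    using that closed(5)[of x v w y] by (simp add: vertex_ideal_def coefficient_0_mult)
  show "x \<in> vertex_ideal v w \<or> y \<in> vertex_ideal v w"
    if "x \<in> ?A" "y \<in> ?A" "x * y \<in> vertex_ideal v w" for x y
    using that by (simp add: vertex_ideal_def coefficient_0_mult)
qed

lemma unit_in_fixed_point_iff:
  "f \<in> monomial_span (dual_cone v w) \<Longrightarrow> unit_in (fixed_point v w) f \<longleftrightarrow> coefficient 0 f \<noteq> (0 :: 'k)"
  unfolding fixed_point_def by (subst unit_in_localize_iff[OF vertex_ideal_prime]) (auto simp: vertex_ideal_def)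

end

context smooth_fan
begin

context
  fixes v w :: "int \<times> int"
    and t :: "'k::field point \<Rightarrow> 'k function_field" and u :: "'k function_field" and a :: "int \<times> int \<Rightarrow> int"
    and p :: "int \<times> int"
  assumes det: "det2 v w * det2 v w = 1"
    and rays: "v \<in> rays \<Delta>" "w \<in> rays \<Delta>"
    and cone: "convex_cone hull (lat ` {v, w}) \<in> \<Delta>"
    and t: "divisor_data \<Delta> t u a"
    and p: "pairing p v = - a v" "pairing p w = - a w"
begin

interpretation chart v w "chart_map v w :: 'k fract poly poly \<Rightarrow> 'k function_field"
  by unfold_locales (simp_all add: det)

lemma chart_ring_maximal: "chart_ring (convex_cone hull (lat ` {v, w})) = monomial_span (dual_cone v w)"
  using chart_ring_cone[of "{v, w}"] by (simp add: cone_points_dual_cone)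

lemma fixed_point_local_ring:
  "(fixed_point v w :: 'k point) \<in> local_rings (chart_ring (convex_cone hull (lat ` {v, w})))"
  unfolding chart_ring_maximal fixed_point_def local_rings_def by (rule imageI[OF vertex_ideal_prime])

lemma fixed_point_mem: "(fixed_point v w :: 'k point) \<in> toric_surface \<Delta>"
  using UN_upper[OF cone, of "\<lambda>\<sigma>. local_rings (chart_ring \<sigma>)"] fixed_point_local_ring
  unfolding toric_surface_def by (rule subsetD)

lemma local_generator_codim1:
  assumes "y \<in> local_rings laurent \<or> y = divisor_ring v \<or> y = divisor_ring w"
  shows "unit_in y (t y / (u * monomial (- p)))"
  using assms
proof (elim disjE)
  assume y: "y \<in> local_rings laurent"
  then have "y \<in> toric_surface \<Delta>" using torus_points by (rule subsetD[rotated])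
  then have "unit_in y (t y / u / monomial (- p))"
    by (intro unit_in_divide mult_closed_point divisor_dataD(4)[OF t y] torus_monomial[OF y])
  then show ?thesis by simp
qed (use divisor_dataD(5)[OF t rays(1), of "- p"] divisor_dataD(5)[OF t rays(2), of "- p"] p
    in \<open>simp_all add: pairing_simps\<close>)

text \<open>The character \<open>- p\<close> has the right order along both divisors through the
  fixed point. If the quotient or its inverse were not regular there, this would show on the torus
  or along one of these divisors.\<close>

lemma local_generator_fixed_point:
  "unit_in (fixed_point v w) (t (fixed_point v w) / (u * monomial (- p)))"
proof -
  let ?x = "fixed_point v w :: 'k point" and ?q = "u * monomial (- p)"
  have *: "F \<in> ?x" if F: "F = t ?x / ?q \<or> F = inverse (t ?x / ?q)" for F
  proof (rule ccontr)
    assume "F \<notin> ?x"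
    from not_mem_point_cases[OF det cone refl subset_refl fixed_point_local_ring this]
    obtain y where y: "F \<notin> y" "specializes \<Delta> y ?x"
      "y \<in> local_rings laurent \<or> (\<exists>v\<in>{v, w}. y = divisor_ring v)" .
    then have y': "y \<in> local_rings laurent \<or> y = divisor_ring v \<or> y = divisor_ring w" by auto
    then have yX: "y \<in> toric_surface \<Delta>"
      using torus_points divisor_ring_point rays by (metis subsetD)
    have "unit_in y (t ?x / t y * (t y / ?q))"
      by (intro unit_in_mult mult_closed_point[OF yX] divisor_dataD(3)[OF t fixed_point_mem yX y(2)]
          local_generator_codim1 y')
    then have "unit_in y (t ?x / ?q)" using divisor_dataD(2)[OF t yX] by simp
    then show False using y(1) F unfolding unit_in_def by blast
  qed
  show ?thesis
    using *[of "t ?x / ?q"] *[of "inverse (t ?x / ?q)"] divisor_dataD(1)[OF t] divisor_dataD(2)[OF t fixed_point_mem]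
    by (simp add: unit_in_def)
qed

lemma section_at_point:
  assumes "y \<in> toric_surface \<Delta>" "unit_in y (t y / (u * monomial (- p)))"
  shows "unit_in y (t y ^ n * f) \<longleftrightarrow> unit_in y (monomial (- p) ^ n * (u ^ n * f))"
proof -
  note mc = mult_closed_point[OF assms(1)]
  have "t y ^ n * f = (t y / (u * monomial (- p))) ^ n * (monomial (- p) ^ n * (u ^ n * f))"
    using divisor_dataD(1)[OF t] by (simp add: power_divide power_mult_distrib)
  then show ?thesis
    by (simp only: unit_in_mult_iff[OF mc unit_in_power[OF mc assms(2)]])
qed

lemma monomial_power: "monomial m ^ n = monomial (int n * fst m, int n * snd m)"
  using monomial_powi[of m "int n"] by simp

lemma section_chart:
  assumes "u ^ n * f \<in> monomial_span (lattice_polygon (rays \<Delta>) (\<lambda>v. int n * a v))"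
  shows "monomial (- p) ^ n * (u ^ n * f) \<in> monomial_span (dual_cone v w)"
proof -
  let ?m = "(int n * fst (- p), int n * snd (- p))"
  have m: "pairing ?m l = - (int n * pairing p l)" for l by (simp add: pairing_def algebra_simps)
  have "lattice_polygon (rays \<Delta>) (\<lambda>v. int n * a v) \<subseteq> {k. ?m + k \<in> dual_cone v w}"
  proof
    fix k assume "k \<in> lattice_polygon (rays \<Delta>) (\<lambda>v. int n * a v)"
    then have "- (int n * a v) \<le> pairing k v" "- (int n * a w) \<le> pairing k w"
      using rays by (auto simp: lattice_polygon_def)
    then show "k \<in> {k. ?m + k \<in> dual_cone v w}"
      by (simp add: dual_cone_def pairing_simps m p del: fst_uminus snd_uminus)
  qed
  then have "u ^ n * f \<in> monomial_span {k. ?m + k \<in> dual_cone v w}"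
    using assms monomial_span_mono by blast
  then have "monomial ?m * (u ^ n * f) \<in> monomial_span {k. k \<in> dual_cone v w}"
    using monomial_shift_iff[of ?m _ "\<lambda>k. k \<in> dual_cone v w"] by metis
  then show ?thesis by (simp add: monomial_power)
qed

text \<open>Non-vanishing at the fixed point is a nonzero constant term in the chart, that is, the
  character \<open>n p\<close> occurs in the section. So \<open>n p\<close> lies in the polygon of
  \<open>n a\<close>, and dividing by \<open>n\<close> gives the claim for \<open>p\<close>, so far
  only the solution of two equations.\<close>

lemma vertex_mem_polygon:
  assumes f: "u ^ n * f \<in> monomial_span (lattice_polygon (rays \<Delta>) (\<lambda>v. int n * a v))"
    and n: "n \<ge> 1" and nz: "unit_in (fixed_point v w) (t (fixed_point v w) ^ n * f)"
  shows "p \<in> lattice_polygon (rays \<Delta>) a"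
    and "coefficient 0 (monomial (- p) ^ n * (u ^ n * f)) \<noteq> 0"
proof -
  show c: "coefficient 0 (monomial (- p) ^ n * (u ^ n * f)) \<noteq> 0"
    using nz unfolding section_at_point[OF fixed_point_mem local_generator_fixed_point]
      unit_in_fixed_point_iff[OF section_chart[OF f]] .
  let ?m = "(int n * fst (- p), int n * snd (- p))"
  have "coefficient (0 - ?m) (u ^ n * f) \<noteq> 0"
    using c coefficient_monomial_mult[OF monomial_span_subset_laurent[OF f], of 0 ?m]
    by (simp add: monomial_power)
  then have "0 - ?m \<in> lattice_polygon (rays \<Delta>) (\<lambda>v. int n * a v)"
    using coefficient_outside[OF f] by blast
  moreover have "pairing (0 - ?m) l = int n * pairing p l" for l by (simp add: pairing_def algebra_simps)
  ultimately have "int n * (- a l) \<le> int n * pairing p l" if "l \<in> rays \<Delta>" for l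
    using that by (auto simp: lattice_polygon_def)
  then show "p \<in> lattice_polygon (rays \<Delta>) a"
    using n unfolding lattice_polygon_def by (intro CollectI ballI) (metis int_one_le_iff_zero_less
        mult_le_cancel_left_pos of_nat_1 of_nat_le_iff)
qed

text \<open>
  On the affine chart of the maximal cone, the non-vanishing locus of a section is the complement
  of the zeros of its local expression, and the functions on it are fractions with powers of this
  expression in the denominator.
\<close>

lemma regular_function_on_locus:
  assumes f: "u ^ n * f \<in> monomial_span (lattice_polygon (rays \<Delta>) (\<lambda>v. int n * a v))"
    and nz: "u ^ n * f \<noteq> 0"
    and h: "\<And>y. y \<in> toric_surface \<Delta> \<Longrightarrow> unit_in y (t y ^ n * f) \<Longrightarrow> h \<in> y"
  shows "\<exists>N. h * (monomial (- p) ^ n * (u ^ n * f)) ^ N \<in> monomial_span (dual_cone v w)"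
proof -
  obtain g where g: "monomial (- p) ^ n * (u ^ n * f) = chart_map v w g"
    using dual_cone_phi[OF section_chart[OF f]] .
  have "g \<noteq> 0" using nz g zero by (metis monomial_neq_0 mult_eq_0_iff power_not_zero)
  have S: "mult_set (range (\<lambda>N. g ^ N))"
    unfolding mult_set_def
  proof (intro conjI ballI)
    show "1 \<in> range (\<lambda>N. g ^ N)" by (rule range_eqI[of _ _ 0]) simp
    show "0 \<notin> range (\<lambda>N. g ^ N)" using \<open>g \<noteq> 0\<close> by auto
    show "x * y \<in> range (\<lambda>N. g ^ N)" if "x \<in> range (\<lambda>N. g ^ N)" "y \<in> range (\<lambda>N. g ^ N)" for x y
      using that by (auto simp flip: power_add)
  qed
  have "h \<in> fractions (range (\<lambda>N. g ^ N))"
  proof (rule mem_fractionsI[OF S])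
    fix r :: "'k fract poly poly" assume r: "prime_elem r" "\<forall>s\<in>range (\<lambda>N. g ^ N). \<not> r dvd s"
    then have rg: "\<not> r dvd g" by (metis power_one_right rangeI)
    have "\<forall>s\<in>var_powers True True. \<not> r dvd s" using r(1) unfolding var_powers_True by auto
    with r(1) have y: "val_ring r \<in> local_rings laurent \<or> val_ring r = divisor_ring v \<or> val_ring r = divisor_ring w"
      by (cases rule: val_ring_cases) auto
    then have yX: "val_ring r \<in> toric_surface \<Delta>"
      using torus_points divisor_ring_point rays by (metis subsetD)
    have "unit_in (val_ring r) (chart_map v w g)" by (rule unit_in_val_ring[OF r(1) rg])
    then have "unit_in (val_ring r) (t (val_ring r) ^ n * f)"
      unfolding section_at_point[OF yX local_generator_codim1[OF y]] g .
    then show "h \<in> val_ring r" by (rule h[OF yX])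
  qed
  then obtain c N where cN: "h = chart_map v w c / chart_map v w (g ^ N)" by (auto simp: fractions_def)
  then have "h * chart_map v w g ^ N = chart_map v w c"
    using \<open>g \<noteq> 0\<close> by (simp add: power eq_0_iff)
  then show ?thesis unfolding g using phi_dual_cone by metis
qed

text \<open>The local expression of the section is a unit at the fixed point, so multiplying
  \<open>h\<close> by its powers changes nothing. The resulting criterion is a constant term, which
  does not mention the cone.\<close>

lemma unit_in_fixed_point_locus:
  assumes f: "u ^ n * f \<in> monomial_span (lattice_polygon (rays \<Delta>) (\<lambda>v. int n * a v))"
    and c: "coefficient 0 (monomial (- p) ^ n * (u ^ n * f)) \<noteq> 0"
    and h: "h * (monomial (- p) ^ n * (u ^ n * f)) ^ N \<in> monomial_span (dual_cone v w)"
  shows "unit_in (fixed_point v w) (t (fixed_point v w) ^ n * f)"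
    and "unit_in (fixed_point v w) h \<longleftrightarrow> coefficient 0 (h * (monomial (- p) ^ n * (u ^ n * f)) ^ N) \<noteq> 0"
proof -
  let ?g = "monomial (- p) ^ n * (u ^ n * f)"
  have g: "unit_in (fixed_point v w) ?g"
    using c unit_in_fixed_point_iff[OF section_chart[OF f]] by simp
  then show "unit_in (fixed_point v w) (t (fixed_point v w) ^ n * f)"
    unfolding section_at_point[OF fixed_point_mem local_generator_fixed_point] .
  note mc = mult_closed_point[OF fixed_point_mem]
  have "unit_in (fixed_point v w) h \<longleftrightarrow> unit_in (fixed_point v w) (h * ?g ^ N)"
    using unit_in_mult_iff[OF mc unit_in_power[OF mc g], of N h] by (simp add: mult.commute)
  then show "unit_in (fixed_point v w) h \<longleftrightarrow> coefficient 0 (h * ?g ^ N) \<noteq> 0"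
    unfolding unit_in_fixed_point_iff[OF h] .
qed

lemma fixed_point_contains: "monomial_span (dual_cone v w) \<subseteq> (fixed_point v w :: 'k point)"
  unfolding fixed_point_def by (rule subset_localize[OF vertex_ideal_prime])

lemma fixed_point_monomial_nonunit:
  assumes "m \<in> dual_cone v w" "m \<noteq> 0"
  shows "\<not> unit_in (fixed_point v w :: 'k point) (monomial m)"
  using unit_in_fixed_point_iff[OF monomial_span_base[OF assms(1)]] assms(2)
  by (simp add: coefficient_monomial)

end

text \<open>
  If the vertices of two adjacent maximal cones agreed, then a section of a power of \<open>L\<close> that does not
  vanish at one of the two fixed points would not vanish at the other one, and the regular functions on its
  non-vanishing locus could not separate the two points (geometrically, the locus contains the
  projective line joining them). So the locus would not be affine.
\<close>

lemma ample_edge: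
  fixes L :: "'k::field line_bundle"
  assumes L: "ample \<Delta> L" and t: "divisor_data \<Delta> (\<lambda>x. trans L x base_point) u a" and v: "v \<in> rays \<Delta>"
  shows "\<exists>p\<in>lattice_polygon (rays \<Delta>) a. \<exists>q\<in>lattice_polygon (rays \<Delta>) a.
    p \<noteq> q \<and> pairing p v = - a v \<and> pairing q v = - a v"
proof -
  let ?t = "\<lambda>x. trans L x base_point"
  have line: "is_line_bundle \<Delta> L" using L by (simp add: ample_def)
  note cocycle = is_line_bundle_cocycle[OF line]
  have "\<exists>n f. n \<ge> 1 \<and> u ^ n * f \<in> monomial_span (lattice_polygon (rays \<Delta>) (\<lambda>v. int n * a v)) \<and>
      unit_in x (?t x ^ n * f) \<and> affine_open \<Delta> {y \<in> toric_surface \<Delta>. unit_in y (?t y ^ n * f)}"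
    if x: "x \<in> toric_surface \<Delta>" for x
  proof -
    obtain n s where ns: "n \<ge> 1" "s \<in> H0 \<Delta> (tensor_power L n)" "x \<in> nonvanishing_locus \<Delta> s"
      "affine_open \<Delta> (nonvanishing_locus \<Delta> s)"
      using bspec[OF conjunct2[OF L[unfolded ample_def]] x] by (elim exE conjE bexE)
    have tn: "trans (tensor_power L n) y base_point = ?t y ^ n" for y
      by (simp add: tensor_power_def)
    let ?f = "s base_point"
    note sec = H0_section[OF is_cocycle_power[OF cocycle] ns(2), unfolded tn]
    have locus: "nonvanishing_locus \<Delta> s = {y \<in> toric_surface \<Delta>. unit_in y (?t y ^ n * ?f)}"
      using sec(1) by (auto simp: mem_nonvanishing_locus_iff)
    have "u ^ n * ?f \<in> monomial_span (lattice_polygon (rays \<Delta>) (\<lambda>v. int n * a v))"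
      using divisor_data_sections[OF divisor_data_power[OF t, of n], of ?f] sec(2) by simp
    moreover have "unit_in x (?t x ^ n * ?f)" using ns(3) unfolding locus by simp
    ultimately show ?thesis using ns(1,4) unfolding locus by (intro exI conjI)
  qed
  note ample = this
  obtain w where w: "det2 v w = 1" "w \<in> rays \<Delta>" "convex_cone hull (lat ` {v, w}) \<in> \<Delta>"
    using adjacent_cone[OF v, of 1] by auto
  obtain w' where w': "det2 v w' = - 1" "w' \<in> rays \<Delta>" "convex_cone hull (lat ` {v, w'}) \<in> \<Delta>"
    using adjacent_cone[OF v, of "- 1"] by auto
  have det: "det2 v w * det2 v w = 1" "det2 v w' * det2 v w' = 1" using w w' by simp_all
  interpret A: chart v w "chart_map v w :: 'k fract poly poly \<Rightarrow> _" by unfold_locales (simp_all add: det)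
  interpret B: chart v w' "chart_map v w' :: 'k fract poly poly \<Rightarrow> _" by unfold_locales (simp_all add: det)
  define p q where "p = A.dual (- a v) (- a w)" and "q = B.dual (- a v) (- a w')"
  have p: "pairing p v = - a v" "pairing p w = - a w" by (simp_all add: p_def A.pairing_dual)
  have q: "pairing q v = - a v" "pairing q w' = - a w'" by (simp_all add: q_def B.pairing_dual)
  let ?x = "fixed_point v w :: 'k point" and ?y = "fixed_point v w' :: 'k point"
  have x: "?x \<in> toric_surface \<Delta>" by (rule fixed_point_mem[OF det(1) v w(2,3) t p])
  have y: "?y \<in> toric_surface \<Delta>" by (rule fixed_point_mem[OF det(2) v w'(2,3) t q])
  from ample[OF x] obtain n f where nf: "n \<ge> 1" "u ^ n * f \<in> monomial_span (lattice_polygon (rays \<Delta>) (\<lambda>v. int n * a v))"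
    "unit_in ?x (?t ?x ^ n * f)" "affine_open \<Delta> {y \<in> toric_surface \<Delta>. unit_in y (?t y ^ n * f)}"
    by (elim exE conjE)
  have pP: "p \<in> lattice_polygon (rays \<Delta>) a"
    and c: "coefficient 0 (monomial (- p) ^ n * (u ^ n * f)) \<noteq> 0"
    by (rule vertex_mem_polygon[OF det(1) v w(2,3) t p nf(2,1,3)])+
  have qP: "q \<in> lattice_polygon (rays \<Delta>) a"
  proof -
    from ample[OF y] obtain n f where nf: "n \<ge> 1"
      "u ^ n * f \<in> monomial_span (lattice_polygon (rays \<Delta>) (\<lambda>v. int n * a v))"
      "unit_in ?y (?t ?y ^ n * f)"
      by (elim exE conjE)
    show ?thesis by (rule vertex_mem_polygon(1)[OF det(2) v w'(2,3) t q nf(2,1,3)])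
  qed
  have "p \<noteq> q"
  proof
    \<comment> \<open>The same function \<open>?g\<close> is now the local expression of the section
      in both charts, and its constant term decides non-vanishing at both fixed points.\<close>
    assume "p = q"
    then have p': "pairing p v = - a v" "pairing p w' = - a w'" using q by simp_all
    let ?U = "{y \<in> toric_surface \<Delta>. unit_in y (?t y ^ n * f)}"
    let ?A = "regular_functions ?U"
    let ?g = "monomial (- p) ^ n * (u ^ n * f)"
    have nz: "u ^ n * f \<noteq> 0" using c by (metis mult_zero_right coefficient_0)
    have xU: "?x \<in> ?U" using x nf(3) by simp
    have "0 * ?g ^ 0 \<in> monomial_span (dual_cone v w')" by (simp add: monomial_span_closed)
    from unit_in_fixed_point_locus(1)[OF det(2) v w'(2,3) t p' nf(2) c this]
    have yU: "?y \<in> ?U" using y by simp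
    have UA: "?U = local_rings ?A" using nf(4) unfolding affine_open_def by (elim conjE)
    obtain P where P: "P \<in> prime_spectrum ?A" "?x = localize ?A P"
      using subsetD[OF equalityD1[OF UA] xU] unfolding local_rings_def by (elim imageE)
    obtain Q where Q: "Q \<in> prime_spectrum ?A" "?y = localize ?A Q"
      using subsetD[OF equalityD1[OF UA] yU] unfolding local_rings_def by (elim imageE)
    \<comment> \<open>With a common exponent \<open>N + N'\<close>, membership in either prime is
      governed by one and the same constant term.\<close>
    have PQ: "h \<in> P \<longleftrightarrow> h \<in> Q" if h: "h \<in> ?A" for h
    proof -
      have reg: "h \<in> z" if "z \<in> toric_surface \<Delta>" "unit_in z (?t z ^ n * f)" for z
        by (rule InterD[OF h[unfolded regular_functions_def]]) (simp add: that)
      have "\<exists>N. h * ?g ^ N \<in> monomial_span (dual_cone v w)"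
        by (rule regular_function_on_locus[OF det(1) v w(2,3) t p nf(2) nz]) (rule reg)
      then obtain N where N: "h * ?g ^ N \<in> monomial_span (dual_cone v w)" by (elim exE)
      have "\<exists>N. h * ?g ^ N \<in> monomial_span (dual_cone v w')"
        by (rule regular_function_on_locus[OF det(2) v w'(2,3) t p' nf(2) nz]) (rule reg)
      then obtain N' where N': "h * ?g ^ N' \<in> monomial_span (dual_cone v w')" by (elim exE)
      have g: "?g \<in> monomial_span (dual_cone v w)" "?g \<in> monomial_span (dual_cone v w')"
        by (rule section_chart[OF det(1) v w(2,3) t p nf(2)] section_chart[OF det(2) v w'(2,3) t p' nf(2)])+
      have "h * ?g ^ (N + N') = (h * ?g ^ N) * ?g ^ N'" "h * ?g ^ (N + N') = (h * ?g ^ N') * ?g ^ N"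
        by (simp_all add: power_add ac_simps)
      then have 1: "h * ?g ^ (N + N') \<in> monomial_span (dual_cone v w)"
        "h * ?g ^ (N + N') \<in> monomial_span (dual_cone v w')"
        using N N' g subring_setD(4,6)[OF subring_dual_cone] by metis+
      have "h \<in> P \<longleftrightarrow> \<not> unit_in ?x h"
        unfolding P(2) using unit_in_localize_iff[OF P(1) h] by simp
      also have "\<dots> \<longleftrightarrow> \<not> unit_in ?y h"
        unfolding unit_in_fixed_point_locus(2)[OF det(1) v w(2,3) t p nf(2) c 1(1)]
          unit_in_fixed_point_locus(2)[OF det(2) v w'(2,3) t p' nf(2) c 1(2)] ..
      also have "\<dots> \<longleftrightarrow> h \<in> Q"
        unfolding Q(2) using unit_in_localize_iff[OF Q(1) h] by simp
      finally show ?thesis .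
    qed
    have "P = Q" using PQ prime_spectrumD(1)[OF P(1)] prime_spectrumD(1)[OF Q(1)] by (auto dest: subsetD)
    then have xy: "?x = ?y" using P(2) Q(2) by simp
    \<comment> \<open>A coordinate on the line joining the two fixed points: regular and vanishing
      at one, with inverse regular at the other. Hence the two local rings differ.\<close>
    let ?e = "perp v"
    have e: "pairing ?e v = 0" "pairing ?e w = 1" "pairing ?e w' = - 1"
      using w(1) w'(1) by (simp_all add: pairing_perp) (simp add: det2_def)
    then have e1: "?e \<in> dual_cone v w" "- ?e \<in> dual_cone v w'" "?e \<noteq> 0"
      by (auto simp: dual_cone_def pairing_simps)
    have "monomial ?e \<in> ?x"
      using fixed_point_contains[OF det(1) v w(2,3) t p] monomial_span_base[OF e1(1)] by (rule subsetD)
    moreover have "monomial (- ?e) \<in> ?x"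
      unfolding xy using fixed_point_contains[OF det(2) v w'(2,3) t p'] monomial_span_base[OF e1(2)]
      by (rule subsetD)
    ultimately have "unit_in ?x (monomial ?e)" by (simp add: unit_in_def monomial_uminus)
    then show False using fixed_point_monomial_nonunit[OF det(1) v w(2,3) t p e1(1,3)] by simp
  qed
  then show ?thesis using pP qP p(1) q(1) by metis
qed

end

section \<open>The cokernel\<close>

text \<open>Each element of \<open>B\<close> is congruent modulo \<open>W\<close> to an element of
  the span of \<open>N\<close>. Independence of \<open>B\<close> modulo \<open>W\<close> makes these
  representatives distinct and independent.\<close>

lemma quotient_dim_le:
  fixes sc :: "'k::field \<Rightarrow> 'v::ab_group_add \<Rightarrow> 'v"
  assumes "vector_space sc" and W: "module.subspace sc W" and N: "finite N"
    and V: "V \<subseteq> module.span sc (N \<union> W)"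
  shows "quotient_dim sc V W \<le> enat (card N)"
  unfolding quotient_dim_def
proof (rule SUP_least)
  interpret V: vector_space sc by fact
  fix B assume "B \<in> {B. finite B \<and> B \<subseteq> V \<and> (\<forall>c. (\<Sum>b\<in>B. sc (c b) b) \<in> W \<longrightarrow> (\<forall>b\<in>B. c b = 0))}"
  then have B: "finite B" "B \<subseteq> V" "\<And>c b. (\<Sum>b\<in>B. sc (c b) b) \<in> W \<Longrightarrow> b \<in> B \<Longrightarrow> c b = 0" by auto
  have "\<exists>x. x \<in> V.span N \<and> b - x \<in> W" if "b \<in> B" for b
  proof -
    have "b \<in> {x + y | x y. x \<in> V.span N \<and> y \<in> V.span W}"
      using that B(2) V unfolding V.span_Un by blast
    moreover have "V.span W = W" using W by (simp add: V.span_eq_iff)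
    ultimately show ?thesis by auto
  qed
  then obtain \<pi> where \<pi>: "\<And>b. b \<in> B \<Longrightarrow> \<pi> b \<in> V.span N" "\<And>b. b \<in> B \<Longrightarrow> b - \<pi> b \<in> W" by metis
  have *: "c b = 0" if "(\<Sum>b\<in>B. sc (c b) (\<pi> b)) = 0" "b \<in> B" for c b
  proof -
    have "(\<Sum>b\<in>B. sc (c b) b) = (\<Sum>b\<in>B. sc (c b) (b - \<pi> b)) + (\<Sum>b\<in>B. sc (c b) (\<pi> b))"
      by (simp add: V.scale_right_diff_distrib flip: sum.distrib)
    also have "\<dots> \<in> W"
      using that(1) \<pi>(2) by (simp add: V.subspace_sum[OF W] V.subspace_scale[OF W])
    finally show ?thesis using B(3) that(2) by blast
  qed
  have inj: "inj_on \<pi> B"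
  proof (rule inj_onI, rule ccontr)
    fix b b' assume b: "b \<in> B" "b' \<in> B" "\<pi> b = \<pi> b'" "b \<noteq> b'"
    let ?c = "\<lambda>x. if x = b then 1 else if x = b' then - 1 else 0 :: 'k"
    have "(\<Sum>x\<in>B. sc (?c x) (\<pi> x)) = (\<Sum>x\<in>{b, b'}. sc (?c x) (\<pi> x))"
      using B(1) b by (intro sum.mono_neutral_right) auto
    also have "\<dots> = 0" using b by simp
    finally have "(\<Sum>x\<in>B. sc (?c x) (\<pi> x)) = 0" .
    from *[of ?c, OF this b(1)] have "?c b = 0" .
    then show False by simp
  qed
  have "V.independent (\<pi> ` B)"
  proof (rule V.independent_if_scalars_zero)
    fix f x assume f: "(\<Sum>x\<in>\<pi> ` B. sc (f x) x) = 0" and "x \<in> \<pi> ` B"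
    then obtain b where b: "b \<in> B" "x = \<pi> b" by blast
    have "(\<Sum>b\<in>B. sc (f (\<pi> b)) (\<pi> b)) = 0" using f by (simp add: sum.reindex[OF inj])
    then show "f x = 0" using b *[of "\<lambda>b. f (\<pi> b)"] by blast
  qed (use B(1) in simp)
  moreover have "\<pi> ` B \<subseteq> V.span N" using \<pi>(1) by blast
  ultimately have "card (\<pi> ` B) \<le> card N" using V.independent_span_bound[OF N] by blast
  then show "enat (card B) \<le> enat (card N)" by (simp add: card_image[OF inj])
qed

context smooth_fan
begin

text \<open>Inverse to taking the expression of a section at the generic point and multiplying it by
  \<open>u\<close>.\<close>

definition section_of ::
  "('k::field point \<Rightarrow> 'k function_field) \<Rightarrow> 'k function_field \<Rightarrow> 'k function_field \<Rightarrow> 'k section_family" where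
  "section_of t u g = (\<lambda>x. if x \<in> toric_surface \<Delta> then t x * (g / u) else 0)"

lemma section_of_H0:
  fixes M :: "'k::field line_bundle"
  assumes "is_cocycle \<Delta> M" "divisor_data \<Delta> (\<lambda>x. trans M x base_point) u b"
    "m \<in> lattice_polygon (rays \<Delta>) b"
  shows "section_of (\<lambda>x. trans M x base_point) u (monomial m) \<in> H0 \<Delta> M"
  unfolding section_of_def
proof (rule H0_from_base_point[OF assms(1)])
  have "u * (monomial m / u) \<in> monomial_span (lattice_polygon (rays \<Delta>) b)"
    using divisor_dataD(1)[OF assms(2)] monomial_span_base[OF assms(3)] by simp
  then have "\<forall>x\<in>toric_surface \<Delta>. trans M x base_point * (monomial m / u) \<in> x"
    by (rule iffD2[OF divisor_data_sections[OF assms(2)]])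
  then show "trans M x base_point * (monomial m / u) \<in> x" if "x \<in> toric_surface \<Delta>" for x
    using that by (rule bspec)
qed

text \<open>A character outside \<open>D\<close> is a sum of characters of the two polygons, and its
  section is the product of theirs. So the sections of the characters in \<open>D\<close> span the
  cokernel.\<close>

lemma coker_dim_le:
  fixes L M :: "'k::field line_bundle"
  assumes L: "is_line_bundle \<Delta> L" "divisor_data \<Delta> (\<lambda>x. trans L x base_point) u a"
    and M: "is_line_bundle \<Delta> M" "divisor_data \<Delta> (\<lambda>x. trans M x base_point) u' b"
    and D: "D = lattice_polygon (rays \<Delta>) (\<lambda>v. a v + b v) -
      {p + q | p q. p \<in> lattice_polygon (rays \<Delta>) a \<and> q \<in> lattice_polygon (rays \<Delta>) b}" "finite D"
  shows "coker_dim \<Delta> L M \<le> enat (card D)"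
proof -
  interpret S: vector_space "sec_scale :: 'k \<Rightarrow> _" by (rule vector_space_sec_scale)
  let ?l = "\<lambda>x. trans L x base_point" and ?m = "\<lambda>x. trans M x base_point"
  let ?t = "\<lambda>x. ?l x * ?m x"
  note cL = is_line_bundle_cocycle[OF L(1)] and cM = is_line_bundle_cocycle[OF M(1)]
  note data = divisor_data_mult[OF L(2) M(2)]
  let ?\<Phi> = "section_of ?t (u * u')"
  let ?N = "(\<lambda>m. ?\<Phi> (monomial m)) ` D"
  let ?W = "mult_image \<Delta> L M"
  have W: "S.subspace ?W" unfolding mult_image_def by (rule S.subspace_span)
  have \<Phi>: "?\<Phi> g \<in> S.span (?N \<union> ?W)"
    if "g \<in> monomial_span (lattice_polygon (rays \<Delta>) (\<lambda>v. a v + b v))" for g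
    using that
  proof (induction rule: monomial_span_induct)
    case zero
    have "?\<Phi> 0 = 0" by (simp add: section_of_def fun_eq_iff)
    then show ?case by (simp only: S.span_zero)
  next
    case (step c m g)
    have "?\<Phi> (monomial m) \<in> ?N \<union> ?W"
    proof (cases "m \<in> D")
      case True
      then show ?thesis by (intro UnI1 imageI)
    next
      case False
      then obtain p q where pq: "m = p + q" "p \<in> lattice_polygon (rays \<Delta>) a"
        "q \<in> lattice_polygon (rays \<Delta>) b" using step(1) unfolding D by blast
      have "?\<Phi> (monomial m) = section_of ?l u (monomial p) * section_of ?m u' (monomial q)"
        by (simp add: section_of_def fun_eq_iff pq(1) monomial_add)
      then have "?\<Phi> (monomial m) \<in> {s * t | s t. s \<in> H0 \<Delta> L \<and> t \<in> H0 \<Delta> M}"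
        using section_of_H0[OF cL L(2) pq(2)] section_of_H0[OF cM M(2) pq(3)] by blast
      then show ?thesis unfolding mult_image_def by (intro UnI2 S.span_base)
    qed
    then have m: "?\<Phi> (monomial m) \<in> S.span (?N \<union> ?W)" by (rule S.span_base)
    have eq: "?\<Phi> (scale c (monomial m) + g) = sec_scale c (?\<Phi> (monomial m)) + ?\<Phi> g"
      by (simp add: section_of_def sec_scale_def scale_def fun_eq_iff algebra_simps add_divide_distrib)
    show ?case unfolding eq by (intro S.span_add S.span_scale m step(2))
  qed
  have V: "H0 \<Delta> (tensor L M) \<subseteq> S.span (?N \<union> ?W)"
  proof
    fix s assume s: "s \<in> H0 \<Delta> (tensor L M)"
    note sec = H0_section[OF is_cocycle_tensor[OF cL cM] s, unfolded tensor_simps]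
    have "\<forall>x\<in>toric_surface \<Delta>. ?t x * s base_point \<in> x"
      using sec(2) by (rule ballI)
    from iffD1[OF divisor_data_sections[OF data] this]
    have "?\<Phi> (u * u' * s base_point) \<in> S.span (?N \<union> ?W)" by (rule \<Phi>)
    moreover have "?\<Phi> (u * u' * s base_point) = s"
    proof
      fix x
      show "?\<Phi> (u * u' * s base_point) x = s x"
        using sec(1)[of x] H0_D(3)[OF s, of x] divisor_dataD(1)[OF data] by (simp add: section_of_def)
    qed
    ultimately show "s \<in> S.span (?N \<union> ?W)" by (simp only:)
  qed
  have "coker_dim \<Delta> L M \<le> enat (card ?N)"
    unfolding coker_dim_def by (rule quotient_dim_le[OF vector_space_sec_scale W _ V]) (use D(2) in simp)
  also have "\<dots> \<le> enat (card D)" using card_image_le[OF D(2)] by simp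
  finally show ?thesis .
qed

lemma polygon_nonempty:
  fixes M :: "'k::field line_bundle"
  assumes M: "is_line_bundle \<Delta> M" "divisor_data \<Delta> (\<lambda>x. trans M x base_point) u b"
    and "H0 \<Delta> M \<noteq> {0}"
  shows "lattice_polygon (rays \<Delta>) b \<noteq> {}"
proof
  assume P: "lattice_polygon (rays \<Delta>) b = {}"
  interpret S: vector_space "sec_scale :: 'k \<Rightarrow> _" by (rule vector_space_sec_scale)
  note cM = is_line_bundle_cocycle[OF M(1)]
  have "s = 0" if s: "s \<in> H0 \<Delta> M" for s
  proof
    fix x
    note sec = H0_section[OF cM s]
    have "\<forall>x\<in>toric_surface \<Delta>. trans M x base_point * s base_point \<in> x"
      using sec(2) by (rule ballI)
    from iffD1[OF divisor_data_sections[OF M(2)] this]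
    have "u * s base_point \<in> monomial_span {}" unfolding P .
    then have "s base_point = 0" using divisor_dataD(1)[OF M(2)] by (simp add: monomial_span_def)
    then show "s x = 0 x" using sec(1)[of x] H0_D(3)[OF s, of x] by (cases "x \<in> toric_surface \<Delta>") auto
  qed
  moreover have "0 \<in> H0 \<Delta> M"
    using subspace_H0[of \<Delta> M] cover_subset[OF M(1)] by (intro S.subspace_0) blast
  ultimately show False using assms(3) by (metis (no_types) subsetI singletonI singletonD set_eq_iff)
qed

end

theorem theorem2:
  fixes \<Delta> :: "(real \<times> real) set set" and L :: "('k::field) line_bundle"
  assumes "smooth_complete_fan \<Delta>" and "ample \<Delta> L"
  shows "\<exists>C::nat. \<forall>M::'k line_bundle.
           is_line_bundle \<Delta> M \<and> H0 \<Delta> M \<noteq> {0} \<longrightarrow> coker_dim \<Delta> L M \<le> enat C"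
proof -
  interpret smooth_fan \<Delta> by unfold_locales (rule assms(1))
  have L: "is_line_bundle \<Delta> L" using assms(2) by (simp add: ample_def)
  obtain u a where a: "divisor_data \<Delta> (\<lambda>x. trans L x base_point) u a"
    using line_bundle_divisor_data[OF L] by (elim exE)
  let ?P = "lattice_polygon (rays \<Delta>)"
  let ?D = "\<lambda>b. ?P (\<lambda>v. a v + b v) - {p + q | p q. p \<in> ?P a \<and> q \<in> ?P b}"
  have "\<exists>C. \<forall>b. ?P b \<noteq> {} \<longrightarrow> finite (?D b) \<and> card (?D b) \<le> C"
    by (rule finitely_many_non_sums[OF finite_rays rays_nonempty ray_parallel ray_witness
          ample_edge[OF assms(2) a]])
  then obtain C where C: "\<forall>b. ?P b \<noteq> {} \<longrightarrow> finite (?D b) \<and> card (?D b) \<le> C" by (elim exE)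
  show ?thesis
  proof (intro exI[of _ C] allI impI)
    fix M :: "'k line_bundle" assume M: "is_line_bundle \<Delta> M \<and> H0 \<Delta> M \<noteq> {0}"
    obtain u' b where b: "divisor_data \<Delta> (\<lambda>x. trans M x base_point) u' b"
      using line_bundle_divisor_data[OF conjunct1[OF M]] by (elim exE)
    have "?P b \<noteq> {}" by (rule polygon_nonempty[OF conjunct1[OF M] b conjunct2[OF M]])
    then have D: "finite (?D b)" "card (?D b) \<le> C" using C by blast+
    have "coker_dim \<Delta> L M \<le> enat (card (?D b))"
      by (rule coker_dim_le[OF L a conjunct1[OF M] b refl D(1)])
    also have "\<dots> \<le> enat C" using D(2) by simp
    finally show "coker_dim \<Delta> L M \<le> enat C" .
  qed
qed

end
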